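(* Let $d\geqslant 1$, let $0<\alpha<2$, let $\Omega$ be a finite (nonempty) subgraph of $\mathbb{Z}^d$, and let $\lambda_1(\Omega)\leqslant\lambda_2(\Omega)\leqslant\dots\leqslant\lambda_{|\Omega|}(\Omega)$ be the eigenvalues, counted with multiplicity, of the operator $L^\alpha_\Omega$, the fractional Laplacian $(-\Delta)^{\frac{\alpha}{2}}$ on $\Omega$ with Dirichlet boundary condition. Then: (a) For all integers $k$ with $1\leqslant k\leqslant\min\{1,\frac{V_d}{2^d}\}|\Omega|$, $$\frac{1}{k}\sum_{i=1}^k\lambda_i(\Omega)\leqslant(2\pi)^\alpha\frac{d}{d+\alpha}\left(\frac{k}{V_d|\Omega|}\right)^{\frac{\alpha}{d}}+\frac{|\partial^\alpha\Omega|}{|\Omega|}.$$ For all integers $k$ with $1\leqslant k\leqslant\min\{1,\frac{V_d}{2^{d+1}}\}|\Omega|$, $$\lambda_{k+1}(\Omega)\leqslant(2\pi)^\alpha\frac{d\cdot 2^{\frac{d+\alpha}{d}}}{d+\alpha}\left(\frac{k}{V_d|\Omega|}\right)^{\frac{\alpha}{d}}+2\frac{|\partial^\alpha\Omega|}{|\Omega|}.$$ (b) For all integers $k$ with $1\leqslant k\leqslant\min\left\{1,\left(\frac{2^{1-\frac{1}{\alpha}}\sqrt{3}}{2\pi}\right)^dV_d\right\}|\Omega|$, $$\lambda_k(\Omega)\geqslant\frac{1}{k}\sum_{i=1}^k\lambda_i(\Omega)\geqslant(2\pi)^\alpha\frac{d}{d+\alpha}\left(\frac{k}{V_d|\Om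ega|}\right)^{\frac{\alpha}{d}}-(2\pi)^{2\alpha}\left(\frac{1}{12}\right)^{\frac{\alpha}{2}}\frac{d}{d+2\alpha}\left(\frac{k}{V_d|\Omega|}\right)^{\frac{2\alpha}{d}}.$$
   Context: $\mathbb{Z}^d$ is the integer lattice regarded as a graph, with $x\sim y$ iff $x-y\in\{\pm e_1,\dots,\pm e_d\}$, where $e_i$ are the standard unit vectors. The graph Laplacian is $\Delta f(x)=\sum_{y\sim x}(f(y)-f(x))$. The heat kernel $p(t,x,y)$ on $\mathbb{Z}^d$ is the kernel of the heat semigroup $e^{t\Delta}$: $e^{t\Delta}u(x)=\sum_{y}p(t,x,y)u(y)$ for bounded $u$; equivalently, for each $y$, $(t,x)\mapsto p(t,x,y)$ is the bounded solution of $\partial_t v=\Delta v$ with initial value $1_{\{x=y\}}$. For $0<\alpha<2$ the fractional Laplacian is $$(-\Delta)^{\frac{\alpha}{2}}u(x)=\frac{1}{|\Gamma(-\frac{\alpha}{2})|}\int_0^\infty(u(x)-e^{t\Delta}u(x))t^{-1-\frac{\alpha}{2}}dt,$$ which, for bounded $u$, equals $\sum_{y\neq x}Q_\alpha(x,y)(u(x)-u(y))$, where for $x\neq y$ $$Q_\alpha(x,y)=\frac{1}{|\Gamma(-\frac{\alpha}{2})|}\int_0^\infty t^{-1-\frac{\alpha}{2}}p(t,x,y)\,dt.$$ A subgraph of a graph $(V,E)$ is a graph $(V_1,E_1)$ with $V_1\subset V$, $E_1\subset E$. For a finite subgraph $\Omega$ of $\mathbb{Z}^d$, we identify $\Omega$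 with its vertex set, $|\Omega|$ is its number of vertices, and $\Omega^c$ is the set of vertices of $\mathbb{Z}^d$ not in $\Omega$. For $u:\Omega\to\mathbb{C}$, let $u^*:\mathbb{Z}^d\to\mathbb{C}$ be its extension by zero. The fractional Laplacian with Dirichlet boundary condition on $\Omega$ is the operator $L^\alpha_\Omega u=\big((-\Delta)^{\frac{\alpha}{2}}u^*\big)|_\Omega$ on functions $u:\Omega\to\mathbb{C}$; it is a real symmetric operator on a space of dimension $|\Omega|$. The boundary term is $$|\partial^\alpha\Omega|=\sum_{x\in\Omega^c,\,y\in\Omega}Q_\alpha(x,y)<+\infty.$$ $V_d$ is the volume of the unit ball in $\mathbb{R}^d$. *)

theory Defs
  imports "HOL-Analysis.Analysis" "HOL-Library.Function_Algebras" "HOL-Library.Multiset"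
begin

text \<open>The lattice \<open>\<int>\<^sup>d\<close> is the type \<^typ>\<open>int ^ 'd\<close>, with \<open>d = CARD('d)\<close>.\<close>

definition lattice_adj :: "int ^ 'd::finite \<Rightarrow> int ^ 'd \<Rightarrow> bool" where
  "lattice_adj x y \<longleftrightarrow> (\<exists>i. x - y = axis i 1 \<or> x - y = - axis i 1)"

definition laplacian ::
  "(int ^ 'd::finite \<Rightarrow> 'b::real_normed_vector) \<Rightarrow> int ^ 'd \<Rightarrow> 'b" where
  "laplacian f x = (\<Sum>y | lattice_adj y x. f y - f x)"

text \<open>The Laplacian is a bounded operator on bounded functions, so the semigroup
  \<open>e\<^sup>t\<^sup>\<Delta>\<close> is given by the exponential series, which converges pointwise for bounded \<open>u\<close>.\<close>

definition heat_semigroup ::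
  "real \<Rightarrow> (int ^ 'd::finite \<Rightarrow> 'b::real_normed_vector) \<Rightarrow> int ^ 'd \<Rightarrow> 'b" where
  "heat_semigroup t u x = (\<Sum>n. (t ^ n / fact n) *\<^sub>R (laplacian ^^ n) u x)"

text \<open>The kernel of \<open>e\<^sup>t\<^sup>\<Delta>\<close>: its value at \<open>(x, y)\<close> is obtained by applying the semigroup to the
  indicator function of \<open>{y}\<close>.\<close>

definition heat_kernel :: "real \<Rightarrow> int ^ 'd::finite \<Rightarrow> int ^ 'd \<Rightarrow> real" where
  "heat_kernel t x y = heat_semigroup t (indicator {y}) x"

definition frac_laplacian ::
  "real \<Rightarrow> (int ^ 'd::finite \<Rightarrow> complex) \<Rightarrow> int ^ 'd \<Rightarrow> complex" where
  "frac_laplacian \<alpha> u x =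
     (1 / \<bar>Gamma (- \<alpha> / 2)\<bar>) *\<^sub>R
       (LINT t:{0<..}|lborel. (t powr (- 1 - \<alpha> / 2)) *\<^sub>R (u x - heat_semigroup t u x))"

text \<open>Meaningful for \<open>x \<noteq> y\<close> only: on the diagonal the integral diverges.\<close>

definition frac_kernel :: "real \<Rightarrow> int ^ 'd::finite \<Rightarrow> int ^ 'd \<Rightarrow> real" where
  "frac_kernel \<alpha> x y =
     1 / \<bar>Gamma (- \<alpha> / 2)\<bar> *
       (LINT t:{0<..}|lborel. t powr (- 1 - \<alpha> / 2) * heat_kernel t x y)"

definition frac_boundary :: "real \<Rightarrow> (int ^ 'd::finite) set \<Rightarrow> real" where
  "frac_boundary \<alpha> \<Omega> = (\<Sum>\<^sub>\<infinity>(x, y)\<in>(- \<Omega>) \<times> \<Omega>. frac_kernel \<alpha> x y)"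

text \<open>A subgraph \<open>\<Omega>\<close> enters only through its vertex set. Functions on \<open>\<Omega>\<close> are represented by
  the functions on the lattice that vanish outside \<open>\<Omega>\<close>; with this representation both the
  extension by zero and the restriction to \<open>\<Omega>\<close> are the cut-off \<open>cutoff \<Omega>\<close>.\<close>

definition cutoff :: "'a set \<Rightarrow> ('a \<Rightarrow> 'b::zero) \<Rightarrow> 'a \<Rightarrow> 'b" where
  "cutoff \<Omega> u = (\<lambda>x. if x \<in> \<Omega> then u x else 0)"

definition functions_on :: "'a set \<Rightarrow> ('a \<Rightarrow> complex) set" where
  "functions_on \<Omega> = {u. \<forall>x. x \<notin> \<Omega> \<longrightarrow> u x = 0}"

definition dirichlet_frac_laplacian ::
  "real \<Rightarrow> (int ^ 'd::finite) set \<Rightarrow> (int ^ 'd \<Rightarrow> complex) \<Rightarrow> int ^ 'd \<Rightarrow> complex" where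
  "dirichlet_frac_laplacian \<alpha> \<Omega> u = cutoff \<Omega> (frac_laplacian \<alpha> (cutoff \<Omega> u))"

definition fun_scale :: "complex \<Rightarrow> ('a \<Rightarrow> complex) \<Rightarrow> 'a \<Rightarrow> complex" where
  "fun_scale c u = (\<lambda>x. c * u x)"

interpretation complex_fun: vector_space "fun_scale :: complex \<Rightarrow> ('a \<Rightarrow> complex) \<Rightarrow> _"
  by unfold_locales (auto simp: fun_scale_def algebra_simps)

definition dirichlet_eigenspace ::
  "real \<Rightarrow> (int ^ 'd::finite) set \<Rightarrow> complex \<Rightarrow> (int ^ 'd \<Rightarrow> complex) set" where
  "dirichlet_eigenspace \<alpha> \<Omega> \<mu> =
     {u \<in> functions_on \<Omega>. dirichlet_frac_laplacian \<alpha> \<Omega> u = fun_scale \<mu> u}"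

definition dirichlet_multiplicity ::
  "real \<Rightarrow> (int ^ 'd::finite) set \<Rightarrow> complex \<Rightarrow> nat" where
  "dirichlet_multiplicity \<alpha> \<Omega> \<mu> = complex_fun.dim (dirichlet_eigenspace \<alpha> \<Omega> \<mu>)"

text \<open>All complex eigenvalues are collected. The operator is symmetric, so they are real,
  \<^const>\<open>Re\<close> merely changes their type, and the dimension of the eigenspace is also the
  algebraic multiplicity.\<close>

definition dirichlet_spectrum :: "real \<Rightarrow> (int ^ 'd::finite) set \<Rightarrow> real multiset" where
  "dirichlet_spectrum \<alpha> \<Omega> =
     (\<Sum>\<mu> | dirichlet_eigenspace \<alpha> \<Omega> \<mu> \<noteq> {0}.
        replicate_mset (dirichlet_multiplicity \<alpha> \<Omega> \<mu>) (Re \<mu>))"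

text \<open>The \<open>k\<close>-th smallest eigenvalue with multiplicity, for \<open>1 \<le> k \<le> card \<Omega>\<close>.\<close>

definition dirichlet_eigenvalue :: "real \<Rightarrow> (int ^ 'd::finite) set \<Rightarrow> nat \<Rightarrow> real" where
  "dirichlet_eigenvalue \<alpha> \<Omega> k = sorted_list_of_multiset (dirichlet_spectrum \<alpha> \<Omega>) ! (k - 1)"

end

(* With Phi(z) = sum_i (2 - 2 cos z_i), the semigroup e^{t Delta} is convolution with the Fourier
   coefficients of e^{-t Phi} over the torus [-pi, pi]^d, so the Dirichlet operator on Omega is the
   compression of the symmetric matrix M whose entries are the Fourier coefficients of Phi^{alpha/2}.
   Let psi_j be an orthonormal eigenbasis with eigenvalues l_1 <= l_2 <= ..., and let
   F_j(z) = |sum_x e^{iz.x} psi_j(x)|^2. Completeness gives sum_j F_j = |Omega|, orthonormality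
   gives mean 1 for each F_j, and l_j is the mean of Phi^{alpha/2} F_j.

   Upper bound: the weights w_j = mean of F_j on a ball of suitable radius lie in [0, 1] and add up
   to k, so l_1 + ... + l_k <= sum_j l_j w_j. Fourier inversion for Phi^{alpha/2} and the positivity
   of the heat kernel give sum_j l_j F_j <= |Omega| Phi^{alpha/2} + |boundary|, and Phi <= |z|^2.

   Lower bound: a bathtub argument for F_1 + ... + F_k, which is at most |Omega|, against the
   minorant |z|^alpha - 12^{-alpha/2} |z|^{2 alpha} of Phi^{alpha/2}. The hypothesis on k says
   exactly that this minorant is increasing on the ball of the corresponding radius, and Phi
   increases along rays inside the cube. *)

theory Submission
  imports Defs
begin

section \<open>Symmetric matrices on a finite index set\<close>

text \<open>The spectrum is defined through dimensions of complex eigenspaces, with no basis in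
  sight. A real orthonormal eigenbasis is therefore built by repeated constrained minimization and
  then matched with that multiset. From there on all is real: M is symmetric, so cosines replace
  exponentials.

  Fourier inversion for Phi^{alpha/2} does not rest on a convergence theorem for Fourier series. It
  is inherited from the heat kernel: the sum over y of p(t,x,y) cos(z.(x-y)) equals e^{-t Phi(z)},
  by rearranging an absolutely convergent double series, and integrating 1 - e^{-t Phi} against
  t^{-1-alpha/2} produces Phi^{alpha/2} together with the normalization by |Gamma(-alpha/2)|.

  The ball has radius R with V R^d / (2 pi)^d = k / |Omega|. The threshold V / 2^d in (a) says that
  R \<le> pi, so that the ball stays inside the cube. The second bound of (a) is the first one
  applied to 2k, which explains both the halved threshold and the extra powers of 2.\<close>

definition quad_form :: "'a set \<Rightarrow> ('a \<Rightarrow> 'a \<Rightarrow> real) \<Rightarrow> ('a \<Rightarrow> real) \<Rightarrow> real" where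
  "quad_form A M v = (\<Sum>x\<in>A. \<Sum>y\<in>A. M x y * v x * v y)"

text \<open>The first-order condition at a minimum: for small t of the sign opposite to b the linear
  term beats the quadratic one.\<close>

lemma quadratic_nonneg_imp_linear_zero:
  fixes b c :: real
  assumes "\<And>t. 0 \<le> 2 * t * b + t\<^sup>2 * c"
  shows "b = 0"
proof (rule ccontr)
  assume b: "b \<noteq> 0"
  \<comment> \<open>A positive majorant C of c makes \<open>- b / C\<close> a usable step whatever
    the sign of c: there 2tb + t^2 C equals - b^2 / C.\<close>
  define C where "C = \<bar>c\<bar> + 1"
  have C: "C > 0" "c \<le> C" "c < C" by (auto simp: C_def)
  have "0 \<le> 2 * (- b / C) * b + (- b / C)\<^sup>2 * c" by (rule assms)
  also have "\<dots> \<le> 2 * (- b / C) * b + (- b / C)\<^sup>2 * C"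
    using C by (intro add_left_mono mult_left_mono) auto
  also have "\<dots> = - (b\<^sup>2 / C)" using C by (simp add: field_simps power2_eq_square)
  also have "\<dots> < 0" using b C by simp
  finally show False by simp
qed

lemma quad_form_scale: "quad_form A M (\<lambda>x. c * v x) = c\<^sup>2 * quad_form A M v"
  by (simp add: quad_form_def sum_distrib_left power2_eq_square mult_ac)

lemma quad_form_add:
  assumes sym: "\<And>x y. M x y = M y x"
  shows "quad_form A M (\<lambda>x. v x + t * w x) =
     quad_form A M v + 2 * t * (\<Sum>x\<in>A. w x * (\<Sum>y\<in>A. M x y * v y)) + t\<^sup>2 * quad_form A M w"
proof -
  have "(\<Sum>x\<in>A. \<Sum>y\<in>A. M x y * v x * w y) = (\<Sum>y\<in>A. \<Sum>x\<in>A. M x y * v x * w y)"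
    by (rule sum.swap)
  also have "\<dots> = (\<Sum>x\<in>A. \<Sum>y\<in>A. M x y * w x * v y)"
    by (intro sum.cong refl) (use sym in \<open>simp add: mult_ac\<close>)
  finally have *: "(\<Sum>x\<in>A. \<Sum>y\<in>A. M x y * v x * w y) = (\<Sum>x\<in>A. \<Sum>y\<in>A. M x y * w x * v y)" .
  have "quad_form A M (\<lambda>x. v x + t * w x) =
     (\<Sum>x\<in>A. \<Sum>y\<in>A. M x y * v x * v y + t * (M x y * v x * w y) + t * (M x y * w x * v y) + t\<^sup>2 * (M x y * w x * w y))"
    unfolding quad_form_def by (intro sum.cong refl) (simp add: algebra_simps power2_eq_square)
  also have "\<dots> = quad_form A M v + t * (\<Sum>x\<in>A. \<Sum>y\<in>A. M x y * v x * w y) +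
      t * (\<Sum>x\<in>A. \<Sum>y\<in>A. M x y * w x * v y) + t\<^sup>2 * quad_form A M w"
    by (simp add: quad_form_def sum.distrib sum_distrib_left)
  finally have "quad_form A M (\<lambda>x. v x + t * w x) = quad_form A M v +
      2 * t * (\<Sum>x\<in>A. \<Sum>y\<in>A. M x y * w x * v y) + t\<^sup>2 * quad_form A M w"
    unfolding * by linarith
  moreover have "(\<Sum>x\<in>A. \<Sum>y\<in>A. M x y * w x * v y) = (\<Sum>x\<in>A. w x * (\<Sum>y\<in>A. M x y * v y))"
    by (simp add: sum_distrib_left mult_ac)
  ultimately show ?thesis by simp
qed

text \<open>Vectors indexed by A are functions on the whole type that vanish off A, so the topology
  is the product topology. The set is a product of compact intervals and singletons, and Tychonoff's
  theorem applies.\<close>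

lemma compact_unit_functions:
  fixes A :: "'a set"
  shows "compact {v :: 'a \<Rightarrow> real. (\<forall>x\<in>A. \<bar>v x\<bar> \<le> 1) \<and> (\<forall>x. x \<notin> A \<longrightarrow> v x = 0)}"
proof -
  define B where "B = (\<lambda>x. if x \<in> A then {-1..1} else {0::real})"
  have "compactin (product_topology (\<lambda>_. euclidean) UNIV) (PiE UNIV B)"
    by (subst compactin_PiE) (auto simp: B_def)
  then have "compact (PiE UNIV B)"
    by (simp add: euclidean_product_topology)
  also have "PiE UNIV B = {v. (\<forall>x\<in>A. \<bar>v x\<bar> \<le> 1) \<and> (\<forall>x. x \<notin> A \<longrightarrow> v x = 0)}"
    by (auto simp: B_def PiE_def Pi_def abs_le_iff extensional_def split: if_splits)
  finally show ?thesis .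
qed

text \<open>The unit sphere in the orthogonal complement of S is a closed part of a compact cube;
  \<open>u\<close> makes it nonempty. The minimum is stated in homogeneous form, so that later test
  vectors need no normalization.\<close>

lemma exists_quad_form_minimizer:
  fixes A :: "'a set" and S :: "('a \<Rightarrow> real) set"
  assumes A: "finite A"
    and u: "\<And>x. x \<notin> A \<Longrightarrow> u x = 0" "\<And>s. s \<in> S \<Longrightarrow> (\<Sum>x\<in>A. s x * u x) = 0" "(\<Sum>x\<in>A. (u x)\<^sup>2) > 0"
  obtains v where "\<And>x. x \<notin> A \<Longrightarrow> v x = 0" "\<And>s. s \<in> S \<Longrightarrow> (\<Sum>x\<in>A. s x * v x) = 0"
    "(\<Sum>x\<in>A. (v x)\<^sup>2) = 1"
    "\<And>w. (\<And>x. x \<notin> A \<Longrightarrow> w x = 0) \<Longrightarrow> (\<And>s. s \<in> S \<Longrightarrow> (\<Sum>x\<in>A. s x * w x) = 0) \<Longrightarrow>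
       quad_form A M v * (\<Sum>x\<in>A. (w x)\<^sup>2) \<le> quad_form A M w"
proof -
  define K where "K = {v :: 'a \<Rightarrow> real. (\<forall>x\<in>A. \<bar>v x\<bar> \<le> 1) \<and> (\<forall>x. x \<notin> A \<longrightarrow> v x = 0)}
     \<inter> {v. (\<Sum>x\<in>A. (v x)\<^sup>2) = 1} \<inter> (\<Inter>s\<in>S. {v. (\<Sum>x\<in>A. s x * v x) = 0})"
  have cont: "continuous_on UNIV (\<lambda>v :: 'a \<Rightarrow> real. v x)" for x by (rule continuous_on_product_coordinates)
  have "compact K" unfolding K_def
    by (intro compact_Int_closed compact_unit_functions closed_INT ballI closed_Collect_eq
        continuous_on_sum continuous_on_mult continuous_on_power cont continuous_on_const)
  have normalize: "(\<lambda>x. w x / sqrt (\<Sum>x\<in>A. (w x)\<^sup>2)) \<in> K"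
    if w: "\<And>x. x \<notin> A \<Longrightarrow> w x = 0" "\<And>s. s \<in> S \<Longrightarrow> (\<Sum>x\<in>A. s x * w x) = 0" "(\<Sum>x\<in>A. (w x)\<^sup>2) > 0" for w
  proof -
    define N where "N = (\<Sum>x\<in>A. (w x)\<^sup>2)"
    have N: "N > 0" using w by (simp add: N_def)
    have "(w x)\<^sup>2 \<le> N" if "x \<in> A" for x
      unfolding N_def using A that by (intro member_le_sum) auto
    then have "\<bar>w x\<bar> \<le> sqrt N" if "x \<in> A" for x
      using that real_le_rsqrt[of "\<bar>w x\<bar>" N] by simp
    moreover have "(\<Sum>x\<in>A. (w x / sqrt N)\<^sup>2) = 1"
      using N by (simp add: power_divide flip: sum_divide_distrib) (simp add: N_def)
    moreover have "(\<Sum>x\<in>A. s x * (w x / sqrt N)) = 0" if "s \<in> S" for s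
      using w(2)[OF that] by (simp flip: sum_divide_distrib)
    ultimately show ?thesis using N w(1) by (auto simp: K_def N_def[symmetric])
  qed
  have "K \<noteq> {}" using normalize[of u] u by blast
  moreover have "continuous_on K (quad_form A M)"
    unfolding quad_form_def
    by (intro continuous_on_sum continuous_on_mult continuous_on_const continuous_on_subset[OF cont]) auto
  ultimately obtain v where v: "v \<in> K" "\<And>w. w \<in> K \<Longrightarrow> quad_form A M v \<le> quad_form A M w"
    using continuous_attains_inf[OF \<open>compact K\<close>] by blast
  show ?thesis
  proof (rule that[of v])
    fix w assume w: "\<And>x. x \<notin> A \<Longrightarrow> w x = 0" "\<And>s. s \<in> S \<Longrightarrow> (\<Sum>x\<in>A. s x * w x) = 0"
    define N where "N = (\<Sum>x\<in>A. (w x)\<^sup>2)"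
    show "quad_form A M v * (\<Sum>x\<in>A. (w x)\<^sup>2) \<le> quad_form A M w"
    proof (cases "N > 0")
      case True
      have "quad_form A M v \<le> quad_form A M (\<lambda>x. (1 / sqrt N) * w x)"
        using v(2)[OF normalize[of w]] w True by (simp add: N_def)
      also have "\<dots> = quad_form A M w / N"
        unfolding quad_form_scale using True by (simp add: power_divide)
      finally show ?thesis using True by (simp add: N_def[symmetric] field_simps)
    next
      case False
      then have "N = 0" using sum_nonneg[of A "\<lambda>x. (w x)\<^sup>2"] by (simp add: N_def)
      then have "\<forall>x\<in>A. w x = 0" using A by (simp add: N_def sum_nonneg_eq_0_iff)
      then have "quad_form A M w = 0" by (simp add: quad_form_def)
      then show ?thesis using \<open>N = 0\<close> by (simp add: N_def)
    qed
  qed (use v(1) in \<open>auto simp: K_def\<close>)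
qed

definition min_eigenpair ::
  "'a set \<Rightarrow> ('a \<Rightarrow> 'a \<Rightarrow> real) \<Rightarrow> ('a \<Rightarrow> real) set \<Rightarrow> ('a \<Rightarrow> real) \<Rightarrow> real \<Rightarrow> bool" where
  "min_eigenpair A M S v c \<longleftrightarrow>
     (\<forall>x. x \<notin> A \<longrightarrow> v x = 0) \<and> (\<forall>s\<in>S. (\<Sum>x\<in>A. s x * v x) = 0) \<and>
     (\<Sum>x\<in>A. (v x)\<^sup>2) = 1 \<and> (\<forall>x\<in>A. (\<Sum>y\<in>A. M x y * v y) = c * v x) \<and> quad_form A M v = c \<and>
     (\<forall>w. (\<forall>x. x \<notin> A \<longrightarrow> w x = 0) \<longrightarrow> (\<forall>s\<in>S. (\<Sum>x\<in>A. s x * w x) = 0) \<longrightarrow>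
       c * (\<Sum>x\<in>A. (w x)\<^sup>2) \<le> quad_form A M w)"

text \<open>The residual r = Mv - cv of a constrained minimizer v is orthogonal to S, because M is
  symmetric and S consists of eigenvectors. Moving from v along r thus respects the constraints, and
  the first-order condition forces r = 0: no Lagrange multiplier for S survives.\<close>

lemma exists_orthogonal_eigenvector:
  fixes A :: "'a set" and S :: "('a \<Rightarrow> real) set"
  assumes A: "finite A" and sym: "\<And>x y. M x y = M y x"
    and S: "\<And>s. s \<in> S \<Longrightarrow> \<exists>c. \<forall>x\<in>A. (\<Sum>y\<in>A. M x y * s y) = c * s x"
    and u: "\<And>x. x \<notin> A \<Longrightarrow> u x = 0" "\<And>s. s \<in> S \<Longrightarrow> (\<Sum>x\<in>A. s x * u x) = 0" "(\<Sum>x\<in>A. (u x)\<^sup>2) > 0"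
  shows "\<exists>v c. min_eigenpair A M S v c"
proof -
  obtain v where v: "\<And>x. x \<notin> A \<Longrightarrow> v x = 0" "\<And>s. s \<in> S \<Longrightarrow> (\<Sum>x\<in>A. s x * v x) = 0"
    "(\<Sum>x\<in>A. (v x)\<^sup>2) = 1"
    "\<And>w. (\<And>x. x \<notin> A \<Longrightarrow> w x = 0) \<Longrightarrow> (\<And>s. s \<in> S \<Longrightarrow> (\<Sum>x\<in>A. s x * w x) = 0) \<Longrightarrow>
       quad_form A M v * (\<Sum>x\<in>A. (w x)\<^sup>2) \<le> quad_form A M w"
    using exists_quad_form_minimizer[OF A u, where M = M] by blast
  define c where "c = quad_form A M v"
  define r where "r = (\<lambda>x. if x \<in> A then (\<Sum>y\<in>A. M x y * v y) - c * v x else 0)"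
  have r_orth: "(\<Sum>x\<in>A. s x * r x) = 0" if "s \<in> S" for s
  proof -
    obtain b where b: "\<And>x. x \<in> A \<Longrightarrow> (\<Sum>y\<in>A. M x y * s y) = b * s x" using S \<open>s \<in> S\<close> by blast
    have "(\<Sum>x\<in>A. s x * (\<Sum>y\<in>A. M x y * v y)) = (\<Sum>x\<in>A. \<Sum>y\<in>A. M x y * s x * v y)"
      by (simp add: sum_distrib_left mult_ac)
    also have "\<dots> = (\<Sum>y\<in>A. \<Sum>x\<in>A. M x y * s x * v y)" by (rule sum.swap)
    also have "\<dots> = (\<Sum>y\<in>A. v y * (\<Sum>x\<in>A. M y x * s x))"
      by (intro sum.cong refl) (use sym in \<open>simp add: sum_distrib_left mult_ac\<close>)
    also have "\<dots> = (\<Sum>y\<in>A. b * (s y * v y))" by (intro sum.cong refl) (simp add: b)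
    also have "\<dots> = 0" using v(2)[OF \<open>s \<in> S\<close>] by (simp flip: sum_distrib_left)
    finally have "(\<Sum>x\<in>A. s x * (\<Sum>y\<in>A. M x y * v y)) = 0" .
    moreover have "(\<Sum>x\<in>A. s x * r x) = (\<Sum>x\<in>A. s x * (\<Sum>y\<in>A. M x y * v y)) - c * (\<Sum>x\<in>A. s x * v x)"
      unfolding sum_distrib_left[of c] sum_subtractf[symmetric]
      by (intro sum.cong refl) (simp add: r_def algebra_simps)
    ultimately show ?thesis using v(2)[OF \<open>s \<in> S\<close>] by simp
  qed
  \<comment> \<open>The perturbation goes in the direction r itself, so the linear coefficient is
    the squared norm of r.\<close>
  have "0 \<le> 2 * t * (\<Sum>x\<in>A. (r x)\<^sup>2) + t\<^sup>2 * (quad_form A M r - c * (\<Sum>x\<in>A. (r x)\<^sup>2))" for t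
  proof -
    have "c * (\<Sum>x\<in>A. (v x + t * r x)\<^sup>2) \<le> quad_form A M (\<lambda>x. v x + t * r x)"
      unfolding c_def
    proof (rule v(4))
      show "(\<Sum>x\<in>A. s x * (v x + t * r x)) = 0" if "s \<in> S" for s
      proof -
        have "(\<Sum>x\<in>A. s x * (v x + t * r x)) = (\<Sum>x\<in>A. s x * v x) + t * (\<Sum>x\<in>A. s x * r x)"
          by (simp add: sum_distrib_left sum.distrib algebra_simps)
        then show ?thesis using v(2) r_orth that by simp
      qed
    qed (use v(1) in \<open>auto simp: r_def\<close>)
    also have "\<dots> = c + 2 * t * (\<Sum>x\<in>A. r x * (\<Sum>y\<in>A. M x y * v y)) + t\<^sup>2 * quad_form A M r"
      by (simp add: quad_form_add[OF sym] c_def)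
    also have "(\<Sum>x\<in>A. r x * (\<Sum>y\<in>A. M x y * v y)) = (\<Sum>x\<in>A. (r x)\<^sup>2 + c * (r x * v x))"
      by (intro sum.cong refl) (simp add: r_def algebra_simps power2_eq_square)
    also have "\<dots> = (\<Sum>x\<in>A. (r x)\<^sup>2) + c * (\<Sum>x\<in>A. r x * v x)"
      by (simp add: sum.distrib sum_distrib_left)
    also have "(\<Sum>x\<in>A. (v x + t * r x)\<^sup>2) = (\<Sum>x\<in>A. (v x)\<^sup>2 + 2 * t * (r x * v x) + t\<^sup>2 * (r x)\<^sup>2)"
      by (intro sum.cong refl) (simp add: algebra_simps power2_eq_square)
    also have "\<dots> = 1 + 2 * t * (\<Sum>x\<in>A. r x * v x) + t\<^sup>2 * (\<Sum>x\<in>A. (r x)\<^sup>2)"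
      by (simp add: v(3) sum.distrib sum_distrib_left)
    finally show ?thesis by (simp add: algebra_simps)
  qed
  then have "(\<Sum>x\<in>A. (r x)\<^sup>2) = 0" by (rule quadratic_nonneg_imp_linear_zero)
  then have "\<forall>x\<in>A. r x = 0" using A by (simp add: sum_nonneg_eq_0_iff)
  then have "\<And>x. x \<in> A \<Longrightarrow> (\<Sum>y\<in>A. M x y * v y) = c * v x" by (simp add: r_def)
  then have "min_eigenpair A M S v c"
    unfolding min_eigenpair_def using v by (intro conjI ballI allI impI) (simp_all add: c_def)
  then show ?thesis by (intro exI)
qed

text \<open>The residual of the unit vector at \<open>x\<close> after projecting on an orthonormal family.\<close>

lemma orthonormal_residual:
  fixes e :: "nat \<Rightarrow> 'a \<Rightarrow> real"
  assumes A: "finite A" and x: "x \<in> A"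
    and e: "\<And>i j. i < k \<Longrightarrow> j < k \<Longrightarrow> (\<Sum>x\<in>A. e i x * e j x) = of_bool (i = j)"
  defines "r \<equiv> (\<lambda>y. of_bool (y = x) - (\<Sum>j<k. e j x * e j y))"
  shows "i < k \<Longrightarrow> (\<Sum>y\<in>A. e i y * r y) = 0"
    and "(\<Sum>y\<in>A. (r y)\<^sup>2) = 1 - (\<Sum>j<k. (e j x)\<^sup>2)"
proof -
  show orth: "(\<Sum>y\<in>A. e i y * r y) = 0" if "i < k" for i
  proof -
    have "(\<Sum>y\<in>A. e i y * r y) = (\<Sum>y\<in>A. e i y * of_bool (y = x)) - (\<Sum>y\<in>A. \<Sum>j<k. e j x * (e i y * e j y))"
      by (simp add: r_def algebra_simps sum_subtractf sum_distrib_left)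
    also have "(\<Sum>y\<in>A. \<Sum>j<k. e j x * (e i y * e j y)) = (\<Sum>j<k. e j x * (\<Sum>y\<in>A. e i y * e j y))"
      by (subst sum.swap) (simp add: sum_distrib_left)
    also have "\<dots> = (\<Sum>j<k. e j x * of_bool (i = j))"
      by (intro sum.cong refl) (use that in \<open>simp add: e\<close>)
    finally show ?thesis using A x that by (simp add: of_bool_def if_distrib sum.delta sum.delta' cong: if_cong)
  qed
  have "(r y)\<^sup>2 = of_bool (y = x) * r y - (\<Sum>j<k. e j x * (e j y * r y))" for y
  proof -
    have "(r y)\<^sup>2 = (of_bool (y = x) - (\<Sum>j<k. e j x * e j y)) * r y"
      by (simp only: power2_eq_square r_def)
    then show ?thesis by (simp only: left_diff_distrib sum_distrib_right mult.assoc)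
  qed
  then have "(\<Sum>y\<in>A. (r y)\<^sup>2) = (\<Sum>y\<in>A. of_bool (y = x) * r y - (\<Sum>j<k. e j x * (e j y * r y)))"
    by simp
  also have "\<dots> = (\<Sum>y\<in>A. of_bool (y = x) * r y) - (\<Sum>j<k. e j x * (\<Sum>y\<in>A. e j y * r y))"
    by (simp add: sum_subtractf sum.swap[of _ A] sum_distrib_left)
  \<comment> \<open>The residual is orthogonal to the family, so its squared norm is its pairing
    with the unit vector alone.\<close>
  also have "\<dots> = r x" using A x by (simp add: orth of_bool_def if_distrib if_distribR sum.delta cong: if_cong)
  finally show "(\<Sum>y\<in>A. (r y)\<^sup>2) = 1 - (\<Sum>j<k. (e j x)\<^sup>2)"
    by (simp add: r_def power2_eq_square)
qed

text \<open>The trace of the complementary projection. When positive it yields a unit vector outside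
  the span, so that the construction can continue; when zero it yields completeness.\<close>

lemma sum_diag_orthonormal:
  fixes e :: "nat \<Rightarrow> 'a \<Rightarrow> real"
  assumes "\<And>i j. i < k \<Longrightarrow> j < k \<Longrightarrow> (\<Sum>x\<in>A. e i x * e j x) = of_bool (i = j)"
  shows "(\<Sum>x\<in>A. 1 - (\<Sum>j<k. (e j x)\<^sup>2)) = real (card A) - real k"
proof -
  have "(\<Sum>x\<in>A. \<Sum>j<k. (e j x)\<^sup>2) = (\<Sum>j<k. \<Sum>x\<in>A. e j x * e j x)"
    by (subst sum.swap) (simp add: power2_eq_square)
  then show ?thesis using assms by (simp add: sum_subtractf)
qed

text \<open>The last clause is the induction invariant: every eigenvalue found so far bounds the
  quadratic form from below on the complement of all the eigenvectors found. It is what keeps the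
  next eigenvalue from being smaller.\<close>

definition eigen_seq ::
  "'a set \<Rightarrow> ('a \<Rightarrow> 'a \<Rightarrow> real) \<Rightarrow> nat \<Rightarrow> (nat \<Rightarrow> 'a \<Rightarrow> real) \<Rightarrow> (nat \<Rightarrow> real) \<Rightarrow> bool" where
  "eigen_seq A M k e l \<longleftrightarrow>
     (\<forall>i<k. \<forall>j<k. (\<Sum>x\<in>A. e i x * e j x) = of_bool (i = j)) \<and>
     (\<forall>j<k. \<forall>x. x \<notin> A \<longrightarrow> e j x = 0) \<and>
     (\<forall>j<k. \<forall>x\<in>A. (\<Sum>y\<in>A. M x y * e j y) = l j * e j x) \<and>
     (\<forall>i j. i \<le> j \<longrightarrow> j < k \<longrightarrow> l i \<le> l j) \<and>
     (\<forall>i<k. \<forall>w. (\<forall>x. x \<notin> A \<longrightarrow> w x = 0) \<longrightarrow> (\<forall>j<k. (\<Sum>x\<in>A. e j x * w x) = 0) \<longrightarrow>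
         l i * (\<Sum>x\<in>A. (w x)\<^sup>2) \<le> quad_form A M w)"

lemma partial_eigenbasis:
  fixes M :: "'a \<Rightarrow> 'a \<Rightarrow> real"
  assumes A: "finite A" and sym: "\<And>x y. M x y = M y x" and "k \<le> card A"
  shows "\<exists>e l. eigen_seq A M k e l"
  using \<open>k \<le> card A\<close>
proof (induction k)
  case 0
  then show ?case by (simp add: eigen_seq_def)
next
  case (Suc k)
  from Suc.IH[OF Suc_leD[OF Suc.prems]] obtain e l where E:
    "eigen_seq A M k e l" by blast
  note e = E[unfolded eigen_seq_def, THEN conjunct1, rule_format] E[unfolded eigen_seq_def, THEN conjunct2, THEN conjunct1, rule_format]
    E[unfolded eigen_seq_def, THEN conjunct2, THEN conjunct2, THEN conjunct1, rule_format]
    E[unfolded eigen_seq_def, THEN conjunct2, THEN conjunct2, THEN conjunct2, THEN conjunct1, rule_format]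
    E[unfolded eigen_seq_def, THEN conjunct2, THEN conjunct2, THEN conjunct2, THEN conjunct2, rule_format]
  \<comment> \<open>The residuals of the unit vectors have total squared norm card A - k > 0, so one
    of them is a nonzero vector orthogonal to the eigenvectors found so far.\<close>
  have "(\<Sum>x\<in>A. 1 - (\<Sum>j<k. (e j x)\<^sup>2)) > 0"
    using sum_diag_orthonormal[where k = k and A = A and e = e] e(1) Suc.prems by simp
  then obtain x where x: "x \<in> A" "1 - (\<Sum>j<k. (e j x)\<^sup>2) > 0"
    by (meson not_le sum_nonpos)
  define r where "r = (\<lambda>y. of_bool (y = x) - (\<Sum>j<k. e j x * e j y))"
  have r: "\<And>i. i < k \<Longrightarrow> (\<Sum>y\<in>A. e i y * r y) = 0" "(\<Sum>y\<in>A. (r y)\<^sup>2) > 0"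
    unfolding r_def using orthonormal_residual[where k = k and e = e, OF A x(1)] e(1) x(2) by simp_all
  have r0: "r y = 0" if "y \<notin> A" for y
    using that x(1) e(2) by (auto simp: r_def)
  have Sev: "\<And>s. s \<in> e ` {..<k} \<Longrightarrow> \<exists>c. \<forall>x\<in>A. (\<Sum>y\<in>A. M x y * s y) = c * s x"
    using e(3) by blast
  have Sr: "\<And>s. s \<in> e ` {..<k} \<Longrightarrow> (\<Sum>x\<in>A. s x * r x) = 0" using r(1) by auto
  from exists_orthogonal_eigenvector[where M = M, OF A sym Sev r0 Sr r(2)]
  obtain v c where V: "min_eigenpair A M (e ` {..<k}) v c" by blast
  note v = V[unfolded min_eigenpair_def, THEN conjunct1, rule_format]
    V[unfolded min_eigenpair_def, THEN conjunct2, THEN conjunct1, rule_format]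
    V[unfolded min_eigenpair_def, THEN conjunct2, THEN conjunct2, THEN conjunct1, rule_format]
    V[unfolded min_eigenpair_def, THEN conjunct2, THEN conjunct2, THEN conjunct2, THEN conjunct1, rule_format]
    V[unfolded min_eigenpair_def, THEN conjunct2, THEN conjunct2, THEN conjunct2, THEN conjunct2, THEN conjunct1, rule_format]
    V[unfolded min_eigenpair_def, THEN conjunct2, THEN conjunct2, THEN conjunct2, THEN conjunct2, THEN conjunct2, rule_format]
  \<comment> \<open>The new vector is orthogonal to the earlier ones, so the invariant can be tested
    on it.\<close>
  have lc: "l i \<le> c" if "i < k" for i
    using e(5)[OF that, of v] v(1,2,3,5) by simp
  have "eigen_seq A M (Suc k) (e(k := v)) (l(k := c))"
    unfolding eigen_seq_def
  proof (intro conjI allI impI ballI)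
    fix i j assume ij: "i < Suc k" "j < Suc k"
    have "(\<Sum>x\<in>A. e i x * v x) = 0" if "i < k" for i using v(2) that by simp
    then show "(\<Sum>x\<in>A. (e(k := v)) i x * (e(k := v)) j x) = of_bool (i = j)"
      using ij e(1) v(3) by (auto simp: less_Suc_eq power2_eq_square mult.commute)
  next
    fix i w assume i: "i < Suc k" and w: "\<forall>x. x \<notin> A \<longrightarrow> w x = 0"
      "\<forall>j<Suc k. (\<Sum>x\<in>A. (e(k := v)) j x * w x) = 0"
    have orth: "\<forall>j<k. (\<Sum>x\<in>A. e j x * w x) = 0"
    proof (intro allI impI)
      fix j assume "j < k"
      then show "(\<Sum>x\<in>A. e j x * w x) = 0" using w(2)[rule_format, of j] by simp
    qed
    show "(l(k := c)) i * (\<Sum>x\<in>A. (w x)\<^sup>2) \<le> quad_form A M w"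
      using i e(5)[of i w] v(6)[of w] w(1) orth by (auto simp: less_Suc_eq)
  next
    fix i j assume "i \<le> j" "j < Suc k"
    then show "(l(k := c)) i \<le> (l(k := c)) j"
      using e(4)[of i j] lc[of i] by (cases "i = k"; cases "j = k") auto
  next
    fix j x assume "j < Suc k" "x \<in> A"
    then show "(\<Sum>y\<in>A. M x y * (e(k := v)) j y) = (l(k := c)) j * (e(k := v)) j x"
      using e(3)[of j x] v(4)[of x] by (cases "j = k") auto
  next
    fix j x assume "j < Suc k" "x \<notin> A"
    then show "(e(k := v)) j x = 0"
      using e(2)[of j x] v(1)[of x] by (cases "j = k") auto
  qed
  then show ?case by (intro exI)
qed

lemma symmetric_eigenbasis:
  fixes M :: "'a \<Rightarrow> 'a \<Rightarrow> real"
  assumes A: "finite A" and sym: "\<And>x y. M x y = M y x"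
  shows "\<exists>e l. eigen_seq A M (card A) e l \<and>
    (\<forall>x\<in>A. \<forall>y\<in>A. (\<Sum>j<card A. e j x * e j y) = of_bool (x = y))"
proof -
  obtain e l where E: "eigen_seq A M (card A) e l"
    using partial_eigenbasis[where M = M, OF A sym order_refl] by blast
  note e = E[unfolded eigen_seq_def, THEN conjunct1, rule_format] E[unfolded eigen_seq_def, THEN conjunct2, THEN conjunct1, rule_format]
    E[unfolded eigen_seq_def, THEN conjunct2, THEN conjunct2, THEN conjunct1, rule_format]
    E[unfolded eigen_seq_def, THEN conjunct2, THEN conjunct2, THEN conjunct2, THEN conjunct1, rule_format]
    E[unfolded eigen_seq_def, THEN conjunct2, THEN conjunct2, THEN conjunct2, THEN conjunct2, rule_format]
  have "(\<Sum>j<card A. e j x * e j y) = of_bool (x = y)" if xy: "x \<in> A" "y \<in> A" for x y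
  proof -
    define r where "r x = (\<lambda>y. of_bool (y = x) - (\<Sum>j<card A. e j x * e j y))" for x
    have r: "(\<Sum>y\<in>A. (r x y)\<^sup>2) = 1 - (\<Sum>j<card A. (e j x)\<^sup>2)" if "x \<in> A" for x
      unfolding r_def using orthonormal_residual[where k = "card A" and e = e, OF A that] e(1) by simp
    \<comment> \<open>With card A vectors the complementary projection has trace 0, so every
      residual vanishes entrywise; that is completeness.\<close>
    have "(\<Sum>x\<in>A. \<Sum>y\<in>A. (r x y)\<^sup>2) = 0"
      using sum_diag_orthonormal[where k = "card A" and A = A and e = e] e(1) by (simp add: r)
    then have "r x y = 0" using A xy by (simp add: sum_nonneg_eq_0_iff sum_nonneg)
    then show ?thesis by (auto simp: r_def)
  qed
  with E show ?thesis by blast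
qed

section \<open>The spectrum as a multiset\<close>

lemma sum_fun_apply: "(\<Sum>j\<in>J. f j) x = (\<Sum>j\<in>J. f j x :: 'b::comm_monoid_add)"
  by (induction J rule: infinite_finite_induct) auto

text \<open>Both sides of the eigenvalue equation vanish off \<Omega>, which reduces it to a matrix
  equation on \<Omega>.\<close>

lemma subspace_eigenspace:
  assumes L: "\<And>u x. u \<in> functions_on \<Omega> \<Longrightarrow> x \<in> \<Omega> \<Longrightarrow>
      frac_laplacian \<alpha> u x = (\<Sum>y\<in>\<Omega>. of_real (M x y) * u y)"
  shows "complex_fun.subspace (dirichlet_eigenspace \<alpha> \<Omega> \<mu>)"
    and "dirichlet_eigenspace \<alpha> \<Omega> \<mu> =
      {u \<in> functions_on \<Omega>. \<forall>x\<in>\<Omega>. (\<Sum>y\<in>\<Omega>. of_real (M x y) * u y) = \<mu> * u x}"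
proof -
  show *: "dirichlet_eigenspace \<alpha> \<Omega> \<mu> =
      {u \<in> functions_on \<Omega>. \<forall>x\<in>\<Omega>. (\<Sum>y\<in>\<Omega>. of_real (M x y) * u y) = \<mu> * u x}"
  proof -
    have "dirichlet_frac_laplacian \<alpha> \<Omega> u = fun_scale \<mu> u \<longleftrightarrow>
        (\<forall>x\<in>\<Omega>. (\<Sum>y\<in>\<Omega>. of_real (M x y) * u y) = \<mu> * u x)" if "u \<in> functions_on \<Omega>" for u
    proof -
      have "cutoff \<Omega> u = u" using that by (auto simp: cutoff_def functions_on_def)
      then have "dirichlet_frac_laplacian \<alpha> \<Omega> u =
          (\<lambda>x. if x \<in> \<Omega> then \<Sum>y\<in>\<Omega>. of_real (M x y) * u y else 0)"
        using L[OF that] by (auto simp: dirichlet_frac_laplacian_def cutoff_def)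
      then show ?thesis using that by (force simp: fun_scale_def fun_eq_iff functions_on_def)
    qed
    then show ?thesis by (auto simp: dirichlet_eigenspace_def)
  qed
  show "complex_fun.subspace (dirichlet_eigenspace \<alpha> \<Omega> \<mu>)"
    unfolding *
    by (rule complex_fun.subspaceI)
       (auto simp: functions_on_def fun_scale_def algebra_simps sum.distrib simp flip: sum_distrib_left)
qed

text \<open>The eigenspace of \<mu> is spanned by the real eigenvectors with \<open>l j\<close>
  equal to \<mu>. These are independent by orthogonality, so its complex dimension is the number of
  such indices, and collecting over \<mu> recovers the list of all \<open>l j\<close>.\<close>

lemma dirichlet_spectrum_eq:
  fixes e :: "nat \<Rightarrow> int ^ 'd::finite \<Rightarrow> real"
  assumes \<Omega>: "finite \<Omega>" and sym: "\<And>x y. M x y = M y x"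
    and L: "\<And>u x. u \<in> functions_on \<Omega> \<Longrightarrow> x \<in> \<Omega> \<Longrightarrow>
      frac_laplacian \<alpha> u x = (\<Sum>y\<in>\<Omega>. of_real (M x y) * u y)"
    and orth: "\<And>i j. i < card \<Omega> \<Longrightarrow> j < card \<Omega> \<Longrightarrow> (\<Sum>x\<in>\<Omega>. e i x * e j x) = of_bool (i = j)"
    and supp: "\<And>j x. j < card \<Omega> \<Longrightarrow> x \<notin> \<Omega> \<Longrightarrow> e j x = 0"
    and eigen: "\<And>j x. j < card \<Omega> \<Longrightarrow> x \<in> \<Omega> \<Longrightarrow> (\<Sum>y\<in>\<Omega>. M x y * e j y) = l j * e j x"
    and complete: "\<And>x y. x \<in> \<Omega> \<Longrightarrow> y \<in> \<Omega> \<Longrightarrow> (\<Sum>j<card \<Omega>. e j x * e j y) = of_bool (x = y)"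
  shows "dirichlet_spectrum \<alpha> \<Omega> = mset (map l [0..<card \<Omega>])"
proof -
  define n where "n = card \<Omega>"
  define E :: "nat \<Rightarrow> int ^ 'd \<Rightarrow> complex" where "E j = (\<lambda>x. of_real (e j x))" for j
  define J where "J \<mu> = {j. j < n \<and> complex_of_real (l j) = \<mu>}" for \<mu>
  note [folded n_def, simp] = orth supp eigen complete
  have subsp: "complex_fun.subspace (dirichlet_eigenspace \<alpha> \<Omega> \<mu>)" for \<mu>
    by (rule subspace_eigenspace(1)[where M = M]) (rule L)
  have eigsp: "dirichlet_eigenspace \<alpha> \<Omega> \<mu> =
      {u \<in> functions_on \<Omega>. \<forall>x\<in>\<Omega>. (\<Sum>y\<in>\<Omega>. of_real (M x y) * u y) = \<mu> * u x}" for \<mu>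
    by (rule subspace_eigenspace(2)[where M = M]) (rule L)
  have orthE: "(\<Sum>x\<in>\<Omega>. E i x * E j x) = of_bool (i = j)" if "i < n" "j < n" for i j
  proof -
    have "(\<Sum>x\<in>\<Omega>. E i x * E j x) = of_real (\<Sum>x\<in>\<Omega>. e i x * e j x)" by (simp add: E_def)
    then show ?thesis using that by (simp del: of_real_sum)
  qed
  have injE: "inj_on E {..<n}"
  proof (rule inj_onI)
    fix i j assume "i \<in> {..<n}" "j \<in> {..<n}" "E i = E j"
    then show "i = j" using orthE[of i j] orthE[of i i] by (cases "i = j") simp_all
  qed
  have E0: "E j \<noteq> 0" if "j < n" for j
    using orthE[OF that that] by (intro notI) simp
  have spaceE: "E j \<in> dirichlet_eigenspace \<alpha> \<Omega> (of_real (l j))" if "j < n" for j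
  proof -
    have "(\<Sum>y\<in>\<Omega>. of_real (M x y) * E j y) = of_real (\<Sum>y\<in>\<Omega>. M x y * e j y)" for x
      by (simp only: E_def of_real_sum of_real_mult)
    then have "(\<Sum>y\<in>\<Omega>. of_real (M x y) * E j y) = of_real (l j) * E j x" if "x \<in> \<Omega>" for x
      using that \<open>j < n\<close> by (simp add: E_def del: of_real_sum)
    moreover have "E j x = 0" if "x \<notin> \<Omega>" for x using that \<open>j < n\<close> by (simp add: E_def)
    ultimately show ?thesis by (auto simp: eigsp functions_on_def)
  qed
  have space: "dirichlet_eigenspace \<alpha> \<Omega> \<mu> = complex_fun.span (E ` J \<mu>)" for \<mu>
  proof
    show "complex_fun.span (E ` J \<mu>) \<subseteq> dirichlet_eigenspace \<alpha> \<Omega> \<mu>"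
      using subsp
      by (rule complex_fun.span_minimal[rotated]) (use spaceE in \<open>auto simp: J_def\<close>)
    show "dirichlet_eigenspace \<alpha> \<Omega> \<mu> \<subseteq> complex_fun.span (E ` J \<mu>)"
    proof
      fix u assume "u \<in> dirichlet_eigenspace \<alpha> \<Omega> \<mu>"
      then have u: "\<And>x. x \<notin> \<Omega> \<Longrightarrow> u x = 0"
        "\<And>x. x \<in> \<Omega> \<Longrightarrow> (\<Sum>y\<in>\<Omega>. of_real (M x y) * u y) = \<mu> * u x"
        by (auto simp: eigsp functions_on_def)
      \<comment> \<open>The pairing carries no conjugation; since the \<open>E j\<close> are
        real-valued it still gives the coefficient of u along \<open>E j\<close>.\<close>
      define c where "c j = (\<Sum>x\<in>\<Omega>. E j x * u x)" for j
      \<comment> \<open>Symmetry moves the matrix from u to \<open>e j\<close>, which gives (\<mu> -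
        l j) c j = 0. Here \<mu> is an arbitrary complex number, so this also rules out non-real
        eigenvalues.\<close>
      have c0: "c j = 0" if j: "j < n" "j \<notin> J \<mu>" for j
      proof -
        have "\<mu> * c j = (\<Sum>x\<in>\<Omega>. E j x * (\<Sum>y\<in>\<Omega>. of_real (M x y) * u y))"
          unfolding c_def sum_distrib_left[of \<mu>] by (intro sum.cong refl) (simp add: u(2))
        also have "\<dots> = (\<Sum>x\<in>\<Omega>. \<Sum>y\<in>\<Omega>. of_real (M y x * e j x) * u y)"
          unfolding sum_distrib_left
          by (intro sum.cong refl) (subst sym, simp add: E_def)
        also have "\<dots> = (\<Sum>y\<in>\<Omega>. \<Sum>x\<in>\<Omega>. of_real (M y x * e j x) * u y)"
          by (rule sum.swap)
        also have "\<dots> = (\<Sum>y\<in>\<Omega>. of_real (\<Sum>x\<in>\<Omega>. M y x * e j x) * u y)"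
          by (simp only: of_real_sum sum_distrib_right)
        also have "\<dots> = of_real (l j) * c j"
          using j unfolding c_def sum_distrib_left by (intro sum.cong refl) (simp add: E_def del: of_real_sum)
        finally show ?thesis using j by (auto simp: J_def)
      qed
      have "u = (\<Sum>j\<in>J \<mu>. fun_scale (c j) (E j))"
      proof
        fix x
        have "(\<Sum>j<n. c j * E j x) = u x"
        proof (cases "x \<in> \<Omega>")
          case True
          have "(\<Sum>j<n. c j * E j x) = (\<Sum>j<n. \<Sum>y\<in>\<Omega>. E j y * E j x * u y)"
            unfolding c_def sum_distrib_right by (simp add: mult_ac)
          also have "\<dots> = (\<Sum>y\<in>\<Omega>. \<Sum>j<n. E j y * E j x * u y)" by (rule sum.swap)
          also have "\<dots> = (\<Sum>y\<in>\<Omega>. of_real (\<Sum>j<n. e j y * e j x) * u y)"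
            by (simp only: E_def of_real_sum of_real_mult sum_distrib_right)
          also have "\<dots> = (\<Sum>y\<in>\<Omega>. of_bool (y = x) * u y)"
            using True by (intro sum.cong refl) (simp del: of_real_sum)
          finally show ?thesis using True \<Omega> by (simp add: Int_absorb1)
        qed (simp add: E_def u(1))
        moreover have "(\<Sum>j<n. c j * E j x) = (\<Sum>j\<in>J \<mu>. c j * E j x)"
          by (rule sum.mono_neutral_right) (auto simp: c0, auto simp: J_def)
        ultimately show "u x = (\<Sum>j\<in>J \<mu>. fun_scale (c j) (E j)) x"
          by (simp add: sum_fun_apply fun_scale_def)
      qed
      then show "u \<in> complex_fun.span (E ` J \<mu>)"
        by (simp add: complex_fun.span_sum complex_fun.span_scale complex_fun.span_base)
    qed
  qed
  have indep: "complex_fun.independent (E ` J \<mu>)" for \<mu>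
    unfolding complex_fun.independent_explicit_module
  proof (intro allI impI)
    fix t u v assume t: "finite t" "t \<subseteq> E ` J \<mu>" "(\<Sum>v\<in>t. fun_scale (u v) v) = 0" "v \<in> t"
    have prod: "(\<Sum>x\<in>\<Omega>. v x * w x) = of_bool (v = w)" if "w \<in> t" for w
    proof -
      obtain i where i: "i < n" "v = E i" using t(2,4) unfolding J_def by blast
      obtain j where j: "j < n" "w = E j" using t(2) \<open>w \<in> t\<close> unfolding J_def by blast
      show ?thesis using i j orthE[of i j] inj_onD[OF injE, of i j] by (cases "i = j") auto
    qed
    have "0 = (\<Sum>x\<in>\<Omega>. v x * (\<Sum>w\<in>t. fun_scale (u w) w) x)" by (simp add: t(3))
    also have "\<dots> = (\<Sum>w\<in>t. u w * (\<Sum>x\<in>\<Omega>. v x * w x))"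
      unfolding sum_fun_apply sum_distrib_left by (subst sum.swap) (simp add: fun_scale_def mult_ac)
    also have "\<dots> = (\<Sum>w\<in>t. u w * of_bool (v = w))" by (simp add: prod)
    also have "\<dots> = u v" using t by (simp add: Int_absorb1)
    finally show "u v = 0" by simp
  qed
  have mult: "dirichlet_multiplicity \<alpha> \<Omega> \<mu> = card (J \<mu>)" for \<mu>
  proof -
    have "dirichlet_multiplicity \<alpha> \<Omega> \<mu> = card (E ` J \<mu>)"
      unfolding dirichlet_multiplicity_def space
      using complex_fun.dim_eq_card_independent[OF indep[of \<mu>]] by (simp add: complex_fun.dim_span)
    also have "\<dots> = card (J \<mu>)"
      by (intro card_image inj_on_subset[OF injE]) (auto simp: J_def)
    finally show ?thesis .
  qed
  have nontriv: "dirichlet_eigenspace \<alpha> \<Omega> \<mu> \<noteq> {0} \<longleftrightarrow> \<mu> \<in> complex_of_real ` l ` {..<n}" for \<mu>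
  proof
    assume "dirichlet_eigenspace \<alpha> \<Omega> \<mu> \<noteq> {0}"
    then have "J \<mu> \<noteq> {}" unfolding space by auto
    then show "\<mu> \<in> complex_of_real ` l ` {..<n}" by (auto simp: J_def)
  qed (use spaceE E0 in auto)
  \<comment> \<open>Only the finitely many values \<open>l j\<close> have a nontrivial eigenspace.
    This matters because a sum over an infinite index set would be the empty multiset by
    convention.\<close>
  have "dirichlet_spectrum \<alpha> \<Omega> =
      (\<Sum>\<mu>\<in>complex_of_real ` l ` {..<n}. replicate_mset (card (J \<mu>)) (Re \<mu>))"
    unfolding dirichlet_spectrum_def mult nontriv by simp
  also have "\<dots> = (\<Sum>r\<in>l ` {..<n}. replicate_mset (card {j. j < n \<and> l j = r}) r)"
    by (subst sum.reindex) (auto intro: inj_onI simp: J_def)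
  also have "\<dots> = mset (map l [0..<n])"
  proof (rule multiset_eqI)
    fix r
    have "count (\<Sum>r\<in>l ` {..<n}. replicate_mset (card {j. j < n \<and> l j = r}) r) r =
        (\<Sum>s\<in>l ` {..<n}. if s = r then card {j. j < n \<and> l j = r} else 0)"
      unfolding count_sum by (intro sum.cong refl) simp
    also have "\<dots> = card {j. j < n \<and> l j = r}"
      by (auto simp: sum.delta' sum.delta card_eq_0_iff)
    also have "\<dots> = count (mset (map l [0..<n])) r"
    proof -
      have "{j. j < n \<and> l j = r} = l -` {r} \<inter> {0..<n}" by auto
      moreover have "count (mset (map l [0..<n])) r = card (l -` {r} \<inter> {0..<n})"
        by (simp add: count_image_mset mset_upt)
      ultimately show ?thesis by simp
    qed
    finally show "count (\<Sum>r\<in>l ` {..<n}. replicate_mset (card {j. j < n \<and> l j = r}) r) r =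
        count (mset (map l [0..<n])) r" .
  qed
  finally show ?thesis by (simp add: n_def)
qed

text \<open>The eigenvalues are numbered from 1 and the entries of \<open>l\<close> from 0, hence
  \<open>Suc i\<close>.\<close>

lemma dirichlet_eigenvalue_eq:
  assumes "dirichlet_spectrum \<alpha> \<Omega> = mset (map l [0..<n])"
    and "\<And>i j. i \<le> j \<Longrightarrow> j < n \<Longrightarrow> l i \<le> l j" and "i < n"
  shows "dirichlet_eigenvalue \<alpha> \<Omega> (Suc i) = l i"
proof -
  have "sorted (map l [0..<n])" using assms(2) by (auto simp: sorted_iff_nth_mono)
  then have "sorted_list_of_multiset (dirichlet_spectrum \<alpha> \<Omega>) = map l [0..<n]"
    unfolding assms(1) sorted_list_of_multiset_mset by (simp only: sorted_sort_id)
  then show ?thesis using \<open>i < n\<close> by (simp add: dirichlet_eigenvalue_def)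
qed

section \<open>The symbol of the lattice Laplacian\<close>

text \<open>The function Phi of the overview: the Laplacian multiplies a cosine wave of frequency z
  by \<open>- lsymbol z\<close>.\<close>

definition lsymbol :: "real ^ 'd::finite \<Rightarrow> real" where
  "lsymbol z = (\<Sum>i\<in>UNIV. 2 - 2 * cos (z $ i))"

lemma lsymbol_0 [simp]: "lsymbol 0 = 0"
  by (simp add: lsymbol_def)

lemma lsymbol_nonneg [simp]: "0 \<le> lsymbol z"
  by (simp add: lsymbol_def sum_nonneg)

lemma lsymbol_le: "lsymbol (z :: real ^ 'd::finite) \<le> 4 * real CARD('d)"
proof -
  have "lsymbol z \<le> (\<Sum>i\<in>(UNIV :: 'd set). 4)"
    unfolding lsymbol_def by (rule sum_mono) (use cos_ge_minus_one in \<open>smt (verit)\<close>)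
  then show ?thesis by simp
qed

lemma continuous_on_lsymbol [continuous_intros]:
  fixes g :: "'a::t2_space \<Rightarrow> real ^ 'd::finite"
  shows "continuous_on S g \<Longrightarrow> continuous_on S (\<lambda>x. lsymbol (g x))"
  unfolding lsymbol_def by (intro continuous_intros)

lemma norm_vec_square: "(norm (z :: real ^ 'd::finite))\<^sup>2 = (\<Sum>i\<in>UNIV. (z $ i)\<^sup>2)"
  unfolding power2_norm_eq_inner inner_vec_def by (simp add: power2_eq_square)

lemma lsymbol_le_norm: "lsymbol (z :: real ^ 'd::finite) \<le> (norm z)\<^sup>2"
  unfolding lsymbol_def norm_vec_square
proof (rule sum_mono)
  fix i
  have "2 - 2 * cos (z $ i) = (2 * sin (z $ i / 2))\<^sup>2"
    using cos_double_sin[of "z $ i / 2"] by (simp add: power_mult_distrib)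
  also have "\<dots> \<le> (2 * (z $ i / 2))\<^sup>2"
    unfolding abs_le_square_iff[symmetric] using abs_sin_x_le_abs_x[of "z $ i / 2"] by (simp add: abs_mult)
  finally show "2 - 2 * cos (z $ i) \<le> (z $ i)\<^sup>2" by simp
qed

text \<open>Each coordinate contributes an increasing function of its modulus, since cos decreases
  on [0, pi]. This is used to pull points of the cube back along rays to the sphere of radius
  R.\<close>

lemma lsymbol_mono:
  assumes "\<And>i. \<bar>w $ i\<bar> \<le> \<bar>z $ i\<bar>" "\<And>i. \<bar>z $ i\<bar> \<le> pi"
  shows "lsymbol w \<le> lsymbol z"
  unfolding lsymbol_def
proof (rule sum_mono)
  fix i
  have "cos \<bar>z $ i\<bar> \<le> cos \<bar>w $ i\<bar>"
    by (rule cos_monotone_0_pi_le) (use assms in auto)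
  then show "2 - 2 * cos (w $ i) \<le> 2 - 2 * cos (z $ i)" by simp
qed

text \<open>After division by a + b both ratios lie in [0, 1], where raising to a power s \<le> 1
  can only increase them.\<close>

lemma powr_add_le:
  fixes a b s :: real
  assumes "0 \<le> a" "0 \<le> b" "0 < s" "s \<le> 1"
  shows "(a + b) powr s \<le> a powr s + b powr s"
proof (cases "a + b = 0")
  case False
  define c where "c = a + b"
  have c: "c > 0" using False assms by (simp add: c_def)
  have *: "x / c \<le> (x / c) powr s" if "0 \<le> x" "x \<le> c" for x
    using powr_mono'[of s 1 "x / c"] that c assms by (simp add: powr_one_gt_zero_iff)
  have "1 = a / c + b / c" using c by (simp add: c_def flip: add_divide_distrib)
  also have "\<dots> \<le> (a / c) powr s + (b / c) powr s"
    by (intro add_mono *) (use assms in \<open>auto simp: c_def\<close>)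
  also have "\<dots> = (a powr s + b powr s) / c powr s"
    using assms c by (simp add: powr_divide add_divide_distrib)
  finally show ?thesis using c by (simp add: field_simps c_def)
qed (use assms in \<open>auto simp: add_nonneg_eq_0_iff\<close>)

text \<open>Taylor expansion of the cosine with a fourth-order remainder, whose coefficient is at
  most 1/24, in each coordinate. The sum of the fourth powers of the coordinates is at most the
  fourth power of the norm.\<close>

lemma lsymbol_ge_norm: "(norm (z :: real ^ 'd::finite))\<^sup>2 - (norm z) ^ 4 / 12 \<le> lsymbol z"
proof -
  have "2 - 2 * cos x \<ge> x\<^sup>2 - x ^ 4 / 12" for x :: real
  proof -
    obtain t where t: "cos x = (\<Sum>m<4. cos_coeff m * x ^ m) + cos (t + 1/2 * real 4 * pi) / fact 4 * x ^ 4"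
      using Maclaurin_cos_expansion[of x 4] by blast
    have "cos (t + 1/2 * real 4 * pi) / fact 4 * x ^ 4 \<le> 1 / 24 * x ^ 4"
      by (intro mult_right_mono) (auto simp: fact_numeral)
    moreover have "(\<Sum>m<4. cos_coeff m * x ^ m) = 1 - x\<^sup>2 / 2"
    proof -
      have "{..<4} = {0, 1, 2, 3 :: nat}" by auto
      then show ?thesis by (simp add: cos_coeff_def)
    qed
    ultimately show ?thesis using t by linarith
  qed
  then have "lsymbol z \<ge> (\<Sum>i\<in>UNIV. (z $ i)\<^sup>2 - (z $ i) ^ 4 / 12)"
    unfolding lsymbol_def by (intro sum_mono)
  moreover have "(\<Sum>i\<in>UNIV. (z $ i) ^ 4) \<le> (norm z) ^ 4"
  proof -
    have "(\<Sum>i\<in>UNIV. ((z $ i)\<^sup>2)\<^sup>2) \<le> (\<Sum>i\<in>UNIV. (z $ i)\<^sup>2 * (norm z)\<^sup>2)"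
    proof (rule sum_mono)
      fix i
      have "(z $ i)\<^sup>2 \<le> (norm z)\<^sup>2"
        unfolding norm_vec_square by (rule member_le_sum) auto
      then show "((z $ i)\<^sup>2)\<^sup>2 \<le> (z $ i)\<^sup>2 * (norm z)\<^sup>2"
        unfolding power2_eq_square[of "(z $ i)\<^sup>2"] by (intro mult_left_mono) auto
    qed
    also have "\<dots> = ((norm z)\<^sup>2)\<^sup>2" by (simp add: norm_vec_square power2_eq_square[of "sum _ _"] flip: sum_distrib_right)
    finally show ?thesis by simp
  qed
  ultimately show ?thesis
    by (simp add: sum_subtractf norm_vec_square flip: sum_divide_distrib)
qed

lemma lsymbol_powr_le:
  assumes "0 < \<alpha>" shows "lsymbol (z :: real ^ 'd::finite) powr (\<alpha> / 2) \<le> norm z powr \<alpha>"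
proof -
  have "lsymbol z powr (\<alpha> / 2) \<le> ((norm z)\<^sup>2) powr (\<alpha> / 2)"
    using assms by (intro powr_mono2) (auto simp: lsymbol_le_norm)
  then show ?thesis by (cases "z = 0") (simp_all add: powr_powr flip: powr_numeral)
qed

text \<open>The origin of the minorant: subadditivity of the power \<alpha>/2 < 1 is applied to
  |z|^2 = (|z|^2 - |z|^4/12) + |z|^4/12. The first summand is nonnegative because |z|^2 \<le> 12 and
  lies below the symbol; the second produces the correction term.\<close>

lemma lsymbol_powr_ge:
  assumes "0 < \<alpha>" "\<alpha> < 2" "(norm z)\<^sup>2 \<le> 12"
  shows "norm z powr \<alpha> - (1 / 12) powr (\<alpha> / 2) * norm z powr (2 * \<alpha>)
     \<le> lsymbol (z :: real ^ 'd::finite) powr (\<alpha> / 2)"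
proof (cases "z = 0")
  case False
  define a where "a = (norm z)\<^sup>2"
  define b where "b = (norm z) ^ 4 / 12"
  have b: "0 \<le> b" "b \<le> a"
    using mult_left_mono[OF assms(3), of "(norm z)\<^sup>2"] by (auto simp: a_def b_def power4_eq_xxxx power2_eq_square)
  have "a powr (\<alpha> / 2) = ((a - b) + b) powr (\<alpha> / 2)" by simp
  also have "\<dots> \<le> (a - b) powr (\<alpha> / 2) + b powr (\<alpha> / 2)"
    by (rule powr_add_le) (use b assms in auto)
  also have "(a - b) powr (\<alpha> / 2) \<le> lsymbol z powr (\<alpha> / 2)"
    using lsymbol_ge_norm[of z] b assms by (intro powr_mono2) (auto simp: a_def b_def)
  also have "a powr (\<alpha> / 2) = norm z powr \<alpha>"
    using False by (simp add: a_def powr_powr flip: powr_numeral)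
  also have "b powr (\<alpha> / 2) = (1 / 12) powr (\<alpha> / 2) * norm z powr (2 * \<alpha>)"
  proof -
    have "b = 1 / 12 * norm z powr 4" using False by (simp add: b_def)
    then show ?thesis by (simp only: powr_mult powr_powr) simp
  qed
  finally show ?thesis by simp
qed (use assms in auto)

section \<open>Two integrals\<close>

text \<open>Write 1 - e^{-t} as the integral of e^{-r} over [0, t] and exchange the integrals. The
  inner one becomes r^{-s}/s, which leaves the integral for Gamma(1 - s).\<close>

lemma nn_integral_one_minus_exp_powr:
  fixes s :: real
  assumes s: "0 < s" "s < 1"
  shows "(\<integral>\<^sup>+t. ennreal (indicator {0<..} t * (t powr (- 1 - s) * (1 - exp (- t)))) \<partial>lborel)
     = ennreal (Gamma (1 - s) / s)"
proof -
  define h where "h t r = ennreal (t powr (- 1 - s) * exp (- r)) * indicator {0<..} t * indicator {0..t} r" for t r :: real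
  have meas: "case_prod h \<in> borel_measurable (lborel \<Otimes>\<^sub>M lborel)"
  proof -
    have "(\<lambda>(t, r). ennreal (t powr (- 1 - s) * exp (- r)) * indicator {0<..} t *
        indicator {p :: real \<times> real. 0 \<le> snd p \<and> snd p \<le> fst p} (t, r)) \<in> borel_measurable (borel \<Otimes>\<^sub>M borel)"
      by measurable
    then show ?thesis by (simp add: h_def case_prod_unfold indicator_def cong: measurable_cong_sets)
  qed
  have inner: "(\<integral>\<^sup>+r. h t r \<partial>lborel) = ennreal (indicator {0<..} t * (t powr (- 1 - s) * (1 - exp (- t))))" for t
  proof (cases "t > 0")
    case True
    have "((\<lambda>r. t powr (- 1 - s) * exp (- r)) has_integral
        (- (t powr (- 1 - s)) * exp (- t) - (- (t powr (- 1 - s)) * exp (- 0)))) {0..t}"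
      by (rule fundamental_theorem_of_calculus)
         (use True in \<open>auto intro!: derivative_eq_intros simp flip: has_real_derivative_iff_has_vector_derivative\<close>)
    from nn_integral_has_integral_lebesgue'[OF _ this] True show ?thesis
      by (simp add: h_def algebra_simps)
  qed (simp add: h_def)
  \<comment> \<open>The point r = 0 is a genuine exception: there the left side is infinite, while
    the right side is 0 because \<open>0 powr x\<close> is 0. It is a null set.\<close>
  have outer: "(\<integral>\<^sup>+t. h t r \<partial>lborel) = ennreal (indicator {0..} r * r powr ((1 - s) - 1) / exp r) * ennreal (1 / s)"
    if "r \<noteq> 0" for r
  proof (cases "r > 0")
    case True
    have "h t r = ennreal (exp (- r)) * (ennreal (t powr (- 1 - s)) * indicator {r..} t)" for t
      using True by (auto simp: h_def indicator_def mult.commute simp flip: ennreal_mult)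
    moreover have "(\<integral>\<^sup>+t. ennreal (t powr (- 1 - s)) * indicator {r..} t \<partial>lborel) =
        ennreal (- (r powr (- 1 - s + 1)) / (- 1 - s + 1))"
      by (rule nn_integral_has_integral_lebesgue'[OF _ has_integral_powr_to_inf]) (use True s in auto)
    ultimately have "(\<integral>\<^sup>+t. h t r \<partial>lborel) = ennreal (exp (- r)) * ennreal (- (r powr (- 1 - s + 1)) / (- 1 - s + 1))"
      by (simp only: nn_integral_cmult) (subst nn_integral_cmult, auto)
    then show ?thesis using True s
      by (simp add: exp_minus field_simps flip: ennreal_mult)
  qed (use that in \<open>simp add: h_def\<close>)
  have "(\<integral>\<^sup>+t. ennreal (indicator {0<..} t * (t powr (- 1 - s) * (1 - exp (- t)))) \<partial>lborel)
      = (\<integral>\<^sup>+t. \<integral>\<^sup>+r. h t r \<partial>lborel \<partial>lborel)" by (simp add: inner)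
  also have "\<dots> = (\<integral>\<^sup>+r. \<integral>\<^sup>+t. h t r \<partial>lborel \<partial>lborel)"
    by (rule lborel_pair.Fubini'[OF meas, symmetric])
  also have "\<dots> = (\<integral>\<^sup>+r. ennreal (indicator {0..} r * r powr ((1 - s) - 1) / exp r) * ennreal (1 / s) \<partial>lborel)"
    using AE_lborel_singleton[of "0 :: real"]
    by (intro nn_integral_cong_AE, elim AE_mp, intro AE_I2 impI outer)
  also have "\<dots> = ennreal (Gamma (1 - s)) * ennreal (1 / s)"
    using s by (subst nn_integral_multc) (auto simp: Gamma_conv_nn_integral_real)
  also have "\<dots> = ennreal (Gamma (1 - s) / s)"
    using s by (simp flip: ennreal_mult)
  finally show ?thesis .
qed

lemma minus_frac_not_nonpos_Int:
  fixes s :: real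
  assumes "0 < s" "s < 1"
  shows "- s \<notin> \<int>\<^sub>\<le>\<^sub>0"
proof
  assume "- s \<in> \<int>\<^sub>\<le>\<^sub>0"
  then obtain n where "- s = of_int n" by (auto elim: nonpos_Ints_cases)
  then have "real_of_int n < 0" "real_of_int n > - 1" using assms by linarith+
  then show False by simp
qed

text \<open>Substitute a * t in the previous integral. The functional equation gives Gamma(1 - s) =
  - s Gamma(-s), so Gamma(-s) is negative and |Gamma(-s)| = Gamma(1 - s)/s. This is the identity
  that makes the heat-semigroup integral a fractional power of the symbol.\<close>

lemma has_bochner_integral_frac_power:
  fixes s a :: real
  assumes s: "0 < s" "s < 1" and a: "0 \<le> a"
  shows "has_bochner_integral lborel
     (\<lambda>t. indicator {0<..} t * (t powr (- 1 - s) * (1 - exp (- (t * a))))) (\<bar>Gamma (- s)\<bar> * a powr s)"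
proof (cases "a = 0")
  case False
  then have a: "a > 0" using a by simp
  have "Gamma (1 - s) = - s * Gamma (- s)"
    using Gamma_plus1[OF minus_frac_not_nonpos_Int[OF s]] by simp
  then have G: "\<bar>Gamma (- s)\<bar> = Gamma (1 - s) / s"
    using Gamma_real_pos[of "1 - s"] s by (simp add: field_simps abs_if zero_less_mult_iff mult_less_0_iff)
  have "has_bochner_integral lborel
     (\<lambda>t. indicator {0<..} t * (t powr (- 1 - s) * (1 - exp (- t)))) (Gamma (1 - s) / s)"
    using s by (intro has_bochner_integral_nn_integral nn_integral_one_minus_exp_powr)
      (auto simp: indicator_def Gamma_real_nonneg)
  then have "has_bochner_integral lborel
     (\<lambda>t. indicator {0<..} (0 + a * t) * ((0 + a * t) powr (- 1 - s) * (1 - exp (- (0 + a * t)))))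
     ((Gamma (1 - s) / s) /\<^sub>R \<bar>a\<bar>)"
    by (subst (asm) lborel_has_bochner_integral_real_affine_iff[of a _ _ 0]) (use a in auto)
  then have "has_bochner_integral lborel
     (\<lambda>t. a powr (1 + s) * (indicator {0<..} (0 + a * t) * ((0 + a * t) powr (- 1 - s) * (1 - exp (- (0 + a * t))))))
     (a powr (1 + s) * ((Gamma (1 - s) / s) /\<^sub>R \<bar>a\<bar>))"
    by (rule has_bochner_integral_mult_right) 
  also have "(\<lambda>t. a powr (1 + s) * (indicator {0<..} (0 + a * t) * ((0 + a * t) powr (- 1 - s) * (1 - exp (- (0 + a * t)))))) =
      (\<lambda>t. indicator {0<..} t * (t powr (- 1 - s) * (1 - exp (- (t * a)))))"
  proof
    fix t
    have "a powr (1 + s) * a powr (- 1 - s) = 1" using a by (simp flip: powr_add)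
    then show "a powr (1 + s) * (indicator {0<..} (0 + a * t) * ((0 + a * t) powr (- 1 - s) * (1 - exp (- (0 + a * t))))) =
      indicator {0<..} t * (t powr (- 1 - s) * (1 - exp (- (t * a))))"
      using a by (auto simp: indicator_def powr_mult mult.commute zero_less_mult_iff)
  qed
  also have "a powr (1 + s) * ((Gamma (1 - s) / s) /\<^sub>R \<bar>a\<bar>) = \<bar>Gamma (- s)\<bar> * a powr s"
    using a by (simp add: G powr_add field_simps)
  finally show ?thesis .
qed (simp add: has_bochner_integral_zero)

text \<open>A layer-cake computation in place of polar coordinates: |z|^a is the integral of a
  r^{a-1} over [0, |z|], so after the exchange only volumes of differences of balls are
  required.\<close>

lemma integral_norm_powr_ball:
  fixes a R :: real
  assumes a: "0 < a" and R: "0 < R"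
  defines "d \<equiv> DIM('a::euclidean_space)"
  shows "has_bochner_integral lborel (\<lambda>z :: 'a. indicator (ball 0 R) z * norm z powr a)
    (real d / (real d + a) * measure lborel (ball (0::'a) 1) * R powr (real d + a))"
proof -
  define V where "V = measure lborel (ball (0::'a) 1)"
  have V: "V = unit_ball_vol (real d)" "V \<ge> 0" by (simp_all add: V_def content_ball d_def)
  have d: "d > 0" by (simp add: d_def)
  define h where "h r z = (if 0 \<le> r \<and> r \<le> norm z \<and> norm z < R then ennreal (a * r powr (a - 1)) else 0)"
    for r and z :: 'a
  have meas: "case_prod h \<in> borel_measurable (lborel \<Otimes>\<^sub>M lborel)"
    unfolding h_def case_prod_unfold by measurable
  have inner: "(\<integral>\<^sup>+r. h r z \<partial>lborel) = ennreal (indicator (ball 0 R) z * norm z powr a)" for z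
  proof -
    have "((\<lambda>r. a * r powr (a - 1)) has_integral (a * (norm z powr (a - 1 + 1) / (a - 1 + 1)))) {0..norm z}"
      by (intro has_integral_mult_right has_integral_powr_from_0) (use a in auto)
    from nn_integral_has_integral_lebesgue'[OF _ this] a
    have "(\<integral>\<^sup>+r. ennreal (a * r powr (a - 1)) * indicator {0..norm z} r \<partial>lborel) = ennreal (norm z powr a)"
      by simp
    moreover have "h r z = ennreal (a * r powr (a - 1)) * indicator {0..norm z} r" if "norm z < R" for r
      using that by (simp add: h_def indicator_def)
    moreover have "h r z = 0" if "\<not> norm z < R" for r using that by (simp add: h_def)
    ultimately show ?thesis by (cases "norm z < R") simp_all
  qed
  have outer: "(\<integral>\<^sup>+z. h r z \<partial>lborel) =
      ennreal (a * r powr (a - 1) * (V * R ^ d) - a * V * r powr (real d + a - 1)) * indicator {0..R} r" for r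
  proof (cases "0 \<le> r \<and> r \<le> R")
    case True
    have "(\<integral>\<^sup>+z. h r z \<partial>lborel) = (\<integral>\<^sup>+z. ennreal (a * r powr (a - 1)) * indicator (ball 0 R - ball (0::'a) r) z \<partial>lborel)"
      using True by (intro nn_integral_cong) (auto simp: h_def indicator_def not_less)
    also have "\<dots> = ennreal (a * r powr (a - 1)) * emeasure lborel (ball 0 R - ball (0::'a) r)"
      by (rule nn_integral_cmult_indicator) auto
    also have "emeasure lborel (ball 0 R - ball (0::'a) r) = emeasure lborel (ball (0::'a) R) - emeasure lborel (ball (0::'a) r)"
      using True by (intro emeasure_Diff) (auto simp: emeasure_ball)
    also have "\<dots> = ennreal (V * R ^ d - V * r ^ d)"
      using True V by (simp add: emeasure_ball d_def ennreal_minus)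
    also have "ennreal (a * r powr (a - 1)) * \<dots> = ennreal (a * r powr (a - 1) * (V * R ^ d - V * r ^ d))"
      using True V a R by (intro ennreal_mult[symmetric]) (auto intro!: mult_left_mono power_mono)
    also have "r powr (a - 1) * r ^ d = r powr (real d + a - 1)"
    proof (cases "r = 0")
      case False
      then show ?thesis using True by (simp add: powr_realpow[symmetric] flip: powr_add) (simp add: algebra_simps)
    qed (use d in simp)
    then have "a * r powr (a - 1) * (V * R ^ d - V * r ^ d) =
        a * r powr (a - 1) * (V * R ^ d) - a * V * r powr (real d + a - 1)"
      by (simp add: algebra_simps)
    finally show ?thesis using True by simp
  next
    case False
    then have "h r z = 0" for z
      by (auto simp: h_def)
    then show ?thesis using False by (simp add: indicator_def)
  qed
  have "(\<integral>\<^sup>+z. ennreal (indicator (ball (0 :: 'a) R) z * norm z powr a) \<partial>lborel) = (\<integral>\<^sup>+z. \<integral>\<^sup>+r. h r z \<partial>lborel \<partial>lborel)"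
    by (simp add: inner)
  also have "\<dots> = (\<integral>\<^sup>+r. \<integral>\<^sup>+z. h r z \<partial>lborel \<partial>lborel)"
    by (rule lborel_pair.Fubini'[OF meas])
  also have "\<dots> = (\<integral>\<^sup>+r. ennreal (a * r powr (a - 1) * (V * R ^ d) - a * V * r powr (real d + a - 1)) * indicator {0..R} r \<partial>lborel)"
    by (simp add: outer)
  also have "\<dots> = ennreal (a * (R powr (a - 1 + 1) / (a - 1 + 1)) * (V * R ^ d) -
      a * V * (R powr (real d + a - 1 + 1) / (real d + a - 1 + 1)))"
  proof (rule nn_integral_has_integral_lebesgue')
    show "((\<lambda>r. a * r powr (a - 1) * (V * R ^ d) - a * V * r powr (real d + a - 1)) has_integral
        (a * (R powr (a - 1 + 1) / (a - 1 + 1)) * (V * R ^ d) -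
          a * V * (R powr (real d + a - 1 + 1) / (real d + a - 1 + 1)))) {0..R}"
      by (intro has_integral_diff has_integral_mult_right has_integral_mult_left has_integral_powr_from_0)
         (use a R d in auto)
    fix r assume r: "r \<in> {0..R}"
    have "a * V * r powr (real d + a - 1) = a * r powr (a - 1) * (V * r ^ d)"
      using r d by (cases "r = 0") (auto simp: powr_add powr_diff powr_realpow)
    also have "\<dots> \<le> a * r powr (a - 1) * (V * R ^ d)"
      using r a V by (intro mult_left_mono power_mono) auto
    finally show "0 \<le> a * r powr (a - 1) * (V * R ^ d) - a * V * r powr (real d + a - 1)" by simp
  qed
  also have "a * (R powr (a - 1 + 1) / (a - 1 + 1)) * (V * R ^ d) -
      a * V * (R powr (real d + a - 1 + 1) / (real d + a - 1 + 1)) =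
      real d / (real d + a) * V * R powr (real d + a)"
    using a R d by (simp add: powr_add powr_realpow field_simps)
  finally show ?thesis
    unfolding V_def[symmetric] using V a R d
    by (intro has_bochner_integral_nn_integral) (auto simp: indicator_def)
qed

section \<open>Averages over the torus\<close>

definition fcube :: "'a::euclidean_space set" where
  "fcube = cbox (- (pi *\<^sub>R One)) (pi *\<^sub>R One)"

text \<open>Normalized to total mass one, so that means and Fourier coefficients are plain
  integrals.\<close>

definition torus :: "'a::euclidean_space measure" where
  "torus = density lborel (\<lambda>z. ennreal (indicator fcube z / (2 * pi) ^ DIM('a)))"

lemma mem_fcube: "z \<in> fcube \<longleftrightarrow> (\<forall>b\<in>Basis. \<bar>z \<bullet> b\<bar> \<le> pi)"
  by (auto simp: fcube_def mem_box abs_le_iff)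

lemma fcube_borel [measurable]: "fcube \<in> sets borel"
  by (simp add: fcube_def)

lemma sets_torus [simp, measurable_cong]: "sets torus = sets borel"
  and space_torus [simp]: "space torus = UNIV"
  by (simp_all add: torus_def)

lemma measure_fcube: "measure lborel (fcube :: 'a::euclidean_space set) = (2 * pi) ^ DIM('a)"
  unfolding fcube_def by (subst content_cbox) (auto simp: algebra_simps)

lemma emeasure_fcube: "emeasure lborel (fcube :: 'a::euclidean_space set) = ennreal ((2 * pi) ^ DIM('a))"
  by (metis emeasure_eq_ennreal_measure emeasure_lborel_cbox_finite fcube_def infinity_ennreal_def
      less_irrefl measure_fcube)

lemma emeasure_torus_UNIV [simp]: "emeasure (torus :: 'a::euclidean_space measure) UNIV = 1"
proof -
  have "emeasure (torus :: 'a measure) UNIV = (\<integral>\<^sup>+z. ennreal (1 / (2 * pi) ^ DIM('a)) * indicator (fcube :: 'a set) z \<partial>lborel)"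
    unfolding torus_def by (subst emeasure_density) (auto intro!: nn_integral_cong simp: indicator_def)
  also have "\<dots> = 1"
    by (subst nn_integral_cmult_indicator) (auto simp: emeasure_fcube simp flip: ennreal_mult')
  finally show ?thesis .
qed

interpretation torus: finite_measure "torus :: 'a::euclidean_space measure"
  by (rule finite_measureI) simp

lemma measure_torus_UNIV [simp]: "measure (torus :: 'a::euclidean_space measure) UNIV = 1"
  by (simp add: measure_def)

lemma integral_torus:
  fixes f :: "'a::euclidean_space \<Rightarrow> real"
  assumes [measurable]: "f \<in> borel_measurable borel"
  shows "integral\<^sup>L torus f = (\<integral>z. indicator fcube z * f z \<partial>lborel) / (2 * pi) ^ DIM('a)"
  unfolding torus_def by (subst integral_density) auto

lemma integrable_torus_bounded:
  fixes f :: "'a::euclidean_space \<Rightarrow> 'b::{banach,second_countable_topology}"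
  assumes "f \<in> borel_measurable borel" "\<And>z. norm (f z) \<le> B"
  shows "integrable torus f"
  by (rule torus.integrable_const_bound[of _ B]) (use assms in auto)

lemma AE_torus: "AE z in torus. z \<in> fcube"
  unfolding torus_def by (subst AE_density) (auto simp: indicator_def)

lemma integral_cis_period:
  fixes c :: real
  assumes "c \<in> \<int>"
  shows "integrable lborel (\<lambda>t. indicator {-pi..pi} t *\<^sub>R cis (t * c))"
    and "(\<integral>t. indicator {-pi..pi} t *\<^sub>R cis (t * c) \<partial>lborel) = of_real (2 * pi) * of_bool (c = 0)"
proof -
  show "integrable lborel (\<lambda>t. indicator {-pi..pi} t *\<^sub>R cis (t * c))"
    by (rule borel_integrable_compact) (auto intro!: continuous_intros simp: cis_conv_exp)
  show "(\<integral>t. indicator {-pi..pi} t *\<^sub>R cis (t * c) \<partial>lborel) = of_real (2 * pi) * of_bool (c = 0)"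
  proof (cases "c = 0")
    case True
    then show ?thesis by (simp add: scaleR_conv_of_real)
  next
    case False
    obtain n where n: "c = of_int n" using assms by (auto elim: Ints_cases)
    define F where "F t = cis (t * c) / (\<i> * of_real c)" for t
    have "(F has_vector_derivative cis (t * c)) (at t within S)" for t S
    proof -
      have "((\<lambda>w. exp (\<i> * (w * of_real c)) / (\<i> * of_real c)) has_field_derivative
          exp (\<i> * (of_real t * of_real c))) (at (of_real t))"
        using False by (auto intro!: derivative_eq_intros simp: algebra_simps)
      from has_vector_derivative_real_field[OF this] show ?thesis
        unfolding F_def[abs_def] by (simp add: cis_conv_exp)
    qed
    then have "(\<integral>t. indicator {-pi..pi} t *\<^sub>R cis (t * c) \<partial>lborel) = F pi - F (- pi)"
      by (intro integral_FTC_Icc) (auto intro!: continuous_intros simp: cis_conv_exp)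
    also have "\<dots> = 0"
    proof -
      have "cis (pi * c) = cis (- pi * c)"
        by (simp add: n complex_eq_iff sin_times_pi_eq_0 mult.commute[of pi])
      then show ?thesis by (simp add: F_def)
    qed
    finally show ?thesis using False by simp
  qed
qed

text \<open>The exponential factorizes over the coordinates, and a coordinate with nonzero integer
  frequency integrates to zero over its period.\<close>

lemma integral_cis_fcube:
  fixes X :: "'a::euclidean_space"
  assumes "\<And>b. b \<in> Basis \<Longrightarrow> X \<bullet> b \<in> \<int>"
  shows "(\<integral>z. indicator fcube z *\<^sub>R cis (z \<bullet> X) \<partial>lborel) = of_real ((2 * pi) ^ DIM('a)) * of_bool (X = 0)"
proof -
  interpret product_sigma_finite "\<lambda>_ :: 'a. lborel :: real measure" ..
  define k where "k b = (\<lambda>t. indicator {-pi..pi} t *\<^sub>R cis (t * (X \<bullet> b)))" for b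
  have "(\<integral>z. indicator fcube z *\<^sub>R cis (z \<bullet> X) \<partial>lborel) =
      (\<integral>f. indicator fcube (\<Sum>b\<in>Basis. f b *\<^sub>R b) *\<^sub>R cis ((\<Sum>b\<in>Basis. f b *\<^sub>R b) \<bullet> X)
         \<partial>(\<Pi>\<^sub>M b\<in>(Basis :: 'a set). lborel))"
    by (subst lborel_eq, subst integral_distr) (auto simp: cis_conv_exp)
  also have "\<dots> = (\<integral>f. (\<Prod>b\<in>Basis. k b (f b)) \<partial>(\<Pi>\<^sub>M b\<in>(Basis :: 'a set). lborel))"
  proof (rule Bochner_Integration.integral_cong[OF refl])
    fix f :: "'a \<Rightarrow> real"
    have "(\<Sum>b\<in>Basis. f b *\<^sub>R b) \<bullet> X = (\<Sum>b\<in>Basis. f b * (X \<bullet> b))"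
      unfolding inner_sum_left by (simp add: inner_commute)
    moreover have "cis (\<Sum>b\<in>Basis. f b * (X \<bullet> b)) = (\<Prod>b\<in>Basis. cis (f b * (X \<bullet> b)))"
      by (simp add: cis_conv_exp sum_distrib_left exp_sum)
    moreover have "indicator fcube (\<Sum>b\<in>Basis. f b *\<^sub>R b :: 'a) = (\<Prod>b\<in>(Basis :: 'a set). indicator {-pi..pi} (f b) :: real)"
    proof (cases "(\<Sum>b\<in>Basis. f b *\<^sub>R b :: 'a) \<in> fcube")
      case True
      then have "\<forall>b\<in>Basis. f b \<in> {-pi..pi}" by (auto simp: mem_fcube abs_le_iff minus_le_iff)
      then show ?thesis using True by simp
    next
      case False
      then obtain b :: 'a where "b \<in> Basis" "f b \<notin> {-pi..pi}" by (auto simp: mem_fcube abs_le_iff minus_le_iff)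
      then show ?thesis using False by (auto simp: prod_zero_iff indicator_def)
    qed
    ultimately show "indicator fcube (\<Sum>b\<in>Basis. f b *\<^sub>R b) *\<^sub>R cis ((\<Sum>b\<in>Basis. f b *\<^sub>R b) \<bullet> X) =
       (\<Prod>b\<in>Basis. k b (f b))"
      by (simp add: k_def scaleR_conv_of_real prod.distrib)
  qed
  also have "\<dots> = (\<Prod>b\<in>Basis. integral\<^sup>L lborel (k b))"
    by (rule product_integral_prod) (auto simp: k_def assms intro!: integral_cis_period)
  also have "\<dots> = (\<Prod>b\<in>Basis. of_real (2 * pi) * of_bool (X \<bullet> b = 0))"
    unfolding k_def by (intro prod.cong refl integral_cis_period(2) assms)
  also have "\<dots> = of_real ((2 * pi) ^ DIM('a)) * (\<Prod>b\<in>Basis. of_bool (X \<bullet> b = 0))"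
    by (simp add: prod.distrib)
  also have "(\<Prod>b\<in>Basis. of_bool (X \<bullet> b = 0)) = (of_bool (X = 0) :: complex)"
    by (cases "X = 0") (auto simp: euclidean_eq_iff[of X 0] prod_zero_iff)
  finally show ?thesis .
qed

lemma integral_cos_torus:
  fixes X :: "'a::euclidean_space"
  assumes "\<And>b. b \<in> Basis \<Longrightarrow> X \<bullet> b \<in> \<int>"
  shows "(\<integral>z. cos (z \<bullet> X) \<partial>torus) = of_bool (X = 0)"
proof -
  have int: "integrable lborel (\<lambda>z. indicator fcube z *\<^sub>R cis (z \<bullet> X))"
    unfolding fcube_def
    by (rule borel_integrable_compact) (auto intro!: continuous_intros simp: cis_conv_exp)
  have "(\<integral>z. cos (z \<bullet> X) \<partial>torus) = (\<integral>z. Re (indicator fcube z *\<^sub>R cis (z \<bullet> X)) \<partial>lborel) / (2 * pi) ^ DIM('a)"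
    by (subst integral_torus) auto
  also have "(\<integral>z. Re (indicator fcube z *\<^sub>R cis (z \<bullet> X)) \<partial>lborel) = (2 * pi) ^ DIM('a) * of_bool (X = 0)"
    using integral_Re[OF int] integral_cis_fcube[OF assms] by (simp add: of_bool_def)
  finally show ?thesis by simp
qed

section \<open>Lattice points as frequencies, and lattice neighbours\<close>

definition lvec :: "int ^ 'd::finite \<Rightarrow> real ^ 'd" where
  "lvec x = (\<chi> i. real_of_int (x $ i))"

lemma lvec_eq_0_iff [simp]: "lvec x = 0 \<longleftrightarrow> x = 0"
  by (simp add: lvec_def vec_eq_iff)

lemma lvec_diff: "lvec (x - y) = lvec x - lvec y"
  and lvec_add: "lvec (x + y) = lvec x + lvec y"
  by (simp_all add: lvec_def vec_eq_iff)

lemma inner_lvec_axis: "z \<bullet> lvec (axis i 1) = z $ i"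
proof -
  have "lvec (axis i 1) = axis i 1" by (simp add: lvec_def vec_eq_iff axis_def)
  then show ?thesis by (simp add: inner_axis)
qed

lemma integral_cos_lvec: "(\<integral>z. cos (z \<bullet> lvec x) \<partial>torus) = of_bool (x = 0)"
proof -
  have "lvec x \<bullet> b \<in> \<int>" if "b \<in> Basis" for b
    using that by (auto simp: Basis_vec_def inner_axis lvec_def)
  then show ?thesis by (simp add: integral_cos_torus)
qed

lemma lattice_adj_set: "{y. lattice_adj y x} = range (\<lambda>i. x + axis i 1) \<union> range (\<lambda>i. x - axis i 1)"
  by (auto simp: lattice_adj_def image_iff algebra_simps)

lemma finite_lattice_adj: "finite {y. lattice_adj y (x :: int ^ 'd::finite)}"
  by (simp add: lattice_adj_set)

lemma sum_lattice_adj: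
  fixes f :: "int ^ 'd::finite \<Rightarrow> 'b::comm_monoid_add"
  shows "(\<Sum>y | lattice_adj y x. f y) = (\<Sum>i\<in>UNIV. f (x + axis i 1) + f (x - axis i 1))"
proof -
  have ax: "axis i (1 :: int) \<noteq> - axis j 1" for i j :: 'd
  proof
    assume "axis i (1 :: int) = - axis j 1"
    then have "axis i (1 :: int) $ i = - axis j 1 $ i" by simp
    then show False by (simp add: axis_def split: if_splits)
  qed
  have "(\<Sum>y | lattice_adj y x. f y) = sum f (range (\<lambda>i. x + axis i 1)) + sum f (range (\<lambda>i. x - axis i 1))"
    unfolding lattice_adj_set
  proof (rule sum.union_disjoint)
    show "range (\<lambda>i. x + axis i 1) \<inter> range (\<lambda>i. x - axis i 1) = {}"
      using ax by (auto simp: diff_conv_add_uminus simp del: add_uminus_conv_diff)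
  qed auto
  also have "\<dots> = (\<Sum>i\<in>UNIV. f (x + axis i 1)) + (\<Sum>i\<in>UNIV. f (x - axis i 1))"
    by (subst (1 2) sum.reindex) (auto simp: inj_on_def axis_eq_axis)
  finally show ?thesis by (simp add: sum.distrib)
qed

section \<open>The heat kernel\<close>

text \<open>The shift \<open>b = 2d\<close> turns the Laplacian into the adjacency operator. Its powers have nonnegative
  entries, which is how positivity of the heat kernel is obtained.\<close>

definition lap_shift :: "real \<Rightarrow> (int ^ 'd::finite \<Rightarrow> real) \<Rightarrow> int ^ 'd \<Rightarrow> real" where
  "lap_shift b f x = laplacian f x + b * f x"

lemma lvec_0 [simp]: "lvec 0 = 0"
  by simp

lemma lap_shift_0: "lap_shift 0 = laplacian"
  by (simp add: lap_shift_def fun_eq_iff)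

lemma lap_shift_eq_adj_sum:
  fixes f :: "int ^ 'd::finite \<Rightarrow> real"
  shows "lap_shift (2 * real CARD('d)) f x = (\<Sum>y | lattice_adj y x. f y)"
proof -
  have "card {y. lattice_adj y x} = 2 * CARD('d)"
    using sum_lattice_adj[of "\<lambda>_. 1 :: nat" x] by simp
  then show ?thesis by (simp add: lap_shift_def laplacian_def sum_subtractf)
qed

text \<open>Opposite neighbours contribute sine terms that cancel, so the cosine alone is an
  eigenfunction. The constant g lets the identity be iterated and used under the integral
  sign.\<close>

lemma lap_shift_cos:
  "lap_shift b (\<lambda>v. g * cos (z \<bullet> lvec (v - x))) v = (b - lsymbol z) * (g * cos (z \<bullet> lvec (v - x)))"
proof -
  have eq: "g * cos (z \<bullet> lvec (v + axis i 1 - x)) - g * cos (z \<bullet> lvec (v - x)) +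
      (g * cos (z \<bullet> lvec (v - axis i 1 - x)) - g * cos (z \<bullet> lvec (v - x))) =
      - ((2 - 2 * cos (z $ i)) * (g * cos (z \<bullet> lvec (v - x))))" for i
  proof -
    have *: "z \<bullet> lvec (v + axis i 1 - x) = z \<bullet> lvec (v - x) + z $ i"
      "z \<bullet> lvec (v - axis i 1 - x) = z \<bullet> lvec (v - x) - z $ i"
      by (simp_all add: lvec_diff lvec_add inner_diff_right inner_add_right inner_lvec_axis)
    show ?thesis unfolding * cos_add cos_diff by (simp add: algebra_simps)
  qed
  show ?thesis
    unfolding lap_shift_def laplacian_def sum_lattice_adj eq
      sum_negf sum_distrib_right[symmetric] lsymbol_def[symmetric]
    by (simp add: left_diff_distrib)
qed

lemma lap_shift_pow_cos:
  "(lap_shift b ^^ n) (\<lambda>v. cos (z \<bullet> lvec (v - x))) = (\<lambda>v. (b - lsymbol z) ^ n * cos (z \<bullet> lvec (v - x)))"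
  by (induction n) (auto simp: lap_shift_cos)

lemma lsymbol_borel [measurable]: "lsymbol \<in> borel_measurable borel"
  by (intro borel_measurable_continuous_onI continuous_intros)

lemma lap_shift_integral:
  assumes "\<And>x. integrable M (F x)"
  shows "lap_shift b (\<lambda>x. \<integral>z. F x z \<partial>M) x = (\<integral>z. lap_shift b (\<lambda>x. F x z) x \<partial>M)"
  using assms by (simp add: lap_shift_def laplacian_def)

lemma abs_lsymbol_pow_cos_le:
  fixes z :: "real ^ 'd::finite"
  shows "\<bar>(b - lsymbol z) ^ n * cos u\<bar> \<le> (\<bar>b\<bar> + 4 * real CARD('d)) ^ n"
proof -
  have "\<bar>b - lsymbol z\<bar> \<le> \<bar>b\<bar> + 4 * real CARD('d)"
    using lsymbol_le[of z] lsymbol_nonneg[of z] by linarith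
  then have "\<bar>b - lsymbol z\<bar> ^ n * \<bar>cos u\<bar> \<le> (\<bar>b\<bar> + 4 * real CARD('d)) ^ n * 1"
    by (intro mult_mono power_mono) auto
  then show ?thesis by (simp add: abs_mult power_abs)
qed

text \<open>The indicator of a point is the torus mean of cosines centred there, and each of these
  is an eigenfunction of the shifted operator.\<close>

lemma lap_shift_pow_indicator:
  "(lap_shift b ^^ n) (indicator {y}) x = (\<integral>z. (b - lsymbol z) ^ n * cos (z \<bullet> lvec (x - y)) \<partial>torus)"
proof (induction n arbitrary: x)
  case 0
  then show ?case by (simp add: integral_cos_lvec indicator_def)
next
  case (Suc n)
  have "(lap_shift b ^^ n) (indicator {y}) = (\<lambda>x. \<integral>z. (b - lsymbol z) ^ n * cos (z \<bullet> lvec (x - y)) \<partial>torus)"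
    by (rule ext) (rule Suc)
  then have "(lap_shift b ^^ Suc n) (indicator {y}) x =
      lap_shift b (\<lambda>x. \<integral>z. (b - lsymbol z) ^ n * cos (z \<bullet> lvec (x - y)) \<partial>torus) x" by simp
  also have "\<dots> = (\<integral>z. lap_shift b (\<lambda>x. (b - lsymbol z) ^ n * cos (z \<bullet> lvec (x - y))) x \<partial>torus)"
    by (intro lap_shift_integral integrable_torus_bounded) (auto simp only: real_norm_def intro!: abs_lsymbol_pow_cos_le, measurable)
  finally show ?case by (simp add: lap_shift_cos mult.assoc)
qed

lemma has_sum_finite_sum:
  fixes f :: "'i \<Rightarrow> 'a \<Rightarrow> 'b::topological_comm_monoid_add"
  assumes "finite J" "\<And>j. j \<in> J \<Longrightarrow> (f j has_sum s j) A"
  shows "((\<lambda>y. \<Sum>j\<in>J. f j y) has_sum (\<Sum>j\<in>J. s j)) A"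
  using assms by (induction J rule: finite_induct) (auto intro!: has_sum_add)

text \<open>The kernel expansion of a power of the operator, for arbitrary u. It is later applied
  with u a cosine, where the right side is explicit.\<close>

lemma lap_shift_pow_has_sum:
  "((\<lambda>y. (lap_shift b ^^ n) (indicator {y}) x * u y) has_sum (lap_shift b ^^ n) u x) UNIV"
proof (induction n arbitrary: x)
  case 0
  have "((\<lambda>y. indicator {y} x * u y) has_sum u x) {x}"
    by (rule has_sum_finiteI) auto
  then have "((\<lambda>y. indicator {y} x * u y) has_sum u x) UNIV"
    by (rule has_sum_cong_neutral[THEN iffD1, rotated -1]) auto
  then show ?case by simp
next
  case (Suc n)
  have "((\<lambda>y. (\<Sum>v | lattice_adj v x. (lap_shift b ^^ n) (indicator {y}) v * u y +
        (- 1) * ((lap_shift b ^^ n) (indicator {y}) x * u y)) +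
      b * ((lap_shift b ^^ n) (indicator {y}) x * u y)) has_sum
      ((\<Sum>v | lattice_adj v x. (lap_shift b ^^ n) u v + (- 1) * (lap_shift b ^^ n) u x) + b * (lap_shift b ^^ n) u x)) UNIV"
    by (intro has_sum_add has_sum_finite_sum finite_lattice_adj has_sum_cmult_right Suc)
  then show ?case
    by (simp add: lap_shift_def[of b "(lap_shift b ^^ n) _"] laplacian_def sum_distrib_left sum_distrib_right algebra_simps)
qed

lemma exp_series_torus:
  fixes h g :: "real ^ 'd::finite \<Rightarrow> real"
  assumes [measurable]: "h \<in> borel_measurable borel" "g \<in> borel_measurable borel"
    and h: "\<And>z. \<bar>h z\<bar> \<le> B" and g: "\<And>z. \<bar>g z\<bar> \<le> C"
  shows "(\<lambda>n. t ^ n / fact n * (\<integral>z. h z ^ n * g z \<partial>torus)) sums (\<integral>z. exp (t * h z) * g z \<partial>torus)"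
proof -
  define f where "f n z = t ^ n / fact n * (h z ^ n * g z)" for n z
  have C: "C \<ge> 0" and B: "B \<ge> 0" using order_trans[OF abs_ge_zero g] order_trans[OF abs_ge_zero h] by auto
  have bound: "norm (f n z) \<le> (\<bar>t\<bar> * B) ^ n /\<^sub>R fact n * C" for n z
  proof -
    have "\<bar>h z\<bar> ^ n * \<bar>g z\<bar> \<le> B ^ n * C"
      using g h C B by (intro mult_mono power_mono) auto
    then have "\<bar>t\<bar> ^ n / fact n * (\<bar>h z\<bar> ^ n * \<bar>g z\<bar>) \<le> \<bar>t\<bar> ^ n / fact n * (B ^ n * C)"
      by (rule mult_left_mono) auto
    then show ?thesis by (simp add: f_def abs_mult power_abs power_mult_distrib field_simps)
  qed
  have summ: "summable (\<lambda>n. (\<bar>t\<bar> * B) ^ n /\<^sub>R fact n * C)"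
    by (intro summable_mult2 summable_exp_generic)
  have int: "integrable torus (f n)" for n
    by (rule integrable_torus_bounded[OF _ bound]) (simp add: f_def)
  have "(\<lambda>n. integral\<^sup>L torus (f n)) sums (\<integral>z. (\<Sum>n. f n z) \<partial>torus)"
  proof (rule sums_integral[OF int])
    show "AE z in torus. summable (\<lambda>n. norm (f n z))"
      using bound by (intro AE_I2 summable_comparison_test'[OF summ, of 0]) auto
    show "summable (\<lambda>n. \<integral>z. norm (f n z) \<partial>torus)"
    proof (rule summable_comparison_test'[OF summ, of 0])
      fix n
      have "(\<integral>z. norm (f n z) \<partial>torus) \<le> integral\<^sup>L torus (\<lambda>z :: real ^ 'd. (\<bar>t\<bar> * B) ^ n /\<^sub>R fact n * C)"
        by (intro integral_mono integrable_norm int torus.integrable_const bound)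
      then show "norm (\<integral>z. norm (f n z) \<partial>torus) \<le> (\<bar>t\<bar> * B) ^ n /\<^sub>R fact n * C"
        by simp
    qed
  qed
  moreover have "(\<Sum>n. f n z) = exp (t * h z) * g z" for z
  proof -
    have "(\<lambda>n. (t * h z) ^ n /\<^sub>R fact n * g z) sums (exp (t * h z) * g z)"
      by (intro sums_mult2 exp_converges)
    then show ?thesis by (simp add: f_def sums_iff power_mult_distrib field_simps)
  qed
  moreover have "integral\<^sup>L torus (f n) = t ^ n / fact n * (\<integral>z. h z ^ n * g z \<partial>torus)" for n
    unfolding f_def[abs_def] by (rule integral_mult_right_zero)
  ultimately show ?thesis by (simp only:)
qed

text \<open>Used twice: b = 0 gives the heat kernel as a torus integral, and b = 2d gives its
  expansion in powers of the adjacency operator.\<close>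

lemma lap_shift_exp_sums:
  "(\<lambda>n. t ^ n / fact n * (lap_shift b ^^ n) (indicator {y}) x) sums
     (\<integral>z. exp (t * (b - lsymbol z)) * cos (z \<bullet> lvec (x - y :: int ^ 'd::finite)) \<partial>torus)"
  unfolding lap_shift_pow_indicator
proof (rule exp_series_torus[where C = 1])
  show "\<bar>b - lsymbol z\<bar> \<le> \<bar>b\<bar> + 4 * real CARD('d)" for z :: "real ^ 'd"
    using lsymbol_le[of z] lsymbol_nonneg[of z] by linarith
qed auto

lemma heat_kernel_eq:
  "heat_kernel t x y = (\<integral>z. exp (- (t * lsymbol z)) * cos (z \<bullet> lvec (x - y)) \<partial>torus)"
  using lap_shift_exp_sums[of t 0 y x]
  by (simp add: heat_kernel_def heat_semigroup_def lap_shift_0 sums_iff)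

text \<open>The shift multiplies the semigroup by e^{2dt}. Up to that positive factor the heat
  kernel is, for t \<ge> 0, a series of nonnegative terms.\<close>

lemma heat_kernel_adj_sums:
  "(\<lambda>n. t ^ n / fact n * (lap_shift (2 * real CARD('d)) ^^ n) (indicator {y}) x) sums
     (exp (t * (2 * real CARD('d))) * heat_kernel t x (y :: int ^ 'd::finite))"
proof -
  have "(\<integral>z. exp (t * (2 * real CARD('d) - lsymbol z)) * cos (z \<bullet> lvec (x - y)) \<partial>torus) =
     (\<integral>z. exp (t * (2 * real CARD('d))) * (exp (- (t * lsymbol z)) * cos (z \<bullet> lvec (x - y))) \<partial>torus)"
    by (intro Bochner_Integration.integral_cong refl) (simp add: right_diff_distrib exp_diff exp_minus field_simps)
  also have "\<dots> = exp (t * (2 * real CARD('d))) * heat_kernel t x y"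
    by (simp add: heat_kernel_eq)
  finally show ?thesis using lap_shift_exp_sums[of t "2 * real CARD('d)" y x] by simp
qed

lemma adj_pow_nonneg:
  "0 \<le> (lap_shift (2 * real CARD('d)) ^^ n) (indicator {y}) (x :: int ^ 'd::finite)"
  by (induction n arbitrary: x) (auto simp: lap_shift_eq_adj_sum intro!: sum_nonneg)

lemma heat_kernel_nonneg:
  assumes "0 \<le> t"
  shows "0 \<le> heat_kernel t x (y :: int ^ 'd::finite)"
proof -
  have "0 \<le> exp (t * (2 * real CARD('d))) * heat_kernel t x y"
    by (rule sums_le[OF _ sums_zero heat_kernel_adj_sums])
       (use assms in \<open>auto simp: adj_pow_nonneg\<close>)
  then show ?thesis by (simp add: zero_le_mult_iff)
qed

text \<open>Summing the adjacency series over y first gives powers of the symbol, and summing over n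
  first gives the heat kernel. The two orders agree because the double family is absolutely
  summable.\<close>

lemma heat_kernel_has_sum:
  fixes x :: "int ^ 'd::finite"
  assumes t: "0 \<le> t"
  shows "((\<lambda>y. heat_kernel t x y * cos (w \<bullet> lvec (x - y))) has_sum exp (- (t * lsymbol w))) UNIV"
proof -
  define D where "D = 2 * real CARD('d)"
  define a where "a n y = t ^ n / fact n * (lap_shift D ^^ n) (indicator {y}) x" for n y
  have a_nonneg: "0 \<le> a n y" for n y
    using t by (auto simp: a_def D_def adj_pow_nonneg)
  have a_n: "((\<lambda>n. a n y) has_sum exp (t * D) * heat_kernel t x y) UNIV" for y
    using heat_kernel_adj_sums[of t y x] a_nonneg
    by (intro sums_nonneg_imp_has_sum) (auto simp: a_def D_def)
  have a_y: "((\<lambda>y. a n y * cos (v \<bullet> lvec (x - y))) has_sum (t ^ n / fact n * (D - lsymbol v) ^ n)) UNIV" for n v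
  proof -
    have "cos (v \<bullet> lvec (x - y)) = cos (v \<bullet> lvec (y - x))" for y
      by (simp add: lvec_diff inner_diff_right cos_diff)
    then have "((\<lambda>y. t ^ n / fact n * ((lap_shift D ^^ n) (indicator {y}) x * cos (v \<bullet> lvec (x - y)))) has_sum
        t ^ n / fact n * (lap_shift D ^^ n) (\<lambda>y. cos (v \<bullet> lvec (y - x))) x) UNIV"
      by (simp only:) (intro has_sum_cmult_right lap_shift_pow_has_sum)
    then show ?thesis unfolding lap_shift_pow_cos by (simp add: a_def mult.assoc)
  qed
  have exp_n: "((\<lambda>n. t ^ n / fact n * (D - lsymbol v) ^ n) has_sum exp (t * (D - lsymbol v))) UNIV" for v :: "real ^ 'd"
  proof (rule norm_summable_imp_has_sum)
    have eq: "(\<lambda>n. t ^ n / fact n * c ^ n) = (\<lambda>n. (t * c) ^ n /\<^sub>R fact n)" for c :: real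
      by (auto simp: power_mult_distrib field_simps)
    show "(\<lambda>n. t ^ n / fact n * (D - lsymbol v) ^ n) sums exp (t * (D - lsymbol v))"
      "summable (\<lambda>n. norm (t ^ n / fact n * (D - lsymbol v) ^ n))"
      unfolding fun_cong[OF eq] eq by (rule exp_converges summable_norm_exp)+
  qed
  \<comment> \<open>At frequency 0 all cosines are 1 and the terms are nonnegative with explicit row
    sums. This dominates the family at every frequency w.\<close>
  have "(\<lambda>(n, y). a n y) summable_on (UNIV \<times> UNIV)"
  proof (rule summable_on_SigmaI)
    show "((\<lambda>y. case (n, y) of (n, y) \<Rightarrow> a n y) has_sum t ^ n / fact n * (D - lsymbol (0 :: real ^ 'd)) ^ n) UNIV" for n
      using a_y[of n 0] by simp
  qed (use exp_n[of 0] a_nonneg in \<open>auto simp: summable_on_def\<close>)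
  then have "(\<lambda>p. norm (case p of (n, y) \<Rightarrow> a n y * cos (w \<bullet> lvec (x - y)))) summable_on (UNIV \<times> UNIV)"
    by (rule summable_on_comparison_test) (auto simp: abs_mult a_nonneg mult_left_le)
  then have "(\<lambda>(n, y). a n y * cos (w \<bullet> lvec (x - y))) summable_on (UNIV \<times> UNIV)"
    by (rule abs_summable_summable)
  then have "((\<lambda>(n, y). a n y * cos (w \<bullet> lvec (x - y))) has_sum exp (t * (D - lsymbol w))) (UNIV \<times> UNIV)"
    using a_y[of _ w] by (intro has_sum_SigmaI[OF _ exp_n[of w]]) auto
  then have "((\<lambda>(y, n). a n y * cos (w \<bullet> lvec (x - y))) has_sum exp (t * (D - lsymbol w))) (UNIV \<times> UNIV)"
    by (subst (asm) has_sum_swap) simp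
  then have "((\<lambda>y. exp (t * D) * heat_kernel t x y * cos (w \<bullet> lvec (x - y))) has_sum exp (t * (D - lsymbol w))) UNIV"
    by (rule has_sum_SigmaD) (auto intro!: has_sum_cmult_left a_n)
  then have "((\<lambda>y. exp (- (t * D)) * (exp (t * D) * heat_kernel t x y * cos (w \<bullet> lvec (x - y)))) has_sum
      exp (- (t * D)) * exp (t * (D - lsymbol w))) UNIV"
    by (rule has_sum_cmult_right)
  moreover have "exp (- (t * D)) * (exp (t * D) * r) = r" for r by (simp flip: exp_add mult.assoc)
  moreover have "exp (- (t * D)) * exp (t * (D - lsymbol w)) = exp (- (t * lsymbol w))"
    by (simp add: algebra_simps flip: exp_add)
  ultimately show ?thesis by (simp add: mult.assoc)
qed

section \<open>The fractional Laplacian as a matrix\<close>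

definition frac_matrix :: "real \<Rightarrow> int ^ 'd::finite \<Rightarrow> int ^ 'd \<Rightarrow> real" where
  "frac_matrix \<alpha> x y = (\<integral>z. lsymbol z powr (\<alpha> / 2) * cos (z \<bullet> lvec (x - y)) \<partial>torus)"

lemma frac_matrix_sym: "frac_matrix \<alpha> x y = frac_matrix \<alpha> y x"
  by (simp add: frac_matrix_def lvec_diff inner_diff_right cos_diff mult.commute)

lemma Gamma_neg_frac_pos:
  assumes "0 < \<alpha>" "\<alpha> < 2"
  shows "\<bar>Gamma (- \<alpha> / 2 :: real)\<bar> > 0"
  using minus_frac_not_nonpos_Int[of "\<alpha> / 2"] assms by (simp add: Gamma_eq_zero_iff)

lemma lsymbol_powr_le_const:
  assumes "0 < \<alpha>"
  shows "lsymbol (z :: real ^ 'd::finite) powr (\<alpha> / 2) \<le> (4 * real CARD('d)) powr (\<alpha> / 2)"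
  using assms by (intro powr_mono2) (auto intro: lsymbol_le)

lemma integrable_lsymbol_powr_cos:
  assumes "0 < \<alpha>" and [measurable]: "g \<in> borel_measurable borel" and g: "\<And>z. \<bar>g z\<bar> \<le> C"
  shows "integrable torus (\<lambda>z :: real ^ 'd::finite. lsymbol z powr (\<alpha> / 2) * g z)"
proof (rule integrable_torus_bounded)
  show "norm (lsymbol z powr (\<alpha> / 2) * g z) \<le> (4 * real CARD('d)) powr (\<alpha> / 2) * C" for z :: "real ^ 'd"
    using lsymbol_powr_le_const[OF assms(1), of z] g[of z] by (auto simp: abs_mult intro!: mult_mono)
qed measurable

lemma heat_kernel_compl:
  assumes "0 \<le> t"
  shows "(\<integral>z. (1 - exp (- (t * lsymbol z))) * cos (z \<bullet> lvec (x - y :: int ^ 'd::finite)) \<partial>torus) =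
     of_bool (x = y) - heat_kernel t x y"
proof -
  have 1: "integrable torus (\<lambda>z. cos (z \<bullet> lvec (x - y)))"
    by (rule integrable_torus_bounded[where B = 1]) auto
  have 2: "integrable torus (\<lambda>z. exp (- (t * lsymbol z)) * cos (z \<bullet> lvec (x - y)))"
    by (rule integrable_torus_bounded[where B = 1]) (auto simp: abs_mult assms intro!: mult_le_one)
  show ?thesis
    unfolding heat_kernel_eq using integral_cos_lvec[of "x - y"]
    by (simp add: left_diff_distrib Bochner_Integration.integral_diff[OF 1 2])
qed

text \<open>The scalar formula at a = \<open>lsymbol z\<close> is averaged over z against the
  cosine, and Fubini moves the t-integral outside. Subtracting the kernel from
  \<open>of_bool (x = y)\<close> is what keeps the integrand integrable at t = 0 on the diagonal as
  well.\<close>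

lemma has_bochner_integral_frac_matrix:
  assumes \<alpha>: "0 < \<alpha>" "\<alpha> < 2"
  shows "has_bochner_integral lborel
    (\<lambda>t. indicator {0<..} t * (t powr (- 1 - \<alpha> / 2) * (of_bool (x = y) - heat_kernel t x y)))
    (\<bar>Gamma (- \<alpha> / 2)\<bar> * frac_matrix \<alpha> x (y :: int ^ 'd::finite))"
proof -
  interpret pair_sigma_finite "torus :: (real ^ 'd) measure" "lborel :: real measure" ..
  define c where "c z = cos (z \<bullet> lvec (x - y))" for z
  define f where "f z t = indicator {0<..} t * (t powr (- 1 - \<alpha> / 2) * (1 - exp (- (t * lsymbol z)))) * c z"
    for z :: "real ^ 'd" and t :: real
  define G where "G = \<bar>Gamma (- \<alpha> / 2 :: real)\<bar>"
  have c: "\<bar>c z\<bar> \<le> 1" for z by (simp add: c_def)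
  have [measurable]: "c \<in> borel_measurable borel" unfolding c_def[abs_def] by measurable
  have base: "has_bochner_integral lborel
     (\<lambda>t. indicator {0<..} t * (t powr (- 1 - \<alpha> / 2) * (1 - exp (- (t * lsymbol z))))) (G * lsymbol z powr (\<alpha> / 2))"
    for z :: "real ^ 'd"
    using has_bochner_integral_frac_power[of "\<alpha> / 2" "lsymbol z"] \<alpha> by (simp add: G_def)
  have int_t: "has_bochner_integral lborel (f z) (G * (lsymbol z powr (\<alpha> / 2) * c z))" for z
    using has_bochner_integral_mult_left[OF base, of z "c z"] by (simp add: f_def[abs_def] mult.assoc)
  \<comment> \<open>The factor 1 - e^{-t Phi} is nonnegative, so absolute values affect the cosine
    only and the t-integral remains explicit; this supplies the integrability for Fubini.\<close>
  have norm_t: "(\<integral>t. norm (f z t) \<partial>lborel) = G * (lsymbol z powr (\<alpha> / 2) * \<bar>c z\<bar>)" for z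
  proof -
    have "norm (f z t) = indicator {0<..} t * (t powr (- 1 - \<alpha> / 2) * (1 - exp (- (t * lsymbol z)))) * \<bar>c z\<bar>" for t
      by (auto simp: f_def abs_mult indicator_def)
    then show ?thesis
      using has_bochner_integral_integral_eq[OF has_bochner_integral_mult_left[OF base, of z "\<bar>c z\<bar>"]]
      by (simp add: mult.assoc)
  qed
  have "integrable (torus \<Otimes>\<^sub>M lborel) (case_prod f)"
  proof (rule Fubini_integrable)
    show "case_prod f \<in> borel_measurable (torus \<Otimes>\<^sub>M lborel)"
      unfolding f_def case_prod_unfold by measurable
    show "integrable torus (\<lambda>z. \<integral>t. norm (case_prod f (z, t)) \<partial>lborel)"
      unfolding prod.case norm_t by (intro integrable_mult_right integrable_lsymbol_powr_cos[where C = 1]) (use \<alpha> c in auto)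
    show "AE z in torus. integrable lborel (\<lambda>t. case_prod f (z, t))"
      using int_t by (auto intro!: AE_I2 simp: has_bochner_integral_iff)
  qed
  note F = integrable_snd[OF this] Fubini_integral[OF this]
  have inner: "(\<integral>z. f z t \<partial>torus) =
      indicator {0<..} t * (t powr (- 1 - \<alpha> / 2) * (of_bool (x = y) - heat_kernel t x y))" for t
  proof (cases "t > 0")
    case True
    then have "(\<integral>z. f z t \<partial>torus) =
      (\<integral>z. t powr (- 1 - \<alpha> / 2) * ((1 - exp (- (t * lsymbol z))) * cos (z \<bullet> lvec (x - y))) \<partial>torus)"
      by (simp add: f_def c_def mult.assoc)
    also have "\<dots> = t powr (- 1 - \<alpha> / 2) * (of_bool (x = y) - heat_kernel t x y)"
      using heat_kernel_compl[of t x y] True by simp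
    finally show ?thesis using True by simp
  qed (simp add: f_def)
  have "(\<integral>z. \<integral>t. f z t \<partial>lborel \<partial>torus) = G * frac_matrix \<alpha> x y"
    using int_t by (simp add: has_bochner_integral_iff frac_matrix_def c_def)
  with F show ?thesis by (simp add: inner has_bochner_integral_iff G_def)
qed

lemma frac_kernel_eq:
  assumes \<alpha>: "0 < \<alpha>" "\<alpha> < 2" and "x \<noteq> y"
  shows "frac_kernel \<alpha> x (y :: int ^ 'd::finite) = - frac_matrix \<alpha> x y"
proof -
  have "has_bochner_integral lborel
    (\<lambda>t. - (indicator {0<..} t * (t powr (- 1 - \<alpha> / 2) * (0 - heat_kernel t x y))))
    (- (\<bar>Gamma (- \<alpha> / 2)\<bar> * frac_matrix \<alpha> x y))"
    using has_bochner_integral_minus[OF has_bochner_integral_frac_matrix[OF \<alpha>, of x y]] \<open>x \<noteq> y\<close> by simp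
  then have "(LINT t:{0<..}|lborel. t powr (- 1 - \<alpha> / 2) * heat_kernel t x y) = - (\<bar>Gamma (- \<alpha> / 2)\<bar> * frac_matrix \<alpha> x y)"
    by (simp add: has_bochner_integral_iff set_lebesgue_integral_def)
  then show ?thesis using Gamma_neg_frac_pos[OF \<alpha>] by (simp add: frac_kernel_def)
qed

section \<open>Action on functions supported in a finite set\<close>

lemma laplacian_pow_functions_on:
  assumes \<Omega>: "finite \<Omega>" and u: "u \<in> functions_on \<Omega>"
  shows "(laplacian ^^ n) u x = (\<Sum>y\<in>\<Omega>. of_real ((laplacian ^^ n) (indicator {y}) x) * u y)"
proof (induction n arbitrary: x)
  case 0
  show ?case
  proof (cases "x \<in> \<Omega>")
    case True
    have "(\<Sum>y\<in>\<Omega>. of_real (indicator {y} x) * u y) = (\<Sum>y\<in>\<Omega>. of_bool (y = x) * u y)"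
      by (intro sum.cong refl) (auto simp: indicator_def)
    then show ?thesis using True \<Omega> by (simp add: Int_absorb1)
  next
    case False
    then have "(\<Sum>y\<in>\<Omega>. of_real (indicator {y} x) * u y) = 0"
      by (intro sum.neutral) (auto simp: indicator_def)
    then show ?thesis using False u by (simp add: functions_on_def)
  qed
next
  case (Suc n)
  have "(laplacian ^^ Suc n) u x = (\<Sum>v | lattice_adj v x. (laplacian ^^ n) u v - (laplacian ^^ n) u x)"
    by (simp add: laplacian_def)
  also have "\<dots> = (\<Sum>v | lattice_adj v x. \<Sum>y\<in>\<Omega>.
      of_real ((laplacian ^^ n) (indicator {y}) v - (laplacian ^^ n) (indicator {y}) x) * u y)"
    by (intro sum.cong refl) (simp add: Suc left_diff_distrib sum_subtractf)
  also have "\<dots> = (\<Sum>y\<in>\<Omega>. \<Sum>v | lattice_adj v x.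
      of_real ((laplacian ^^ n) (indicator {y}) v - (laplacian ^^ n) (indicator {y}) x) * u y)"
    by (rule sum.swap)
  also have "\<dots> = (\<Sum>y\<in>\<Omega>. of_real ((laplacian ^^ Suc n) (indicator {y}) x) * u y)"
    by (intro sum.cong refl) (simp only: funpow.simps o_apply laplacian_def[of "(laplacian ^^ n) _"] of_real_sum sum_distrib_right)
  finally show ?case .
qed

lemma heat_semigroup_functions_on:
  assumes \<Omega>: "finite \<Omega>" and u: "u \<in> functions_on \<Omega>"
  shows "heat_semigroup t u x = (\<Sum>y\<in>\<Omega>. of_real (heat_kernel t x y) * u y)"
proof -
  have "(\<lambda>n. t ^ n / fact n * (laplacian ^^ n) (indicator {y}) x) sums heat_kernel t x y" for y
    using lap_shift_exp_sums[of t 0 y x] by (simp add: heat_kernel_eq lap_shift_0)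
  then have "(\<lambda>n. of_real (t ^ n / fact n * (laplacian ^^ n) (indicator {y}) x) * u y) sums
      (of_real (heat_kernel t x y) * u y)" for y
    by (intro sums_mult2) (simp only: sums_of_real_iff)
  then have "(\<lambda>n. \<Sum>y\<in>\<Omega>. of_real (t ^ n / fact n * (laplacian ^^ n) (indicator {y}) x) * u y) sums
      (\<Sum>y\<in>\<Omega>. of_real (heat_kernel t x y) * u y)"
    by (intro sums_sum)
  moreover have "(\<Sum>y\<in>\<Omega>. of_real (t ^ n / fact n * (laplacian ^^ n) (indicator {y}) x) * u y) =
      (t ^ n / fact n) *\<^sub>R (laplacian ^^ n) u x" for n
    unfolding laplacian_pow_functions_on[OF \<Omega> u] scaleR_conv_of_real sum_distrib_left
    by (intro sum.cong refl) (simp only: of_real_mult mult.assoc)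
  ultimately show ?thesis by (simp add: heat_semigroup_def sums_iff)
qed

text \<open>Finite support turns the semigroup into a finite kernel sum. Writing \<open>u x\<close>
  as a sum against \<open>of_bool (x = y)\<close> makes every entry integrable by itself, so the
  integral can be taken term by term.\<close>

lemma frac_laplacian_eq:
  fixes u :: "int ^ 'd::finite \<Rightarrow> complex"
  assumes \<alpha>: "0 < \<alpha>" "\<alpha> < 2" and \<Omega>: "finite \<Omega>" and u: "u \<in> functions_on \<Omega>" and x: "x \<in> \<Omega>"
  shows "frac_laplacian \<alpha> u x = (\<Sum>y\<in>\<Omega>. of_real (frac_matrix \<alpha> x y) * u y)"
proof -
  define G where "G = \<bar>Gamma (- \<alpha> / 2 :: real)\<bar>"
  define g where "g y t = indicator {0<..} t * (t powr (- 1 - \<alpha> / 2) * (of_bool (x = y) - heat_kernel t x y))"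
    for y and t :: real
  have G: "G > 0" unfolding G_def by (rule Gamma_neg_frac_pos[OF \<alpha>])
  have g: "has_bochner_integral lborel (\<lambda>t. complex_of_real (g y t) * u y) (of_real (G * frac_matrix \<alpha> x y) * u y)" for y
    unfolding g_def G_def
    by (intro has_bochner_integral_mult_left has_bochner_integral_of_real has_bochner_integral_frac_matrix \<alpha>)
  have "indicator {0<..} t *\<^sub>R (t powr (- 1 - \<alpha> / 2) *\<^sub>R (u x - heat_semigroup t u x)) =
      (\<Sum>y\<in>\<Omega>. of_real (g y t) * u y)" for t
  proof -
    have "u x = (\<Sum>y\<in>\<Omega>. of_real (of_bool (x = y)) * u y)"
    proof -
      have "(\<Sum>y\<in>\<Omega>. of_real (of_bool (x = y)) * u y) = (\<Sum>y\<in>\<Omega>. of_bool (y = x) * u y)"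
        by (intro sum.cong refl) auto
      then show ?thesis using \<Omega> x by (simp add: Int_absorb1)
    qed
    then have "u x - heat_semigroup t u x = (\<Sum>y\<in>\<Omega>. of_real (of_bool (x = y) - heat_kernel t x y) * u y)"
      unfolding heat_semigroup_functions_on[OF \<Omega> u] by (simp add: left_diff_distrib sum_subtractf)
    then show ?thesis
      unfolding g_def by (simp only: scaleR_conv_of_real sum_distrib_left of_real_mult mult.assoc)
  qed
  then have "(LINT t:{0<..}|lborel. (t powr (- 1 - \<alpha> / 2)) *\<^sub>R (u x - heat_semigroup t u x)) =
      (\<integral>t. (\<Sum>y\<in>\<Omega>. of_real (g y t) * u y) \<partial>lborel)"
    by (simp add: set_lebesgue_integral_def)
  also have "\<dots> = (\<Sum>y\<in>\<Omega>. of_real (G * frac_matrix \<alpha> x y) * u y)"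
    using g by (intro has_bochner_integral_integral_eq has_bochner_integral_sum)
  finally show ?thesis
    unfolding frac_laplacian_def G_def[symmetric] using G
    by (simp add: scaleR_conv_of_real sum_distrib_left field_simps)
qed

section \<open>Fourier inversion and the boundary term\<close>

text \<open>Dominated convergence speaks of sequences, whereas \<open>has_sum\<close> is a limit
  along the filter of finite sets; this exhaustion connects the two.\<close>

lemma finite_exhaustion:
  obtains F :: "nat \<Rightarrow> 'a::countable set" where "\<And>N. finite (F N)"
    "filterlim F (finite_subsets_at_top UNIV) sequentially"
proof -
  define F where "F N = {y :: 'a. to_nat y < N}" for N
  have fin: "finite (F N)" for N
  proof (rule finite_imageD)
    show "finite (to_nat ` F N)" by (rule finite_subset[of _ "{..<N}"]) (auto simp: F_def)
    show "inj_on to_nat (F N)" by (simp add: inj_on_def)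
  qed
  have "filterlim F (finite_subsets_at_top UNIV) sequentially"
    unfolding filterlim_finite_subsets_at_top
  proof (intro allI impI)
    fix X :: "'a set" assume "finite X \<and> X \<subseteq> UNIV"
    then have "bdd_above (to_nat ` X)" by simp
    then obtain K where "\<And>y. y \<in> X \<Longrightarrow> to_nat y \<le> K" by (auto simp: bdd_above_def)
    then have "X \<subseteq> F N" if "Suc K \<le> N" for N
      using that by (fastforce simp: F_def)
    then show "\<forall>\<^sub>F N in sequentially. finite (F N) \<and> X \<subseteq> F N \<and> F N \<subseteq> UNIV"
      using fin by (intro eventually_sequentiallyI[of "Suc K"]) auto
  qed
  with fin show ?thesis using that by blast
qed

lemma heat_kernel_sum_le:
  assumes "0 \<le> t" "finite F"
  shows "(\<Sum>y\<in>F. heat_kernel t x (y :: int ^ 'd::finite)) \<le> 1"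
proof -
  have "((\<lambda>y. heat_kernel t x y) has_sum 1) UNIV"
    using heat_kernel_has_sum[OF assms(1), of x 0] by simp
  then show ?thesis
    by (rule has_sum_mono2[OF has_sum_finite[OF assms(2)]]) (auto simp: heat_kernel_nonneg assms)
qed

lemma frac_kernel_nonneg:
  assumes \<alpha>: "0 < \<alpha>" "\<alpha> < 2"
  shows "0 \<le> frac_kernel \<alpha> x (y :: int ^ 'd::finite)"
  unfolding frac_kernel_def set_lebesgue_integral_def
  by (intro mult_nonneg_nonneg integral_nonneg_AE AE_I2) (auto simp: indicator_def heat_kernel_nonneg)

lemma frac_matrix_nonpos:
  assumes "0 < \<alpha>" "\<alpha> < 2" "x \<noteq> y"
  shows "frac_matrix \<alpha> x (y :: int ^ 'd::finite) \<le> 0"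
  using frac_kernel_nonneg[of \<alpha> x y] frac_kernel_eq[OF assms] assms by simp

text \<open>The heat kernel has total mass 1, so integrating 1 minus its sum over
  \<open>insert x F\<close> gives a nonnegative number. Hence every finite off-diagonal sum is
  bounded by the diagonal entry \<open>frac_matrix \<alpha> x x\<close>.\<close>

lemma frac_kernel_summable:
  assumes \<alpha>: "0 < \<alpha>" "\<alpha> < 2"
  shows "(\<lambda>y. frac_kernel \<alpha> x (y :: int ^ 'd::finite)) summable_on - {x}"
proof (rule nonneg_bdd_above_summable_on)
  define G where "G = \<bar>Gamma (- \<alpha> / 2 :: real)\<bar>"
  have G: "G > 0" unfolding G_def by (rule Gamma_neg_frac_pos[OF \<alpha>])
  show "bdd_above (sum (frac_kernel \<alpha> x) ` {F. F \<subseteq> - {x} \<and> finite F})"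
  proof (rule bdd_aboveI2)
    fix F assume "F \<in> {F. F \<subseteq> - {x} \<and> finite F}"
    then have F: "finite F" "x \<notin> F" by auto
    have "0 \<le> (\<Sum>y\<in>insert x F. G * frac_matrix \<alpha> x y)"
    proof -
      define K where "K t = (\<Sum>y\<in>insert x F. indicator {0<..} t *
          (t powr (- 1 - \<alpha> / 2) * (of_bool (x = y) - heat_kernel t x y)))" for t :: real
      have "has_bochner_integral lborel K (\<Sum>y\<in>insert x F. G * frac_matrix \<alpha> x y)"
        unfolding K_def[abs_def] G_def by (intro has_bochner_integral_sum has_bochner_integral_frac_matrix \<alpha>)
      moreover have "0 \<le> integral\<^sup>L lborel K"
      proof (rule integral_nonneg_AE, rule AE_I2)
        fix t
        show "0 \<le> K t"
        proof (cases "t > 0")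
          case True
          have "(\<Sum>y\<in>insert x F. of_bool (x = y)) = (1 :: real)"
            using F by simp
          then have "(\<Sum>y\<in>insert x F. of_bool (x = y) - heat_kernel t x y) \<ge> 0"
            using heat_kernel_sum_le[of t "insert x F" x] True F unfolding sum_subtractf by simp
          then show ?thesis unfolding K_def sum_distrib_left[symmetric] by simp
        qed (simp add: K_def)
      qed
      ultimately show ?thesis
        by (simp add: has_bochner_integral_integral_eq)
    qed
    then have "0 \<le> G * (\<Sum>y\<in>insert x F. frac_matrix \<alpha> x y)" by (simp add: sum_distrib_left)
    then have "0 \<le> (\<Sum>y\<in>insert x F. frac_matrix \<alpha> x y)" using G by (simp add: zero_le_mult_iff)
    moreover have "(\<Sum>y\<in>F. frac_kernel \<alpha> x y) = (\<Sum>y\<in>F. - frac_matrix \<alpha> x y)"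
      by (intro sum.cong refl frac_kernel_eq \<alpha>) (use F in auto)
    ultimately show "sum (frac_kernel \<alpha> x) F \<le> frac_matrix \<alpha> x x"
      using F by (simp add: sum_negf)
  qed
qed (simp add: frac_kernel_nonneg \<alpha>)

text \<open>Pointwise Fourier inversion. Comparison with the kernel shows that some sum S exists;
  its value is found by integrating the heat-kernel identity over t along an exhaustion of the
  lattice.\<close>

lemma frac_matrix_cos_has_sum:
  fixes x :: "int ^ 'd::finite"
  assumes \<alpha>: "0 < \<alpha>" "\<alpha> < 2"
  shows "((\<lambda>y. frac_matrix \<alpha> x y * cos (w \<bullet> lvec (x - y))) has_sum lsymbol w powr (\<alpha> / 2)) UNIV"
proof -
  define G where "G = \<bar>Gamma (- \<alpha> / 2 :: real)\<bar>"
  have G: "G > 0" unfolding G_def by (rule Gamma_neg_frac_pos[OF \<alpha>])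
  define c where "c y = cos (w \<bullet> lvec (x - y))" for y
  have c: "\<bar>c y\<bar> \<le> 1" "c x = 1" for y by (simp_all add: c_def)
  have "(\<lambda>y. norm (frac_matrix \<alpha> x y * c y)) summable_on - {x}"
  proof (rule summable_on_comparison_test[OF frac_kernel_summable[OF \<alpha>, of x]])
    fix y assume "y \<in> - {x}"
    then have "x \<noteq> y" by auto
    have "\<bar>frac_matrix \<alpha> x y\<bar> * \<bar>c y\<bar> \<le> \<bar>frac_matrix \<alpha> x y\<bar> * 1"
      by (intro mult_left_mono c) auto
    then show "norm (frac_matrix \<alpha> x y * c y) \<le> frac_kernel \<alpha> x y"
      using frac_matrix_nonpos[OF \<alpha> \<open>x \<noteq> y\<close>] frac_kernel_eq[OF \<alpha> \<open>x \<noteq> y\<close>] by (simp add: abs_mult)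
  qed auto
  then have "(\<lambda>y. frac_matrix \<alpha> x y * c y) summable_on - {x}"
    by (rule abs_summable_summable)
  then have "(\<lambda>y. frac_matrix \<alpha> x y * c y) summable_on insert x (- {x})"
    by (simp only: summable_on_insert_iff)
  moreover have "insert x (- {x}) = UNIV" by auto
  ultimately have "(\<lambda>y. frac_matrix \<alpha> x y * c y) summable_on UNIV"
    by simp
  then obtain S where S: "((\<lambda>y. frac_matrix \<alpha> x y * c y) has_sum S) UNIV"
    by (auto simp: summable_on_def)
  obtain F :: "nat \<Rightarrow> (int ^ 'd) set" where F: "\<And>N. finite (F N)"
    "filterlim F (finite_subsets_at_top UNIV) sequentially" using finite_exhaustion by blast
  have lim_S: "(\<lambda>N. \<Sum>y\<in>F N. frac_matrix \<alpha> x y * c y) \<longlonglongrightarrow> S"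
    using filterlim_compose[OF S[unfolded has_sum_def] F(2)] .
  define k where "k t y = indicator {0<..} t * (t powr (- 1 - \<alpha> / 2) * (of_bool (x = y) - heat_kernel t x y))"
    for t :: real and y
  have k: "has_bochner_integral lborel (\<lambda>t. k t y) (G * frac_matrix \<alpha> x y)" for y
    unfolding k_def G_def by (rule has_bochner_integral_frac_matrix[OF \<alpha>])
  have int_sum: "has_bochner_integral lborel (\<lambda>t. \<Sum>y\<in>F N. k t y * c y) (\<Sum>y\<in>F N. G * frac_matrix \<alpha> x y * c y)" for N
    by (intro has_bochner_integral_sum has_bochner_integral_mult_left k)
  define E where "E t = indicator {0<..} t * (t powr (- 1 - \<alpha> / 2) * (1 - exp (- (t * lsymbol w))))" for t :: real
  have E: "has_bochner_integral lborel E (G * lsymbol w powr (\<alpha> / 2))"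
    unfolding E_def[abs_def] G_def using has_bochner_integral_frac_power[of "\<alpha> / 2" "lsymbol w"] \<alpha> by simp
  have pointwise: "(\<lambda>N. \<Sum>y\<in>F N. k t y * c y) \<longlonglongrightarrow> E t" for t
  proof (cases "t > 0")
    case True
    have "((\<lambda>y. of_bool (x = y) * c y) has_sum 1) {x}"
      by (rule has_sum_finiteI) (auto simp: c)
    then have d: "((\<lambda>y. of_bool (x = y) * c y) has_sum 1) UNIV"
      by (rule has_sum_cong_neutral[THEN iffD1, rotated -1]) auto
    have "((\<lambda>y. of_bool (x = y) * c y - heat_kernel t x y * c y) has_sum (1 - exp (- (t * lsymbol w)))) UNIV"
      using has_sum_add[OF d has_sum_cmult_right[OF heat_kernel_has_sum[of t x w, folded c_def], of "- 1"]] True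
      by simp
    then have "((\<lambda>y. t powr (- 1 - \<alpha> / 2) * (of_bool (x = y) * c y - heat_kernel t x y * c y)) has_sum E t) UNIV"
      using True by (simp add: E_def) (rule has_sum_cmult_right)
    from filterlim_compose[OF this[unfolded has_sum_def] F(2)] True show ?thesis
      by (simp add: k_def algebra_simps)
  qed (simp add: k_def E_def)
  have xF: "\<forall>\<^sub>F N in sequentially. x \<in> F N"
    using F(2)[unfolded filterlim_finite_subsets_at_top, rule_format, of "{x}"] by (auto elim: eventually_mono)
  then obtain N0 where N0: "\<And>N. N \<ge> N0 \<Longrightarrow> x \<in> F N" by (auto simp: eventually_sequentially)
  \<comment> \<open>Majorant: the diagonal term is \<open>k t x\<close>, and by total mass 1 the
    off-diagonal terms have absolute sum at most \<open>k t x\<close> too, hence the factor 2. The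
    shift by \<open>N0\<close> ensures that x lies in the finite set, so that the diagonal term can
    be split off.\<close>
  have "(\<lambda>N. \<integral>t. (\<Sum>y\<in>F (N + N0). k t y * c y) \<partial>lborel) \<longlonglongrightarrow> (\<integral>t. E t \<partial>lborel)"
  proof (rule integral_dominated_convergence[where w = "\<lambda>t. 2 * k t x"])
    show "E \<in> borel_measurable lborel" by (rule borel_measurable_integrable[OF integrable.intros[OF E]])
    show "(\<lambda>t. \<Sum>y\<in>F (N + N0). k t y * c y) \<in> borel_measurable lborel" for N
      by (rule borel_measurable_integrable[OF integrable.intros[OF int_sum]])
    show "integrable lborel (\<lambda>t. 2 * k t x)"
      by (intro integrable_mult_right integrable.intros[OF k])
    show "AE t in lborel. (\<lambda>N. \<Sum>y\<in>F (N + N0). k t y * c y) \<longlonglongrightarrow> E t"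
      by (rule AE_I2, rule LIMSEQ_ignore_initial_segment, rule pointwise)
    show "AE t in lborel. norm (\<Sum>y\<in>F (N + N0). k t y * c y) \<le> 2 * k t x" for N
    proof (rule AE_I2)
      fix t :: real
      show "norm (\<Sum>y\<in>F (N + N0). k t y * c y) \<le> 2 * k t x"
      proof (cases "t > 0")
        case True
        define F' where "F' = F (N + N0) - {x}"
        have F': "F (N + N0) = insert x F'" "finite F'" "x \<notin> F'"
          using N0[of "N + N0"] F(1) by (auto simp: F'_def)
        define p where "p = t powr (- 1 - \<alpha> / 2)"
        have "\<bar>\<Sum>y\<in>F'. k t y * c y\<bar> \<le> (\<Sum>y\<in>F'. \<bar>k t y * c y\<bar>)" by (rule sum_abs)
        also have "\<dots> \<le> (\<Sum>y\<in>F'. p * heat_kernel t x y)"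
        proof (rule sum_mono)
          fix y assume "y \<in> F'"
          then have "\<bar>k t y * c y\<bar> = p * heat_kernel t x y * \<bar>c y\<bar>"
            using F' True heat_kernel_nonneg[of t x y] by (auto simp: k_def p_def abs_mult)
          also have "\<dots> \<le> p * heat_kernel t x y * 1"
            using c True by (intro mult_left_mono) (auto simp: p_def heat_kernel_nonneg)
          finally show "\<bar>k t y * c y\<bar> \<le> p * heat_kernel t x y" by simp
        qed
        also have "\<dots> \<le> p * (1 - heat_kernel t x x)"
          using heat_kernel_sum_le[of t "insert x F'" x] F' True
          unfolding sum_distrib_left[symmetric] by (intro mult_left_mono) (auto simp: p_def)
        also have "\<dots> = k t x" using True by (simp add: k_def p_def)
        finally have "\<bar>\<Sum>y\<in>F'. k t y * c y\<bar> \<le> k t x" .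
        then show ?thesis using F' c by simp
      qed (simp add: k_def)
    qed
  qed
  then have "(\<lambda>N. \<Sum>y\<in>F (N + N0). G * frac_matrix \<alpha> x y * c y) \<longlonglongrightarrow> G * lsymbol w powr (\<alpha> / 2)"
    by (simp only: has_bochner_integral_integral_eq[OF int_sum] has_bochner_integral_integral_eq[OF E])
  then have "(\<lambda>N. (1 / G) * (\<Sum>y\<in>F (N + N0). G * frac_matrix \<alpha> x y * c y)) \<longlonglongrightarrow> (1 / G) * (G * lsymbol w powr (\<alpha> / 2))"
    by (rule tendsto_mult_left)
  then have "(\<lambda>N. \<Sum>y\<in>F (N + N0). frac_matrix \<alpha> x y * c y) \<longlonglongrightarrow> lsymbol w powr (\<alpha> / 2)"
    using G by (simp add: sum_distrib_left)
  then have "S = lsymbol w powr (\<alpha> / 2)"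
    by (rule LIMSEQ_unique[OF LIMSEQ_ignore_initial_segment[OF lim_S, of N0]])
  with S show ?thesis by (simp add: c_def)
qed

text \<open>The boundary term is a sum over pairs with the outer point first. Symmetry of the kernel
  reverses the roles, which leaves a finite sum over \<Omega> of summable series.\<close>

lemma frac_boundary_eq:
  assumes \<alpha>: "0 < \<alpha>" "\<alpha> < 2" and \<Omega>: "finite \<Omega>"
  shows "frac_boundary \<alpha> \<Omega> = (\<Sum>x\<in>\<Omega>. \<Sum>\<^sub>\<infinity>y\<in>-\<Omega>. frac_kernel \<alpha> x (y :: int ^ 'd::finite))"
proof -
  have sym: "frac_kernel \<alpha> x y = frac_kernel \<alpha> y x" if "x \<noteq> y" for x y :: "int ^ 'd"
    using that by (simp add: frac_kernel_eq \<alpha> frac_matrix_sym)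
  have summ: "(\<lambda>y. frac_kernel \<alpha> x y) summable_on - \<Omega>" if "x \<in> \<Omega>" for x
    by (rule summable_on_subset_banach[OF frac_kernel_summable[OF \<alpha>, of x]]) (use that in auto)
  have "((\<lambda>(x, y). frac_kernel \<alpha> x y) has_sum (\<Sum>x\<in>\<Omega>. \<Sum>\<^sub>\<infinity>y\<in>-\<Omega>. frac_kernel \<alpha> x y)) (\<Omega> \<times> - \<Omega>)"
  proof (rule has_sum_SigmaI)
    show "((\<lambda>y. case (x, y) of (x, y) \<Rightarrow> frac_kernel \<alpha> x y) has_sum (\<Sum>\<^sub>\<infinity>y\<in>-\<Omega>. frac_kernel \<alpha> x y)) (- \<Omega>)"
      if "x \<in> \<Omega>" for x
      using summ[OF that] by simp
    then show "(\<lambda>(x, y). frac_kernel \<alpha> x y) summable_on (\<Omega> \<times> - \<Omega>)"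
      by (rule summable_on_SigmaI) (use \<Omega> in \<open>auto simp: frac_kernel_nonneg \<alpha>\<close>)
  qed (use \<Omega> in auto)
  then have "((\<lambda>(y, x). frac_kernel \<alpha> x y) has_sum (\<Sum>x\<in>\<Omega>. \<Sum>\<^sub>\<infinity>y\<in>-\<Omega>. frac_kernel \<alpha> x y)) ((- \<Omega>) \<times> \<Omega>)"
    by (subst (asm) has_sum_swap) simp
  moreover have "(case p of (y, x) \<Rightarrow> frac_kernel \<alpha> x y) = (case p of (x, y) \<Rightarrow> frac_kernel \<alpha> x y)"
    if "p \<in> (- \<Omega>) \<times> \<Omega>" for p
    using that by (cases p) (auto intro!: sym)
  ultimately have "((\<lambda>(x, y). frac_kernel \<alpha> x y) has_sum (\<Sum>x\<in>\<Omega>. \<Sum>\<^sub>\<infinity>y\<in>-\<Omega>. frac_kernel \<alpha> x y)) ((- \<Omega>) \<times> \<Omega>)"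
    using has_sum_cong[of "(- \<Omega>) \<times> \<Omega>"] by (metis (no_types, lifting))
  then show ?thesis by (simp add: frac_boundary_def infsumI)
qed

text \<open>The origin of the boundary term: inversion sums over the whole lattice, and the missing
  terms, with y outside \<Omega>, equal minus the kernel times a cosine. Nonnegativity of the kernel
  bounds their omission by the kernel itself.\<close>

lemma frac_matrix_cos_sum_le:
  assumes \<alpha>: "0 < \<alpha>" "\<alpha> < 2" and \<Omega>: "finite \<Omega>"
  shows "(\<Sum>x\<in>\<Omega>. \<Sum>y\<in>\<Omega>. frac_matrix \<alpha> x y * cos (w \<bullet> lvec (x - y :: int ^ 'd::finite))) \<le>
     real (card \<Omega>) * lsymbol w powr (\<alpha> / 2) + frac_boundary \<alpha> \<Omega>"
proof -
  have "(\<Sum>y\<in>\<Omega>. frac_matrix \<alpha> x y * cos (w \<bullet> lvec (x - y))) \<le>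
      lsymbol w powr (\<alpha> / 2) + (\<Sum>\<^sub>\<infinity>y\<in>-\<Omega>. frac_kernel \<alpha> x y)" if x: "x \<in> \<Omega>" for x
  proof -
    have "((\<lambda>y. frac_matrix \<alpha> x y * cos (w \<bullet> lvec (x - y))) has_sum
        (lsymbol w powr (\<alpha> / 2) - (\<Sum>y\<in>\<Omega>. frac_matrix \<alpha> x y * cos (w \<bullet> lvec (x - y))))) (- \<Omega>)"
      unfolding Compl_eq_Diff_UNIV
      by (rule has_sum_Diff[OF frac_matrix_cos_has_sum[OF \<alpha>] has_sum_finite[OF \<Omega>]]) simp
    from has_sum_cmult_right[OF this, of "- 1"]
    have 1: "((\<lambda>y. - (frac_matrix \<alpha> x y * cos (w \<bullet> lvec (x - y)))) has_sum
        - (lsymbol w powr (\<alpha> / 2) - (\<Sum>y\<in>\<Omega>. frac_matrix \<alpha> x y * cos (w \<bullet> lvec (x - y))))) (- \<Omega>)"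
      by simp
    have "(\<lambda>y. frac_kernel \<alpha> x y) summable_on - \<Omega>"
      by (rule summable_on_subset_banach[OF frac_kernel_summable[OF \<alpha>, of x]]) (use x in auto)
    then have 2: "((\<lambda>y. frac_kernel \<alpha> x y) has_sum (\<Sum>\<^sub>\<infinity>y\<in>-\<Omega>. frac_kernel \<alpha> x y)) (- \<Omega>)" by simp
    have "- (lsymbol w powr (\<alpha> / 2) - (\<Sum>y\<in>\<Omega>. frac_matrix \<alpha> x y * cos (w \<bullet> lvec (x - y)))) \<le>
       (\<Sum>\<^sub>\<infinity>y\<in>-\<Omega>. frac_kernel \<alpha> x y)"
    proof (rule has_sum_mono[OF 1 2])
      fix y assume "y \<in> - \<Omega>"
      then have q: "frac_kernel \<alpha> x y = - frac_matrix \<alpha> x y"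
        using x by (intro frac_kernel_eq \<alpha>) auto
      show "- (frac_matrix \<alpha> x y * cos (w \<bullet> lvec (x - y))) \<le> frac_kernel \<alpha> x y"
        unfolding q using mult_left_mono[OF cos_le_one[of "w \<bullet> lvec (x - y)"] frac_kernel_nonneg[OF \<alpha>, of x y], unfolded q]
        by linarith
    qed
    then show ?thesis by simp
  qed
  then have "(\<Sum>x\<in>\<Omega>. \<Sum>y\<in>\<Omega>. frac_matrix \<alpha> x y * cos (w \<bullet> lvec (x - y))) \<le>
      (\<Sum>x\<in>\<Omega>. lsymbol w powr (\<alpha> / 2) + (\<Sum>\<^sub>\<infinity>y\<in>-\<Omega>. frac_kernel \<alpha> x y))"
    by (rule sum_mono)
  then show ?thesis by (simp add: sum.distrib frac_boundary_eq[OF \<alpha> \<Omega>])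
qed

section \<open>Eigenvalue averages\<close>

text \<open>The discrete bathtub principle with threshold c = \<open>l (k - 1)\<close>: mass missing
  below the threshold reappears above it. Termwise, (c - l j)(1 - w j) \<ge> 0 for j < k and (l j -
  c) w j \<ge> 0 otherwise.\<close>

lemma sum_smallest_le_weighted_sum:
  fixes l w :: "nat \<Rightarrow> real"
  assumes mono: "\<And>i j. i \<le> j \<Longrightarrow> j < n \<Longrightarrow> l i \<le> l j"
    and w: "\<And>j. j < n \<Longrightarrow> 0 \<le> w j" "\<And>j. j < n \<Longrightarrow> w j \<le> 1"
    and sum_w: "(\<Sum>j<n. w j) = real k" and k: "1 \<le> k" "k \<le> n"
  shows "(\<Sum>j<k. l j) \<le> (\<Sum>j<n. l j * w j)"
proof -
  define c where "c = l (k - 1)"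
  have "c * w j + (if j < k then l j - c else 0) \<le> l j * w j" if "j < n" for j
  proof (cases "j < k")
    case True
    then have "l j \<le> c" unfolding c_def using k by (intro mono) auto
    then have "0 \<le> (c - l j) * (1 - w j)" using w(2)[OF that] by (intro mult_nonneg_nonneg) auto
    then show ?thesis using True by (simp add: algebra_simps)
  next
    case False
    then have "c \<le> l j" unfolding c_def using that by (intro mono) auto
    then show ?thesis using False w(1)[OF that] by (simp add: mult_right_mono)
  qed
  then have "(\<Sum>j<n. c * w j + (if j < k then l j - c else 0)) \<le> (\<Sum>j<n. l j * w j)"
    by (intro sum_mono) auto
  also have "(\<Sum>j<n. c * w j + (if j < k then l j - c else 0)) = c * real k + (\<Sum>j<n. if j < k then l j - c else 0)"
    by (simp add: sum.distrib sum_w flip: sum_distrib_left)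
  also have "(\<Sum>j<n. if j < k then l j - c else 0) = (\<Sum>j<k. l j - c)"
    using k by (intro sum.mono_neutral_cong_right) auto
  finally show ?thesis by (simp add: sum_subtractf)
qed

section \<open>Balls inside the cube\<close>

lemma ball_subset_fcube:
  assumes "R \<le> pi"
  shows "ball (0 :: 'a::euclidean_space) R \<subseteq> fcube"
proof
  fix z :: 'a assume "z \<in> ball 0 R"
  then have "norm z \<le> pi" using assms by simp
  then show "z \<in> fcube"
    using Basis_le_norm[of _ z] by (auto simp: mem_fcube intro: order_trans)
qed

text \<open>The ball's share of the torus is kept as a separate last factor, since for the chosen
  radius that share is k / card \<Omega>.\<close>

lemma integral_torus_ball_powr:
  assumes a: "0 < a" and R: "0 < R" "R \<le> pi"
  shows "integrable torus (\<lambda>z :: 'a::euclidean_space. indicator (ball 0 R) z * norm z powr a)"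
    and "(\<integral>z. indicator (ball (0 :: 'a) R) z * norm z powr a \<partial>torus) =
      real DIM('a) / (real DIM('a) + a) * R powr a *
        (measure lborel (ball (0 :: 'a) 1) * R ^ DIM('a) / (2 * pi) ^ DIM('a))"
proof -
  have [measurable]: "ball (0 :: 'a) R \<in> sets borel" by simp
  have sub: "z \<in> fcube" if "norm z < R" for z :: 'a
    using ball_subset_fcube[OF R(2), where 'a = 'a] that by auto
  show "integrable torus (\<lambda>z :: 'a. indicator (ball 0 R) z * norm z powr a)"
    by (rule integrable_torus_bounded[where B = "R powr a"])
       (use a in \<open>auto simp: indicator_def intro!: powr_mono2\<close>)
  have "(\<integral>z. indicator (ball (0 :: 'a) R) z * norm z powr a \<partial>torus) =
     (\<integral>z. indicator fcube z * (indicator (ball (0 :: 'a) R) z * norm z powr a) \<partial>lborel) / (2 * pi) ^ DIM('a)"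
    by (rule integral_torus) auto
  also have "(\<lambda>z. indicator fcube z * (indicator (ball (0 :: 'a) R) z * norm z powr a)) =
      (\<lambda>z. indicator (ball (0 :: 'a) R) z * norm z powr a)"
    by (auto simp: indicator_def fun_eq_iff sub)
  also have "(\<integral>z. indicator (ball (0 :: 'a) R) z * norm z powr a \<partial>lborel) =
      real DIM('a) / (real DIM('a) + a) * measure lborel (ball (0 :: 'a) 1) * R powr (real DIM('a) + a)"
    by (rule has_bochner_integral_integral_eq[OF integral_norm_powr_ball[OF a R(1)]])
  finally show "(\<integral>z. indicator (ball (0 :: 'a) R) z * norm z powr a \<partial>torus) =
      real DIM('a) / (real DIM('a) + a) * R powr a *
        (measure lborel (ball (0 :: 'a) 1) * R ^ DIM('a) / (2 * pi) ^ DIM('a))"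
    using R by (simp add: powr_add powr_realpow)
qed

lemma integral_torus_ball:
  assumes R: "0 < R" "R \<le> pi"
  shows "(\<integral>z. indicator (ball (0 :: 'a::euclidean_space) R) z \<partial>torus) =
     measure lborel (ball (0 :: 'a) 1) * R ^ DIM('a) / (2 * pi) ^ DIM('a)"
proof -
  have [measurable]: "ball (0 :: 'a) R \<in> sets borel" by simp
  have sub: "z \<in> fcube" if "norm z < R" for z :: 'a
    using ball_subset_fcube[OF R(2), where 'a = 'a] that by auto
  have "(\<integral>z. indicator (ball (0 :: 'a) R) z \<partial>torus) =
     (\<integral>z. indicator fcube z * indicator (ball (0 :: 'a) R) z \<partial>lborel) / (2 * pi) ^ DIM('a)"
    by (rule integral_torus) auto
  also have "(\<lambda>z. indicator fcube z * indicator (ball (0 :: 'a) R) z) = (indicator (ball (0 :: 'a) R) :: 'a \<Rightarrow> real)"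
    by (auto simp: indicator_def fun_eq_iff sub)
  finally show ?thesis using R by (simp add: content_ball)
qed

text \<open>This gives V / 2^d \<le> 1, which decides the minimum in the hypothesis when k is
  doubled.\<close>

lemma unit_ball_le: "measure lborel (ball (0 :: 'a::euclidean_space) 1) \<le> 2 ^ DIM('a)"
proof -
  have "measure lborel (ball (0 :: 'a) 1) \<le> measure lborel (cbox (- One) (One :: 'a))"
  proof (rule measure_mono_fmeasurable)
    show "ball (0 :: 'a) 1 \<subseteq> cbox (- One) One"
    proof
      fix z :: 'a assume "z \<in> ball 0 1"
      then have "\<bar>z \<bullet> b\<bar> \<le> 1" if "b \<in> Basis" for b
        using Basis_le_norm[OF that, of z] by simp
      then show "z \<in> cbox (- One) One" by (auto simp: mem_box abs_le_iff minus_le_iff)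
    qed
  qed auto
  also have "\<dots> = 2 ^ DIM('a)" by (subst content_cbox) auto
  finally show ?thesis .
qed

lemma powr_root_power:
  fixes c :: real
  assumes "0 < c" "0 < m"
  shows "(c powr (1 / real m)) ^ m = c"
proof -
  have "(c powr (1 / real m)) ^ m = (c powr (1 / real m)) powr real m"
    using assms by (subst powr_realpow) auto
  then show ?thesis using assms by (simp add: powr_powr)
qed

text \<open>The eigenvectors are numbered from 0, and \<open>e\<close> and \<open>l\<close> are
  constrained only below \<open>card \<Omega>\<close>, which is why index bounds accompany most
  facts here.\<close>

locale dirichlet_basis =
  fixes \<Omega> :: "(int ^ 'd::finite) set" and \<alpha> :: real
    and e :: "nat \<Rightarrow> int ^ 'd \<Rightarrow> real" and l :: "nat \<Rightarrow> real" and V :: real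
  assumes V: "V = measure lborel (ball (0 :: real ^ 'd) 1)" and \<Omega>: "finite \<Omega>" "\<Omega> \<noteq> {}" and \<alpha>: "0 < \<alpha>" "\<alpha> < 2"
    and orth: "\<And>i j. i < card \<Omega> \<Longrightarrow> j < card \<Omega> \<Longrightarrow> (\<Sum>x\<in>\<Omega>. e i x * e j x) = of_bool (i = j)"
    and eigen: "\<And>j x. j < card \<Omega> \<Longrightarrow> x \<in> \<Omega> \<Longrightarrow> (\<Sum>y\<in>\<Omega>. frac_matrix \<alpha> x y * e j y) = l j * e j x"
    and mono: "\<And>i j. i \<le> j \<Longrightarrow> j < card \<Omega> \<Longrightarrow> l i \<le> l j"
    and complete: "\<And>x y. x \<in> \<Omega> \<Longrightarrow> y \<in> \<Omega> \<Longrightarrow> (\<Sum>j<card \<Omega>. e j x * e j y) = of_bool (x = y)"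
begin

text \<open>This is \<open>\<bar>\<Sum>x. e\<^sup>i\<^sup>z\<^sup>x e j x\<bar>\<^sup>2\<close>, written without complex numbers.\<close>

definition mode_density :: "nat \<Rightarrow> real ^ 'd \<Rightarrow> real" where
  "mode_density j z = (\<Sum>x\<in>\<Omega>. \<Sum>y\<in>\<Omega>. e j x * e j y * cos (z \<bullet> lvec (x - y)))"

lemma card_pos: "0 < real (card \<Omega>)"
  using \<Omega> by (simp add: card_gt_0_iff)

lemma mode_density_borel [measurable]: "mode_density j \<in> borel_measurable borel"
  unfolding mode_density_def[abs_def] by measurable

lemma mode_density_nonneg: "0 \<le> mode_density j z"
proof -
  have "mode_density j z = (\<Sum>x\<in>\<Omega>. e j x * cos (z \<bullet> lvec x))\<^sup>2 + (\<Sum>x\<in>\<Omega>. e j x * sin (z \<bullet> lvec x))\<^sup>2"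
    by (simp add: mode_density_def power2_eq_square sum_product lvec_diff inner_diff_right cos_diff
        algebra_simps sum.distrib)
  then show ?thesis by simp
qed

lemma sum_mode_density: "(\<Sum>j<card \<Omega>. mode_density j z) = real (card \<Omega>)"
proof -
  have "(\<Sum>j<card \<Omega>. mode_density j z) = (\<Sum>x\<in>\<Omega>. \<Sum>y\<in>\<Omega>. \<Sum>j<card \<Omega>. e j x * e j y * cos (z \<bullet> lvec (x - y)))"
    unfolding mode_density_def by (subst sum.swap, intro sum.cong refl, subst sum.swap) simp
  also have "\<dots> = (\<Sum>x\<in>\<Omega>. \<Sum>y\<in>\<Omega>. of_bool (x = y) * cos (z \<bullet> lvec (x - y)))"
    by (intro sum.cong refl) (simp add: complete flip: sum_distrib_right)
  also have "\<dots> = (\<Sum>x\<in>\<Omega>. \<Sum>y\<in>\<Omega>. of_bool (y = x) * 1)"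
    by (intro sum.cong refl) auto
  also have "\<dots> = real (card \<Omega>)"
    using \<Omega> by (simp add: Int_absorb1 del: mult_1_right)
  finally show ?thesis .
qed

lemma mode_density_le:
  assumes "j < card \<Omega>"
  shows "mode_density j z \<le> real (card \<Omega>)"
  using member_le_sum[of j "{..<card \<Omega>}" "\<lambda>j. mode_density j z"] assms mode_density_nonneg
  by (simp add: sum_mode_density)

text \<open>Completeness and the eigenvalue equation give the spectral decomposition of the matrix
  on \<Omega>, so the basis disappears from the weighted sum of densities.\<close>

lemma sum_eigen_mode_density:
  "(\<Sum>j<card \<Omega>. l j * mode_density j z) = (\<Sum>x\<in>\<Omega>. \<Sum>y\<in>\<Omega>. frac_matrix \<alpha> x y * cos (z \<bullet> lvec (x - y)))"
proof -
  have M: "(\<Sum>j<card \<Omega>. l j * e j x * e j y) = frac_matrix \<alpha> x y" if "x \<in> \<Omega>" "y \<in> \<Omega>" for x y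
  proof -
    have "(\<Sum>j<card \<Omega>. l j * e j x * e j y) = (\<Sum>j<card \<Omega>. \<Sum>v\<in>\<Omega>. frac_matrix \<alpha> x v * e j v * e j y)"
      using that by (intro sum.cong refl) (simp add: eigen flip: sum_distrib_right)
    also have "\<dots> = (\<Sum>v\<in>\<Omega>. \<Sum>j<card \<Omega>. frac_matrix \<alpha> x v * e j v * e j y)"
      by (rule sum.swap)
    also have "\<dots> = (\<Sum>v\<in>\<Omega>. of_bool (v = y) * frac_matrix \<alpha> x v)"
      using that by (intro sum.cong refl) (simp add: mult.assoc complete flip: sum_distrib_left)
    also have "\<dots> = frac_matrix \<alpha> x y" using \<Omega> that by (simp add: Int_absorb1)
    finally show ?thesis .
  qed
  have "(\<Sum>j<card \<Omega>. l j * mode_density j z) =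
      (\<Sum>x\<in>\<Omega>. \<Sum>y\<in>\<Omega>. \<Sum>j<card \<Omega>. l j * e j x * e j y * cos (z \<bullet> lvec (x - y)))"
    unfolding mode_density_def sum_distrib_left
    by (subst sum.swap, intro sum.cong refl, subst sum.swap) (simp add: mult.assoc)
  also have "\<dots> = (\<Sum>x\<in>\<Omega>. \<Sum>y\<in>\<Omega>. frac_matrix \<alpha> x y * cos (z \<bullet> lvec (x - y)))"
    by (intro sum.cong refl) (simp add: M flip: sum_distrib_right)
  finally show ?thesis .
qed

lemma sum_eigen_mode_density_le:
  "(\<Sum>j<card \<Omega>. l j * mode_density j z) \<le> real (card \<Omega>) * lsymbol z powr (\<alpha> / 2) + frac_boundary \<alpha> \<Omega>"
  unfolding sum_eigen_mode_density by (rule frac_matrix_cos_sum_le[OF \<alpha> \<Omega>(1)])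

lemma integrable_mode_density:
  assumes "j < card \<Omega>" and [measurable]: "g \<in> borel_measurable borel" and g: "\<And>z. \<bar>g z\<bar> \<le> C"
  shows "integrable torus (\<lambda>z. g z * mode_density j z)"
proof (rule integrable_torus_bounded)
  show "norm (g z * mode_density j z) \<le> C * real (card \<Omega>)" for z
    using g[of z] mode_density_le[OF assms(1), of z] mode_density_nonneg[of j z] by (auto simp: abs_mult intro!: mult_mono)
qed measurable

lemma integral_mode_density:
  assumes j: "j < card \<Omega>"
  shows "(\<integral>z. mode_density j z \<partial>torus) = 1"
proof -
  have int: "integrable torus (\<lambda>z. e j x * e j y * cos (z \<bullet> lvec (x - y)))" for x y
    by (intro integrable_mult_right integrable_torus_bounded[where B = 1]) auto
  have "(\<integral>z. mode_density j z \<partial>torus) = (\<Sum>x\<in>\<Omega>. \<Sum>y\<in>\<Omega>. e j x * e j y * of_bool (x - y = 0))"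
    unfolding mode_density_def using int
    by (simp add: integral_cos_lvec)
  also have "\<dots> = (\<Sum>x\<in>\<Omega>. \<Sum>y\<in>\<Omega>. of_bool (y = x) * (e j x * e j y))"
    by (intro sum.cong refl) auto
  also have "\<dots> = 1" using \<Omega> orth[OF j j] by (simp add: Int_absorb1)
  finally show ?thesis .
qed

lemma integral_symbol_mode_density:
  assumes j: "j < card \<Omega>"
  shows "(\<integral>z. lsymbol z powr (\<alpha> / 2) * mode_density j z \<partial>torus) = l j"
proof -
  have int: "integrable torus (\<lambda>z. e j x * e j y * (lsymbol z powr (\<alpha> / 2) * cos (z \<bullet> lvec (x - y))))" for x y
    by (intro integrable_mult_right integrable_lsymbol_powr_cos[where C = 1]) (use \<alpha> in auto)
  have "(\<integral>z. lsymbol z powr (\<alpha> / 2) * mode_density j z \<partial>torus) =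
      (\<integral>z. (\<Sum>x\<in>\<Omega>. \<Sum>y\<in>\<Omega>. e j x * e j y * (lsymbol z powr (\<alpha> / 2) * cos (z \<bullet> lvec (x - y)))) \<partial>torus)"
    unfolding mode_density_def sum_distrib_left by (simp add: mult_ac)
  also have "\<dots> = (\<Sum>x\<in>\<Omega>. \<Sum>y\<in>\<Omega>. e j x * e j y * frac_matrix \<alpha> x y)"
    using int by (simp add: frac_matrix_def)
  also have "\<dots> = (\<Sum>x\<in>\<Omega>. e j x * (\<Sum>y\<in>\<Omega>. frac_matrix \<alpha> x y * e j y))"
    by (simp add: sum_distrib_left mult_ac)
  also have "\<dots> = l j * (\<Sum>x\<in>\<Omega>. e j x * e j x)"
    unfolding sum_distrib_left by (intro sum.cong refl) (simp add: eigen[OF j] flip: sum_distrib_left)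
  also have "\<dots> = l j" using orth[OF j j] by simp
  finally show ?thesis .
qed

lemma eigenvalue_nonneg:
  assumes "j < card \<Omega>"
  shows "0 \<le> l j"
  unfolding integral_symbol_mode_density[OF assms, symmetric]
  by (intro integral_nonneg_AE AE_I2 mult_nonneg_nonneg mode_density_nonneg) auto

text \<open>The radius at which the ball fills the fraction k / card \<Omega> of the torus; for such
  a ball the weights in the upper bound add up to exactly k.\<close>

definition radius :: "nat \<Rightarrow> real" where
  "radius k = 2 * pi * (real k / (V * real (card \<Omega>))) powr (1 / real CARD('d))"

lemma V_pos: "0 < V"
  by (simp add: V content_ball)

lemma radius_pos: "1 \<le> k \<Longrightarrow> 0 < radius k"
  using V_pos card_pos \<Omega> by (auto simp: radius_def zero_less_mult_iff)

lemma radius_powr: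
  "radius k powr a = (2 * pi) powr a * (real k / (V * real (card \<Omega>))) powr (a / real CARD('d))"
  by (simp add: radius_def powr_mult powr_powr)

lemma radius_volume:
  assumes "1 \<le> k"
  shows "V * radius k ^ CARD('d) / (2 * pi) ^ CARD('d) = real k / real (card \<Omega>)"
proof -
  have "real k / (V * real (card \<Omega>)) > 0"
    using assms V_pos card_pos by simp
  then have "((real k / (V * real (card \<Omega>))) powr (1 / real CARD('d))) ^ CARD('d) = real k / (V * real (card \<Omega>))"
    by (rule powr_root_power) simp
  then have "radius k ^ CARD('d) = (2 * pi) ^ CARD('d) * (real k / (V * real (card \<Omega>)))"
    by (simp only: radius_def power_mult_distrib)
  then show ?thesis using V_pos card_pos by simp
qed

lemma radius_leI:
  assumes "real k \<le> c ^ CARD('d) * V * real (card \<Omega>)" "0 \<le> c"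
  shows "radius k \<le> 2 * pi * c"
proof -
  have "(real k / (V * real (card \<Omega>))) powr (1 / real CARD('d)) \<le> (c ^ CARD('d)) powr (1 / real CARD('d))"
    using assms V_pos card_pos by (intro powr_mono2) (auto simp: field_simps)
  also have "\<dots> = c"
    using assms by (cases "c = 0") (auto simp: powr_powr simp flip: powr_realpow)
  finally show ?thesis by (simp add: radius_def)
qed

lemma radius_le_pi:
  assumes "real k \<le> min 1 (V / 2 ^ CARD('d)) * real (card \<Omega>)"
  shows "radius k \<le> pi"
proof -
  have "real k \<le> V / 2 ^ CARD('d) * real (card \<Omega>)"
    using assms by (rule order_trans) (intro mult_right_mono, auto)
  then have "radius k \<le> 2 * pi * (1 / 2)"
    by (intro radius_leI) (auto simp: power_divide)
  then show ?thesis by simp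
qed

lemma le_card_if:
  assumes "real k \<le> min 1 c * real (card \<Omega>)"
  shows "k \<le> card \<Omega>"
proof -
  have "min 1 c * real (card \<Omega>) \<le> 1 * real (card \<Omega>)" by (intro mult_right_mono) auto
  then show ?thesis using assms by simp
qed

section \<open>Upper bounds for the eigenvalues\<close>

lemma average_upper:
  assumes k: "1 \<le> k" "real k \<le> min 1 (V / 2 ^ CARD('d)) * real (card \<Omega>)"
  shows "(1 / real k) * (\<Sum>j<k. l j) \<le>
    real CARD('d) / (real CARD('d) + \<alpha>) * radius k powr \<alpha> + frac_boundary \<alpha> \<Omega> / real (card \<Omega>)"
proof -
  define n where "n = real (card \<Omega>)"
  define R where "R = radius k"
  define B where "B = (indicator (ball 0 R) :: real ^ 'd \<Rightarrow> real)"
  define w where "w j = (\<integral>z. B z * mode_density j z \<partial>torus)" for j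
  have n: "n > 0" unfolding n_def by (rule card_pos)
  have R: "0 < R" "R \<le> pi" unfolding R_def using radius_pos radius_le_pi k by auto
  have vol: "V * R ^ CARD('d) / (2 * pi) ^ CARD('d) = real k / n"
    unfolding R_def n_def by (rule radius_volume[OF k(1)])
  have [measurable]: "B \<in> borel_measurable borel"
    unfolding B_def by (intro borel_measurable_indicator) simp
  have B: "\<bar>B z\<bar> \<le> 1" "0 \<le> B z" "B z \<le> 1" for z by (auto simp: B_def indicator_def)
  have B_int: "(\<integral>z. B z \<partial>torus) = real k / n" "integrable torus B"
  proof -
    show "(\<integral>z. B z \<partial>torus) = real k / n"
      using integral_torus_ball[OF R, where 'a = "real ^ 'd"] vol[unfolded V] by (simp add: B_def)
    show "integrable torus B"
      by (rule integrable_torus_bounded[where B = 1]) (use B in auto)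
  qed
  have int: "integrable torus (\<lambda>z. B z * mode_density j z)" if "j < card \<Omega>" for j
    by (rule integrable_mode_density[OF that _ B(1)]) measurable
  have w: "0 \<le> w j" "w j \<le> 1" if "j < card \<Omega>" for j
  proof -
    show "0 \<le> w j" unfolding w_def by (intro integral_nonneg_AE AE_I2 mult_nonneg_nonneg B mode_density_nonneg)
    have "w j \<le> (\<integral>z. mode_density j z \<partial>torus)"
      unfolding w_def using integrable_mode_density[OF that, of "\<lambda>_. 1" 1]
      by (intro integral_mono int that mult_left_le_one_le B mode_density_nonneg) auto
    then show "w j \<le> 1" by (simp add: integral_mode_density[OF that])
  qed
  have "(\<Sum>j<card \<Omega>. w j) = (\<integral>z. (\<Sum>j<card \<Omega>. B z * mode_density j z) \<partial>torus)"
    unfolding w_def using int by (subst Bochner_Integration.integral_sum) auto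
  also have "\<dots> = (\<integral>z. B z * n \<partial>torus)"
    by (simp add: sum_mode_density n_def flip: sum_distrib_left)
  also have "\<dots> = real k" using B_int n by simp
  finally have sum_w: "(\<Sum>j<card \<Omega>. w j) = real k" .
  have "(\<Sum>j<k. l j) \<le> (\<Sum>j<card \<Omega>. l j * w j)"
    by (rule sum_smallest_le_weighted_sum[OF mono w sum_w k(1) le_card_if[OF k(2)]])
  also have "\<dots> = (\<integral>z. (\<Sum>j<card \<Omega>. l j * (B z * mode_density j z)) \<partial>torus)"
    unfolding w_def using int by (subst Bochner_Integration.integral_sum) auto
  \<comment> \<open>Only here is the symbol replaced by a power of the norm, whose ball integral is
    explicit; the constant boundary term picks up the mass k / n of the ball.\<close>
  also have "\<dots> \<le> (\<integral>z. n * (B z * norm z powr \<alpha>) + frac_boundary \<alpha> \<Omega> * B z \<partial>torus)"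
  proof (rule integral_mono)
    show "integrable torus (\<lambda>z. \<Sum>j<card \<Omega>. l j * (B z * mode_density j z))"
      using int by auto
    show "integrable torus (\<lambda>z. n * (B z * norm z powr \<alpha>) + frac_boundary \<alpha> \<Omega> * B z)"
      using integral_torus_ball_powr(1)[OF \<alpha>(1) R] B_int(2) by (auto simp: B_def)
    fix z :: "real ^ 'd"
    have "(\<Sum>j<card \<Omega>. l j * (B z * mode_density j z)) = B z * (\<Sum>j<card \<Omega>. l j * mode_density j z)"
      by (simp add: sum_distrib_left mult_ac)
    also have "\<dots> \<le> B z * (n * lsymbol z powr (\<alpha> / 2) + frac_boundary \<alpha> \<Omega>)"
      unfolding n_def by (intro mult_left_mono sum_eigen_mode_density_le B)
    also have "\<dots> \<le> B z * (n * norm z powr \<alpha> + frac_boundary \<alpha> \<Omega>)"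
      using n by (intro mult_left_mono add_right_mono lsymbol_powr_le \<alpha> B) auto
    finally show "(\<Sum>j<card \<Omega>. l j * (B z * mode_density j z)) \<le> n * (B z * norm z powr \<alpha>) + frac_boundary \<alpha> \<Omega> * B z"
      by (simp add: algebra_simps)
  qed
  also have "\<dots> = n * (\<integral>z. B z * norm z powr \<alpha> \<partial>torus) + frac_boundary \<alpha> \<Omega> * (real k / n)"
    using integral_torus_ball_powr(1)[OF \<alpha>(1) R, where 'a = "real ^ 'd"] B_int
    by (simp add: B_def[symmetric])
  also have "(\<integral>z. B z * norm z powr \<alpha> \<partial>torus) = real CARD('d) / (real CARD('d) + \<alpha>) * R powr \<alpha> * (real k / n)"
    unfolding vol[symmetric] B_def using integral_torus_ball_powr(2)[OF \<alpha>(1) R, where 'a = "real ^ 'd"] by (simp add: V)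
  finally have "(\<Sum>j<k. l j) \<le> n * (real CARD('d) / (real CARD('d) + \<alpha>) * R powr \<alpha> * (real k / n))
      + frac_boundary \<alpha> \<Omega> * (real k / n)" .
  moreover have "n * (A * (real k / n)) + b * (real k / n) = real k * (A + b / n)" for A b
    using n by (simp add: field_simps)
  ultimately have "(\<Sum>j<k. l j) \<le>
      real k * (real CARD('d) / (real CARD('d) + \<alpha>) * R powr \<alpha> + frac_boundary \<alpha> \<Omega> / n)"
    by (simp only:)
  moreover have "(1 / real k) * S \<le> X" if "S \<le> real k * X" for S X
    using k(1) that by (simp add: field_simps)
  ultimately show ?thesis unfolding R_def n_def by blast
qed

text \<open>Among the first 2k eigenvalues, k are at least \<open>l k\<close> (the one numbered k +
  1) and the remaining ones are nonnegative, so \<open>l k\<close> is at most twice their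
  average.\<close>

lemma next_eigenvalue_upper:
  assumes k: "1 \<le> k" "real k \<le> min 1 (V / 2 ^ (CARD('d) + 1)) * real (card \<Omega>)"
  shows "k < card \<Omega>"
    and "l k \<le> 2 * (real CARD('d) / (real CARD('d) + \<alpha>) * radius (2 * k) powr \<alpha>
      + frac_boundary \<alpha> \<Omega> / real (card \<Omega>))"
proof -
  \<comment> \<open>Without V / 2^d \<le> 1 the bound on k would not give 2k \<le> card
    \<Omega>.\<close>
  have V2: "V / 2 ^ CARD('d) \<le> 1" using unit_ball_le[where 'a = "real ^ 'd"] by (simp add: V)
  have "real k \<le> (V / 2 ^ (CARD('d) + 1)) * real (card \<Omega>)"
    using k(2) by (rule order_trans) (intro mult_right_mono, auto)
  then have k2: "real (2 * k) \<le> min 1 (V / 2 ^ CARD('d)) * real (card \<Omega>)"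
    using V2 by (simp add: min_absorb2 field_simps)
  have "2 * k \<le> card \<Omega>" by (rule le_card_if[OF k2])
  then show "k < card \<Omega>" using k(1) by simp
  have "real k * l k = (\<Sum>j\<in>{k..<2 * k}. l k)" by simp
  also have "\<dots> \<le> (\<Sum>j\<in>{k..<2 * k}. l j)"
    using \<open>2 * k \<le> card \<Omega>\<close> by (intro sum_mono mono) auto
  also have "\<dots> \<le> (\<Sum>j<2 * k. l j)"
    using \<open>2 * k \<le> card \<Omega>\<close> by (intro sum_mono2 eigenvalue_nonneg) auto
  finally have "l k \<le> 2 * ((1 / real (2 * k)) * (\<Sum>j<2 * k. l j))"
    using k(1) by (simp add: field_simps)
  also have "\<dots> \<le> 2 * (real CARD('d) / (real CARD('d) + \<alpha>) * radius (2 * k) powr \<alpha>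
      + frac_boundary \<alpha> \<Omega> / real (card \<Omega>))"
    using k(1) by (intro mult_left_mono average_upper k2) auto
  finally show "l k \<le> 2 * (real CARD('d) / (real CARD('d) + \<alpha>) * radius (2 * k) powr \<alpha>
      + frac_boundary \<alpha> \<Omega> / real (card \<Omega>))" .
qed

section \<open>Lower bounds for the eigenvalues\<close>

lemma average_le_last:
  assumes "1 \<le> k" "k \<le> card \<Omega>"
  shows "(1 / real k) * (\<Sum>j<k. l j) \<le> l (k - 1)"
proof -
  have "(\<Sum>j<k. l j) \<le> (\<Sum>j<k. l (k - 1))"
    using assms by (intro sum_mono mono) auto
  then show ?thesis using assms by (simp add: field_simps)
qed

lemma average_lower:
  assumes k: "1 \<le> k"
    "real k \<le> min 1 ((2 powr (1 - 1 / \<alpha>) * sqrt 3 / (2 * pi)) ^ CARD('d) * V) * real (card \<Omega>)"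
  shows "real CARD('d) / (real CARD('d) + \<alpha>) * radius k powr \<alpha>
      - (1 / 12) powr (\<alpha> / 2) * (real CARD('d) / (real CARD('d) + 2 * \<alpha>)) * radius k powr (2 * \<alpha>)
    \<le> (1 / real k) * (\<Sum>j<k. l j)"
proof -
  define n where "n = real (card \<Omega>)"
  define d where "d = real CARD('d)"
  define R where "R = radius k"
  define q where "q = (1 / 12 :: real) powr (\<alpha> / 2)"
  define g where "g r = r powr \<alpha> - q * r powr (2 * \<alpha>)" for r
  define B where "B = (indicator (ball 0 R) :: real ^ 'd \<Rightarrow> real)"
  have n: "n > 0" unfolding n_def by (rule card_pos)
  have q: "q > 0" by (simp add: q_def)
  have kn: "k \<le> card \<Omega>" using le_card_if[OF k(2)] .
  have "real k \<le> ((2 powr (1 - 1 / \<alpha>) * sqrt 3 / (2 * pi)) ^ CARD('d) * V) * real (card \<Omega>)"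
    using k(2) by (rule order_trans) (intro mult_right_mono, auto)
  then have "radius k \<le> 2 * pi * (2 powr (1 - 1 / \<alpha>) * sqrt 3 / (2 * pi))"
    by (rule radius_leI) auto
  then have R_le: "R \<le> 2 powr (1 - 1 / \<alpha>) * sqrt 3" by (simp add: R_def)
  have R0: "0 < R" unfolding R_def by (rule radius_pos[OF k(1)])
  \<comment> \<open>In the variable s = r^\<alpha> the minorant is s - q s^2, which increases up to
    s = 1/(2q). With q = 12^{-\<alpha>/2} this reads R \<le> 2^{1-1/\<alpha>} sqrt 3, the constant
    of the hypothesis.\<close>
  have R_alpha: "2 * q * R powr \<alpha> \<le> 1"
  proof -
    have "R powr \<alpha> \<le> (2 powr (1 - 1 / \<alpha>) * sqrt 3) powr \<alpha>"
      using R_le R0 \<alpha> by (intro powr_mono2) auto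
    also have "\<dots> = 2 powr (\<alpha> - 1) * 3 powr (\<alpha> / 2)"
      using \<alpha> by (simp add: powr_mult powr_powr left_diff_distrib flip: powr_half_sqrt)
    finally have "2 * q * R powr \<alpha> \<le> 2 * q * (2 powr (\<alpha> - 1) * 3 powr (\<alpha> / 2))"
      using q by (intro mult_left_mono) auto
    also have "\<dots> = q * (2 powr \<alpha> * 3 powr (\<alpha> / 2))" by (simp add: powr_diff)
    also have "2 powr \<alpha> = (4 :: real) powr (\<alpha> / 2)"
      using powr_powr[of 2 2 "\<alpha> / 2"] by simp
    also have "q * (4 powr (\<alpha> / 2) * 3 powr (\<alpha> / 2)) = 1"
      unfolding q_def powr_mult[symmetric] by simp
    finally show ?thesis .
  qed
  \<comment> \<open>From \<alpha> < 2 the exponent 2 - 2/\<alpha> is at most 1. The bound 6 serves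
    twice: it is below 12, as the minorant requires, and it gives R \<le> 3 < pi.\<close>
  have R_sq: "R\<^sup>2 \<le> 6"
  proof -
    have "R powr 2 \<le> (2 powr (1 - 1 / \<alpha>) * sqrt 3) powr 2"
      using R_le R0 by (intro powr_mono2) auto
    also have "\<dots> = 2 powr (2 - 2 / \<alpha>) * 3"
      by (simp add: powr_mult powr_powr left_diff_distrib)
    also have "2 powr (2 - 2 / \<alpha>) \<le> (2 :: real) powr 1"
      using \<alpha> by (intro powr_mono) (auto simp: field_simps)
    finally show ?thesis using R0 by simp
  qed
  have R_pi: "R \<le> pi"
  proof -
    have "R\<^sup>2 \<le> 3\<^sup>2" using R_sq by simp
    then have "R \<le> 3" by (rule power2_le_imp_le) simp
    then show ?thesis using pi_gt3 by simp
  qed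
  have vol: "V * R ^ CARD('d) / (2 * pi) ^ CARD('d) = real k / n"
    unfolding R_def n_def by (rule radius_volume[OF k(1)])
  \<comment> \<open>With s = r^\<alpha> and S = R^\<alpha>, the difference g R - g r factors as (S -
    s)(1 - q(s + S)).\<close>
  have g_mono: "g r \<le> g R" if "0 \<le> r" "r \<le> R" for r
  proof -
    have *: "g r = r powr \<alpha> - q * (r powr \<alpha>)\<^sup>2" if "0 \<le> r" for r
      using that by (simp add: g_def power2_eq_square mult.commute[of 2] flip: powr_add) 
    have le: "r powr \<alpha> \<le> R powr \<alpha>" using that \<alpha> by (intro powr_mono2) auto
    have "q * (r powr \<alpha> + R powr \<alpha>) \<le> q * (2 * R powr \<alpha>)"
      using le q by (intro mult_left_mono) auto
    then have "0 \<le> (R powr \<alpha> - r powr \<alpha>) * (1 - q * (r powr \<alpha> + R powr \<alpha>))"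
      using le R_alpha by (intro mult_nonneg_nonneg) auto
    then show ?thesis
      using *[OF that(1)] *[OF less_imp_le[OF R0]] by (simp add: algebra_simps power2_eq_square)
  qed
  have symbol_ge: "g (norm z) \<le> lsymbol z powr (\<alpha> / 2)" if "norm z \<le> R" for z :: "real ^ 'd"
  proof -
    have "(norm z)\<^sup>2 \<le> R\<^sup>2" using that by (intro power_mono) auto
    then show ?thesis unfolding g_def q_def using R_sq by (intro lsymbol_powr_ge \<alpha>) auto
  qed
  \<comment> \<open>Beyond the ball the minorant eventually decreases and is established only for
    |z|^2 \<le> 12. The point is therefore moved radially to the sphere of radius R, which can only
    lower the symbol.\<close>
  have symbol_ge': "g R \<le> lsymbol z powr (\<alpha> / 2)" if "z \<in> fcube" "R \<le> norm z" for z :: "real ^ 'd"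
  proof -
    define w where "w = (R / norm z) *\<^sub>R z"
    have z0: "z \<noteq> 0" using that R0 by auto
    then have "norm w = R" using R0 by (simp add: w_def)
    then have "g R \<le> lsymbol w powr (\<alpha> / 2)" using symbol_ge[of w] by simp
    also have "lsymbol w \<le> lsymbol z"
    proof (rule lsymbol_mono)
      fix i
      have "R / norm z * \<bar>z $ i\<bar> \<le> 1 * \<bar>z $ i\<bar>"
        using that R0 z0 by (intro mult_right_mono) (simp_all add: divide_le_eq)
      then show "\<bar>w $ i\<bar> \<le> \<bar>z $ i\<bar>" using R0 by (simp add: w_def abs_mult)
      show "\<bar>z $ i\<bar> \<le> pi"
        using that(1)[unfolded mem_fcube, rule_format, of "axis i 1"] by (simp add: inner_axis)
    qed
    then have "lsymbol w powr (\<alpha> / 2) \<le> lsymbol z powr (\<alpha> / 2)"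
      using \<alpha> by (intro powr_mono2) auto
    finally show ?thesis .
  qed
  define F where "F z = (\<Sum>j<k. mode_density j z)" for z
  have F: "0 \<le> F z" "F z \<le> n" for z
  proof -
    show "0 \<le> F z" unfolding F_def by (intro sum_nonneg mode_density_nonneg)
    have "F z \<le> (\<Sum>j<card \<Omega>. mode_density j z)"
      unfolding F_def using kn by (intro sum_mono2 mode_density_nonneg) auto
    then show "F z \<le> n" by (simp add: sum_mode_density n_def)
  qed
  \<comment> \<open>The bathtub inequality with threshold g R. Inside the ball g - g R is
    nonpositive, so F may be replaced by its maximum n; outside, the right side is a product of
    nonnegative factors.\<close>
  have pointwise: "n * (B z * (g (norm z) - g R)) \<le> lsymbol z powr (\<alpha> / 2) * F z - g R * F z"
    if "z \<in> fcube" for z :: "real ^ 'd"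
  proof (cases "norm z < R")
    case True
    have "n * (g (norm z) - g R) \<le> F z * (g (norm z) - g R)"
      using F[of z] g_mono[of "norm z"] True by (intro mult_right_mono_neg) auto
    also have "\<dots> \<le> F z * (lsymbol z powr (\<alpha> / 2) - g R)"
      using F[of z] symbol_ge[of z] True by (intro mult_left_mono) auto
    finally show ?thesis using True by (simp add: B_def algebra_simps)
  next
    case False
    then have "0 \<le> (lsymbol z powr (\<alpha> / 2) - g R) * F z"
      using symbol_ge'[OF that] F by (intro mult_nonneg_nonneg) auto
    then show ?thesis using False by (simp add: B_def algebra_simps)
  qed
  have int1: "integrable torus (\<lambda>z. lsymbol z powr (\<alpha> / 2) * mode_density j z)"
    "integrable torus (\<lambda>z. mode_density j z)" if "j < k" for j
    using integrable_mode_density[of j "\<lambda>z. lsymbol z powr (\<alpha> / 2)" "(4 * real CARD('d)) powr (\<alpha> / 2)"]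
      integrable_mode_density[of j "\<lambda>_. 1" 1] that kn lsymbol_powr_le_const[OF \<alpha>(1)] by auto
  have i1: "integrable torus (\<lambda>z. \<Sum>j<k. lsymbol z powr (\<alpha> / 2) * mode_density j z)"
    by (intro Bochner_Integration.integrable_sum int1) auto
  have i2: "integrable torus (\<lambda>z. \<Sum>j<k. g R * mode_density j z)"
    by (intro Bochner_Integration.integrable_sum integrable_mult_right int1) auto
  have int2: "integrable torus (\<lambda>z :: real ^ 'd. B z * norm z powr a)" "integrable torus B"
    "(\<integral>z. B z * norm z powr a \<partial>torus) = d / (d + a) * R powr a * (real k / n)"
    "(\<integral>z. B z \<partial>torus) = real k / n" if "0 < a" for a
  proof -
    show "integrable torus (\<lambda>z :: real ^ 'd. B z * norm z powr a)"
      using integral_torus_ball_powr(1)[OF that R0 R_pi, where 'a = "real ^ 'd"] by (simp add: B_def)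
    show "(\<integral>z. B z * norm z powr a \<partial>torus) = d / (d + a) * R powr a * (real k / n)"
      unfolding vol[symmetric] B_def d_def
      using integral_torus_ball_powr(2)[OF that R0 R_pi, where 'a = "real ^ 'd"] by (simp add: V)
    show "(\<integral>z. B z \<partial>torus) = real k / n"
      using integral_torus_ball[OF R0 R_pi, where 'a = "real ^ 'd"] vol[unfolded V] by (simp add: B_def)
    show "integrable torus B"
      unfolding B_def
      by (rule integrable_torus_bounded[where B = 1]) (auto intro!: borel_measurable_indicator simp: indicator_def)
  qed
  have B_g: "B z * (g (norm z) - g R) = B z * norm z powr \<alpha> - q * (B z * norm z powr (2 * \<alpha>)) - g R * B z" for z
    by (simp add: g_def algebra_simps)
  have "n * (d / (d + \<alpha>) * R powr \<alpha> * (real k / n) - q * (d / (d + 2 * \<alpha>) * R powr (2 * \<alpha>) * (real k / n))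
      - g R * (real k / n)) = (\<integral>z. n * (B z * (g (norm z) - g R)) \<partial>torus)"
    unfolding B_g using int2[of \<alpha>] int2[of "2 * \<alpha>"] \<alpha> by simp
  also have "\<dots> \<le> (\<integral>z. lsymbol z powr (\<alpha> / 2) * F z - g R * F z \<partial>torus)"
  proof (rule integral_mono_AE)
    show "integrable torus (\<lambda>z. n * (B z * (g (norm z) - g R)))"
      unfolding B_g using int2[of \<alpha>] int2[of "2 * \<alpha>"] \<alpha> by simp
    show "integrable torus (\<lambda>z. lsymbol z powr (\<alpha> / 2) * F z - g R * F z)"
      unfolding F_def sum_distrib_left using i1 i2 by (rule Bochner_Integration.integrable_diff)
    show "AE z in torus. n * (B z * (g (norm z) - g R)) \<le> lsymbol z powr (\<alpha> / 2) * F z - g R * F z"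
      using AE_torus by eventually_elim (rule pointwise)
  qed
  \<comment> \<open>F has mean k, which is n times the mass of the ball, so the threshold terms on
    the two sides cancel.\<close>
  also have "\<dots> = (\<Sum>j<k. l j) - g R * real k"
  proof -
    have "(\<integral>z. lsymbol z powr (\<alpha> / 2) * F z - g R * F z \<partial>torus) =
        (\<Sum>j<k. \<integral>z. lsymbol z powr (\<alpha> / 2) * mode_density j z \<partial>torus) - g R * (\<Sum>j<k. \<integral>z. mode_density j z \<partial>torus)"
      unfolding F_def sum_distrib_left Bochner_Integration.integral_diff[OF i1 i2]
      using int1 by (simp add: Bochner_Integration.integral_sum)
    then show ?thesis using kn by (simp add: integral_symbol_mode_density integral_mode_density)
  qed
  finally have "n * (d / (d + \<alpha>) * R powr \<alpha> * (real k / n) -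
      q * (d / (d + 2 * \<alpha>) * R powr (2 * \<alpha>) * (real k / n)) - g R * (real k / n)) \<le>
      (\<Sum>j<k. l j) - g R * real k" .
  moreover have "n * (A * (real k / n) - q * (D * r * (real k / n)) - G * (real k / n)) =
      real k * (A - q * D * r) - G * real k" for A D r G
    using n by (simp add: field_simps)
  ultimately have "real k * (d / (d + \<alpha>) * R powr \<alpha> - q * (d / (d + 2 * \<alpha>)) * R powr (2 * \<alpha>)) \<le> (\<Sum>j<k. l j)"
    by (simp only:)
  moreover have "X \<le> (1 / real k) * S" if "real k * X \<le> S" for S X
    using k(1) that by (simp add: field_simps)
  ultimately show ?thesis unfolding R_def d_def q_def by blast
qed

end

theorem theorem1p1:
  fixes \<Omega> :: "(int ^ 'd::finite) set" and \<alpha> V :: real and d :: nat and ev :: "nat \<Rightarrow> real"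
  assumes d: "d = CARD('d)"
    and V: "V = measure lborel (ball (0 :: real ^ 'd) 1)"
    and \<alpha>: "0 < \<alpha>" "\<alpha> < 2"
    and \<Omega>: "finite \<Omega>" "\<Omega> \<noteq> {}"
    and ev: "ev = dirichlet_eigenvalue \<alpha> \<Omega>"
  shows
    "(\<forall>k::nat. 1 \<le> k \<and> real k \<le> min 1 (V / 2 ^ d) * real (card \<Omega>) \<longrightarrow>
        (1 / real k) * (\<Sum>i=1..k. ev i) \<le>
          (2 * pi) powr \<alpha> * (real d / (real d + \<alpha>))
              * (real k / (V * real (card \<Omega>))) powr (\<alpha> / real d)
            + frac_boundary \<alpha> \<Omega> / real (card \<Omega>)) \<and>
     (\<forall>k::nat. 1 \<le> k \<and> real k \<le> min 1 (V / 2 ^ (d + 1)) * real (card \<Omega>) \<longrightarrow>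
        ev (k + 1) \<le>
          (2 * pi) powr \<alpha> * (real d * 2 powr ((real d + \<alpha>) / real d) / (real d + \<alpha>))
              * (real k / (V * real (card \<Omega>))) powr (\<alpha> / real d)
            + 2 * (frac_boundary \<alpha> \<Omega> / real (card \<Omega>))) \<and>
     (\<forall>k::nat. 1 \<le> k \<and>
          real k \<le> min 1 ((2 powr (1 - 1 / \<alpha>) * sqrt 3 / (2 * pi)) ^ d * V) * real (card \<Omega>) \<longrightarrow>
        ev k \<ge> (1 / real k) * (\<Sum>i=1..k. ev i) \<and>
        (1 / real k) * (\<Sum>i=1..k. ev i) \<ge>
          (2 * pi) powr \<alpha> * (real d / (real d + \<alpha>))
              * (real k / (V * real (card \<Omega>))) powr (\<alpha> / real d)
            - (2 * pi) powr (2 * \<alpha>) * (1 / 12) powr (\<alpha> / 2) * (real d / (real d + 2 * \<alpha>))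
              * (real k / (V * real (card \<Omega>))) powr (2 * \<alpha> / real d))"
proof -
  define n where "n = card \<Omega>"
  from symmetric_eigenbasis[where M = "frac_matrix \<alpha>", OF \<Omega>(1) frac_matrix_sym] obtain e l where
    E: "eigen_seq \<Omega> (frac_matrix \<alpha>) (card \<Omega>) e l"
    and complete: "\<forall>x\<in>\<Omega>. \<forall>y\<in>\<Omega>. (\<Sum>j<card \<Omega>. e j x * e j y) = of_bool (x = y)"
    by blast
  note E' = E[unfolded eigen_seq_def, THEN conjunct1, rule_format]
    E[unfolded eigen_seq_def, THEN conjunct2, THEN conjunct1, rule_format]
    E[unfolded eigen_seq_def, THEN conjunct2, THEN conjunct2, THEN conjunct1, rule_format]
    E[unfolded eigen_seq_def, THEN conjunct2, THEN conjunct2, THEN conjunct2, THEN conjunct1, rule_format]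
  interpret dirichlet_basis \<Omega> \<alpha> e l V
    by unfold_locales (fact V \<Omega> \<alpha> | rule E' complete[rule_format]; assumption)+
  have spec: "dirichlet_spectrum \<alpha> \<Omega> = mset (map l [0..<card \<Omega>])"
    by (rule dirichlet_spectrum_eq[OF \<Omega>(1), where M = "frac_matrix \<alpha>" and e = e])
       (rule frac_matrix_sym frac_laplacian_eq[OF \<alpha> \<Omega>(1)] E' complete[rule_format]; assumption?)+
  have ev_l: "ev (Suc i) = l i" if "i < card \<Omega>" for i
    unfolding ev by (rule dirichlet_eigenvalue_eq[OF spec mono that])
  have sum_ev: "(\<Sum>i=1..k. ev i) = (\<Sum>j<k. l j)" if "k \<le> card \<Omega>" for k
    using that by (simp add: sum.atLeast1_atMost_eq ev_l)
  show ?thesis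
  proof (intro conjI allI impI; elim conjE)
    fix k :: nat assume k: "1 \<le> k" "real k \<le> min 1 (V / 2 ^ d) * real (card \<Omega>)"
    show "(1 / real k) * (\<Sum>i=1..k. ev i) \<le>
          (2 * pi) powr \<alpha> * (real d / (real d + \<alpha>))
              * (real k / (V * real (card \<Omega>))) powr (\<alpha> / real d)
            + frac_boundary \<alpha> \<Omega> / real (card \<Omega>)"
      using average_upper[OF k[unfolded d]] sum_ev[OF le_card_if[OF k(2)]]
      by (simp add: radius_powr d mult_ac)
  next
    fix k :: nat assume k: "1 \<le> k" "real k \<le> min 1 (V / 2 ^ (d + 1)) * real (card \<Omega>)"
    \<comment> \<open>Doubling k inside the power yields 2^{\<alpha>/d}; the other factor 2 comes
      from the passage from an average to a single eigenvalue. Together they form the constant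
      2^{(d+\<alpha>)/d}.\<close>
    have "(real (2 * k) / (V * real (card \<Omega>))) powr (\<alpha> / real d) =
        2 powr (\<alpha> / real d) * (real k / (V * real (card \<Omega>))) powr (\<alpha> / real d)"
      by (simp flip: powr_mult)
    moreover have "2 powr ((real d + \<alpha>) / real d) = 2 * 2 powr (\<alpha> / real d)"
      using d by (simp add: add_divide_distrib powr_add)
    ultimately show "ev (k + 1) \<le>
          (2 * pi) powr \<alpha> * (real d * 2 powr ((real d + \<alpha>) / real d) / (real d + \<alpha>))
              * (real k / (V * real (card \<Omega>))) powr (\<alpha> / real d)
            + 2 * (frac_boundary \<alpha> \<Omega> / real (card \<Omega>))"
      using next_eigenvalue_upper[OF k[unfolded d]] ev_l[of k] by (simp add: radius_powr d mult_ac)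
  next
    fix k :: nat
    assume k: "1 \<le> k" "real k \<le> min 1 ((2 powr (1 - 1 / \<alpha>) * sqrt 3 / (2 * pi)) ^ d * V) * real (card \<Omega>)"
    have kn: "k \<le> card \<Omega>" by (rule le_card_if[OF k(2)])
    have "ev k = l (k - 1)" using ev_l[of "k - 1"] k(1) kn by simp
    then show "ev k \<ge> (1 / real k) * (\<Sum>i=1..k. ev i)"
      using average_le_last[OF k(1) kn] sum_ev[OF kn] by simp
    show "(1 / real k) * (\<Sum>i=1..k. ev i) \<ge>
          (2 * pi) powr \<alpha> * (real d / (real d + \<alpha>))
              * (real k / (V * real (card \<Omega>))) powr (\<alpha> / real d)
            - (2 * pi) powr (2 * \<alpha>) * (1 / 12) powr (\<alpha> / 2) * (real d / (real d + 2 * \<alpha>))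
              * (real k / (V * real (card \<Omega>))) powr (2 * \<alpha> / real d)"
      using average_lower[OF k[unfolded d]] sum_ev[OF kn] by (simp add: radius_powr d mult_ac)
  qed
qed

end
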